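(* Let $X$ be a complex manifold of dimension $n\ge2$, $f$ a holomorphic function on $X$ with Bernstein-Sato polynomial $b_f(s)$. Let $\alpha\in\mathbb{Q}_{>0}$, and write $\alpha=\beta+j$ with $\beta\in(0,1]\cap\mathbb{Q}$ and $j\in\mathbb{N}=\{0,1,2,\dots\}$. Set $$\widetilde{m}_\beta:=\min\{k\in\mathbb{N}\mid N^k\widetilde{M}_f^\beta=0\}.$$ Assume that $-\alpha$ is a root of $b_f(s)$ with the maximal multiplicity $\widetilde{m}_\beta$. Then $\mathcal{D}_Xf^{-\alpha}\ne\mathcal{D}_Xf^{-\alpha+1}$.
   Context: $f$ is not identically zero on any connected component of $X$; $Z:=f^{-1}(0)$, $\mathcal{O}_X( *Z):=\mathcal{O}_X[\frac1f]$. For $\alpha\in\mathbb{Q}$, $\mathcal{O}_X( *Z)f^{-\alpha}$ is the free rank one $\mathcal{O}_X( *Z)$-module on the symbol $f^{-\alpha}$ on which a vector field $\xi$ acts by $\xi(gf^{-\alpha})=(\xi(g)-\alpha g\,\xi(f)/f)f^{-\alpha}$; $\mathcal{D}_Xf^{-\alpha}$ is the $\mathcal{D}_X$-submodule generated by $f^{-\alpha}$. It contains $\mathcal{D}_Xf^{-\alpha+1}$, where $f^{-\alpha+1}=f\cdot f^{-\alpha}$. The Bernstein-Sato polynomial $b_f(s)$ is the monic polynomial of minimal degree satisfying $b_f(s)f^s=Pf^{s+1}$ with $P\in\mathcal{D}_X[s]$ (it exists at least locally on $X$; $X$ is assumed such that it exists and that $N$ below is nilpotent, which also holds at least locally). Graph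 embedding: $i_f:X\hookrightarrow Y:=X\times\mathbb{C}$, $x\mapsto(x,f(x))$, with $t$ the coordinate of $\mathbb{C}$. $M_f:=(i_f)_*^{\mathcal{D}}\mathcal{O}_X$ is the $\mathcal{D}$-module direct image: $M_f=\mathcal{O}_X[\partial_t]\,\delta(t-f)$ with $\partial_{x_i}\delta(t-f)=-(\partial_{x_i}f)\partial_t\delta(t-f)$ and $t\,\delta(t-f)=f\,\delta(t-f)$ (sheaf-theoretic direct images by $i_f$ are omitted). Put $s:=-\partial_tt$. $V$-filtration: for a regular holonomic $\mathcal{D}_Y$-module $M$, $V$ is the unique exhaustive decreasing filtration of Kashiwara and Malgrange indexed (discretely, left-continuously) by $\mathbb{Q}$ such that (a) $tV^\alpha M\subset V^{\alpha+1}M$ (with equality for $\alpha\gg0$) and $\partial_tV^\alpha M\subset V^{\alpha-1}M$; (b) $\partial_tt-\alpha$ is locally nilpotent on $\mathrm{Gr}_V^\alpha M:=V^\alpha M/V^{>\alpha}M$; (c) each $V^\alpha M$ is locally finitely generated over $V^0\mathcal{D}_Y$, the subring of $\mathcal{D}_Y$ generated by $\mathcal{O}_Y$ and $\mathcal{D}_X[s]$. Set $M_f^\alpha:=\mathrm{Gr}_V^\alpha M_f$, a $\mathcal{D}_X$-module. On $M_f^\beta$ put $N:=s+\beta=-\partial_tt+\beta$. Set $\widetilde{M}_f^\beta:=M_f^\beta$ if $\beta\in(0,1)$ and $\widetilde{M}_f^1:=M_f^1/\mathrm{Ker}\,N$, with the induced endomorphism $N$. *)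

theory Defs
  imports
    "HOL-Analysis.Analysis"
    "HOL-Computational_Algebra.Polynomial"
    "HOL-Library.Function_Algebras"
begin

section \<open>Complex manifolds\<close>

type_synonym ('a, 'n) chart = "'a set \<times> ('a \<Rightarrow> complex ^ 'n)"

definition cdiff_at :: "(complex ^ 'n::finite \<Rightarrow> complex) \<Rightarrow> complex ^ 'n \<Rightarrow> bool" where
  "cdiff_at g z \<longleftrightarrow>
     (\<exists>L. (g has_derivative L) (at z) \<and> (\<forall>c v. L (c *s v) = c * L v))"

definition cdiff_at_prod ::
  "((complex ^ 'n::finite) \<times> complex \<Rightarrow> complex) \<Rightarrow> (complex ^ 'n) \<times> complex \<Rightarrow> bool" where
  "cdiff_at_prod G p \<longleftrightarrow>
     (\<exists>L. (G has_derivative L) (at p) \<and> (\<forall>c v w. L (c *s v, c * w) = c * L (v, w)))"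

definition complex_atlas ::
  "('a::{t2_space, second_countable_topology}, 'n::finite) chart set \<Rightarrow> bool" where
  "complex_atlas A \<longleftrightarrow>
     (\<Union>(D, \<phi>)\<in>A. D) = UNIV \<and>
     (\<forall>(D, \<phi>)\<in>A. open D \<and> open (\<phi> ` D) \<and> homeomorphism D (\<phi> ` D) \<phi> (inv_into D \<phi>)) \<and>
     (\<forall>(D, \<phi>)\<in>A. \<forall>(E, \<psi>)\<in>A. \<forall>z\<in>\<phi> ` (D \<inter> E). \<forall>i.
        cdiff_at (\<lambda>w. \<psi> (inv_into D \<phi> w) $ i) z)"

definition hol_at :: "('a::topological_space, 'n::finite) chart set \<Rightarrow> ('a \<Rightarrow> complex) \<Rightarrow> 'a \<Rightarrow> bool" where
  "hol_at A g y \<longleftrightarrow> (\<forall>(D, \<phi>)\<in>A. y \<in> D \<longrightarrow> cdiff_at (\<lambda>z. g (inv_into D \<phi> z)) (\<phi> y))"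

text \<open>
  Sheaves are handled through their stalks. A germ at \<open>x\<close> is represented by a total function,
  only its behaviour near \<open>x\<close> being relevant; a subsheaf is the family of its stalks.
\<close>

definition O_stalk :: "('a::topological_space, 'n::finite) chart set \<Rightarrow> 'a \<Rightarrow> ('a \<Rightarrow> complex) set" where
  "O_stalk A x = {g. \<forall>\<^sub>F y in nhds x. hol_at A g y}"

text \<open>The stalk at \<open>(x, c)\<close> of the sheaf of holomorphic functions on \<open>X \<times> \<complex>\<close>.\<close>

definition O_prod_stalk ::
  "('a::topological_space, 'n::finite) chart set \<Rightarrow> 'a \<times> complex \<Rightarrow> ('a \<times> complex \<Rightarrow> complex) set" where
  "O_prod_stalk A p = {G. \<forall>\<^sub>F q in nhds p. \<forall>(D, \<phi>)\<in>A. fst q \<in> D \<longrightarrow>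
      cdiff_at_prod (\<lambda>(z, t). G (inv_into D \<phi> z, t)) (\<phi> (fst q), snd q)}"

text \<open>The coordinate vector field \<open>\<partial>\<close>/\<open>\<partial>x\<^sub>i\<close> of a chart.\<close>

definition pd :: "('a, 'n::finite) chart \<Rightarrow> 'n \<Rightarrow> ('a \<Rightarrow> complex) \<Rightarrow> 'a \<Rightarrow> complex" where
  "pd c i g y = (case c of (D, \<phi>) \<Rightarrow> deriv (\<lambda>w. g (inv_into D \<phi> (\<phi> y + axis i w))) 0)"


section \<open>Rings of operators\<close>

text \<open>The subring (with unit) of the additive operators generated by a set of operators.\<close>

inductive_set ring_gen :: "('m::ab_group_add \<Rightarrow> 'm) set \<Rightarrow> ('m \<Rightarrow> 'm) set"
  for S :: "('m \<Rightarrow> 'm) set" where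
  one: "(\<lambda>u. u) \<in> ring_gen S"
| gen: "P \<in> S \<Longrightarrow> P \<in> ring_gen S"
| diff: "P \<in> ring_gen S \<Longrightarrow> Q \<in> ring_gen S \<Longrightarrow> (\<lambda>u. P u - Q u) \<in> ring_gen S"
| comp: "P \<in> ring_gen S \<Longrightarrow> Q \<in> ring_gen S \<Longrightarrow> (\<lambda>u. P (Q u)) \<in> ring_gen S"

text \<open>
  The stalk of \<open>\<D>\<^sub>X\<close> at \<open>x\<close> is generated by the germs of holomorphic functions and by the coordinate
  vector fields at \<open>x\<close>. For a \<open>\<D>\<^sub>X\<close>-module on which functions act by \<open>mul\<close> and the coordinate
  vector fields by \<open>dx\<close>, these are the operators by which the generators act.
\<close>

definition D_gens ::
  "('a::topological_space, 'n::finite) chart set \<Rightarrow> (('a \<Rightarrow> complex) \<Rightarrow> 'm \<Rightarrow> 'm) \<Rightarrow>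
   (('a, 'n) chart \<Rightarrow> 'n \<Rightarrow> 'm \<Rightarrow> 'm) \<Rightarrow> 'a \<Rightarrow> ('m \<Rightarrow> 'm) set" where
  "D_gens A mul dx x = {mul g | g. g \<in> O_stalk A x} \<union> {dx c i | c i. c \<in> A \<and> x \<in> fst c}"

text \<open>
  \<open>u :: nat \<Rightarrow> 'a \<Rightarrow> complex\<close> stands for a polynomial \<open>\<Sum>\<^sub>k u\<^sub>k T\<^sup>k\<close> with functions as coefficients, in the
  variable \<open>T = s\<close> for \<open>\<O>\<^sub>X(*Z)[s] f\<^sup>s\<close> and \<open>T = \<partial>\<^sub>t\<close> for \<open>\<O>\<^sub>X[\<partial>\<^sub>t] \<delta>(t-f)\<close>.
\<close>

definition pmul :: "('a \<Rightarrow> complex) \<Rightarrow> (nat \<Rightarrow> 'a \<Rightarrow> complex) \<Rightarrow> nat \<Rightarrow> 'a \<Rightarrow> complex" where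
  "pmul g u = (\<lambda>k y. g y * u k y)"

definition pshift :: "(nat \<Rightarrow> 'a \<Rightarrow> complex) \<Rightarrow> nat \<Rightarrow> 'a \<Rightarrow> complex" where
  "pshift u = (\<lambda>k y. if k = 0 then 0 else u (k - 1) y)"

definition pconst :: "('a \<Rightarrow> complex) \<Rightarrow> nat \<Rightarrow> 'a \<Rightarrow> complex" where
  "pconst g = (\<lambda>k y. if k = 0 then g y else 0)"


section \<open>The modules \<open>\<D>\<^sub>X f\<^sup>-\<^sup>\<alpha>\<close> and the Bernstein-Sato polynomial\<close>

text \<open>
  The germ \<open>g f\<^sup>-\<^sup>\<alpha>\<close> of \<open>\<O>\<^sub>X(*Z) f\<^sup>-\<^sup>\<alpha>\<close> is represented by \<open>g\<close>. Since \<open>Z\<close> is nowhere dense, germs of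
  \<open>\<O>\<^sub>X(*Z)\<close> are determined by their values off \<open>Z\<close>, and only these values are meaningful.
\<close>

definition germ_eq_off :: "('a::topological_space \<Rightarrow> complex) \<Rightarrow> 'a \<Rightarrow> ('a \<Rightarrow> complex) \<Rightarrow> ('a \<Rightarrow> complex) \<Rightarrow> bool" where
  "germ_eq_off f x u v \<longleftrightarrow> (\<forall>\<^sub>F y in nhds x. f y \<noteq> 0 \<longrightarrow> u y = v y)"

definition pow_dx :: "('a \<Rightarrow> complex) \<Rightarrow> rat \<Rightarrow> ('a, 'n::finite) chart \<Rightarrow> 'n \<Rightarrow> ('a \<Rightarrow> complex) \<Rightarrow> 'a \<Rightarrow> complex" where
  "pow_dx f \<alpha> c i g = (\<lambda>y. pd c i g y - of_rat \<alpha> * g y * pd c i f y / f y)"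

text \<open>
  The stalk at \<open>x\<close> of the \<open>\<D>\<^sub>X\<close>-submodule of \<open>\<O>\<^sub>X(*Z) f\<^sup>-\<^sup>\<alpha>\<close> generated by \<open>g f\<^sup>-\<^sup>\<alpha>\<close>. Thus
  \<open>\<D>\<^sub>X f\<^sup>-\<^sup>\<alpha>\<close> is the case \<open>g = 1\<close> and \<open>\<D>\<^sub>X f\<^sup>-\<^sup>\<alpha>\<^sup>+\<^sup>1\<close> is the case \<open>g = f\<close>.
\<close>

definition D_pow ::
  "('a::topological_space, 'n::finite) chart set \<Rightarrow> ('a \<Rightarrow> complex) \<Rightarrow> rat \<Rightarrow> ('a \<Rightarrow> complex) \<Rightarrow> 'a \<Rightarrow> ('a \<Rightarrow> complex) set" where
  "D_pow A f \<alpha> g x =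
     {u. \<exists>P\<in>ring_gen (D_gens A (*) (pow_dx f \<alpha>) x). germ_eq_off f x u (P g)}"

text \<open>\<open>\<partial>\<^sub>i(g f\<^sup>s) = (\<partial>\<^sub>i g + s g \<partial>\<^sub>i f / f) f\<^sup>s\<close> on \<open>\<O>\<^sub>X(*Z)[s] f\<^sup>s\<close>.\<close>

definition fs_dx :: "('a \<Rightarrow> complex) \<Rightarrow> ('a, 'n::finite) chart \<Rightarrow> 'n \<Rightarrow> (nat \<Rightarrow> 'a \<Rightarrow> complex) \<Rightarrow> nat \<Rightarrow> 'a \<Rightarrow> complex" where
  "fs_dx f c i u = (\<lambda>k y. pd c i (u k) y + pd c i f y / f y * pshift u k y)"

definition Ds_ops :: "('a::topological_space, 'n::finite) chart set \<Rightarrow> ('a \<Rightarrow> complex) \<Rightarrow> 'a \<Rightarrow>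
    ((nat \<Rightarrow> 'a \<Rightarrow> complex) \<Rightarrow> (nat \<Rightarrow> 'a \<Rightarrow> complex)) set" where
  "Ds_ops A f x = ring_gen (D_gens A pmul (fs_dx f) x \<union> {pshift})"

text \<open>
  \<open>b(s) f\<^sup>s = P f\<^sup>s\<^sup>+\<^sup>1\<close> with \<open>P\<close> a local section of the sheaf \<open>\<D>\<^sub>X[s]\<close> near each point, i.e.
  \<open>b(s) f\<^sup>s\<close> is a section of the subsheaf \<open>\<D>\<^sub>X[s] f\<^sup>s\<^sup>+\<^sup>1\<close>.
\<close>

definition b_equation :: "('a::topological_space, 'n::finite) chart set \<Rightarrow> ('a \<Rightarrow> complex) \<Rightarrow> complex poly \<Rightarrow> bool" where
  "b_equation A f b \<longleftrightarrow> (\<forall>x. \<exists>P\<in>Ds_ops A f x. \<forall>\<^sub>F y in nhds x. f y \<noteq> 0 \<longrightarrow>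
      (\<forall>k. coeff b k = P (pconst f) k y))"

definition is_bernstein_sato_poly ::
  "('a::topological_space, 'n::finite) chart set \<Rightarrow> ('a \<Rightarrow> complex) \<Rightarrow> complex poly \<Rightarrow> bool" where
  "is_bernstein_sato_poly A f b \<longleftrightarrow>
     lead_coeff b = 1 \<and> b_equation A f b \<and>
     (\<forall>b'. lead_coeff b' = 1 \<and> b_equation A f b' \<longrightarrow> degree b \<le> degree b')"


section \<open>The module \<open>M\<^sub>f\<close> and its \<open>V\<close>-filtration\<close>

definition Mf :: "('a::topological_space, 'n::finite) chart set \<Rightarrow> 'a \<Rightarrow> (nat \<Rightarrow> 'a \<Rightarrow> complex) set" where
  "Mf A x = {u. (\<forall>k. u k \<in> O_stalk A x) \<and> (\<exists>K. \<forall>\<^sub>F y in nhds x. \<forall>k>K. u k y = 0)}"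

definition germ_eq :: "'a::topological_space \<Rightarrow> (nat \<Rightarrow> 'a \<Rightarrow> complex) \<Rightarrow> (nat \<Rightarrow> 'a \<Rightarrow> complex) \<Rightarrow> bool" where
  "germ_eq x u v \<longleftrightarrow> (\<forall>\<^sub>F y in nhds x. \<forall>k. u k y = v k y)"

abbreviation Mf_dt :: "(nat \<Rightarrow> 'a \<Rightarrow> complex) \<Rightarrow> nat \<Rightarrow> 'a \<Rightarrow> complex" where
  "Mf_dt \<equiv> pshift"

text \<open>\<open>t h \<partial>\<^sub>t\<^sup>k \<delta>(t-f) = f h \<partial>\<^sub>t\<^sup>k \<delta>(t-f) - k h \<partial>\<^sub>t\<^sup>k\<^sup>-\<^sup>1 \<delta>(t-f)\<close>.\<close>

definition Mf_t :: "('a \<Rightarrow> complex) \<Rightarrow> (nat \<Rightarrow> 'a \<Rightarrow> complex) \<Rightarrow> nat \<Rightarrow> 'a \<Rightarrow> complex" where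
  "Mf_t f u = (\<lambda>k y. f y * u k y - of_nat (Suc k) * u (Suc k) y)"

definition Mf_dx :: "('a \<Rightarrow> complex) \<Rightarrow> ('a, 'n::finite) chart \<Rightarrow> 'n \<Rightarrow> (nat \<Rightarrow> 'a \<Rightarrow> complex) \<Rightarrow> nat \<Rightarrow> 'a \<Rightarrow> complex" where
  "Mf_dx f c i u = (\<lambda>k y. pd c i (u k) y - pd c i f y * Mf_dt u k y)"

text \<open>
  A function \<open>G(x,t)\<close> acts by
  \<open>G h \<partial>\<^sub>t\<^sup>k \<delta>(t-f) = \<Sum>\<^sub>j (-1)\<^sup>j (k choose j) h (\<partial>\<^sub>t\<^sup>j G)(x, f(x)) \<partial>\<^sub>t\<^sup>k\<^sup>-\<^sup>j \<delta>(t-f)\<close>;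
  the sum below is the coefficient of \<open>\<partial>\<^sub>t\<^sup>m\<close>, with \<open>k = m + j\<close>.
\<close>

definition Mf_mulY ::
  "('a \<Rightarrow> complex) \<Rightarrow> ('a \<times> complex \<Rightarrow> complex) \<Rightarrow> (nat \<Rightarrow> 'a \<Rightarrow> complex) \<Rightarrow> nat \<Rightarrow> 'a \<Rightarrow> complex" where
  "Mf_mulY f G u = (\<lambda>m y. \<Sum>j | u (m + j) y \<noteq> 0.
      (-1) ^ j * of_nat ((m + j) choose j) * (deriv ^^ j) (\<lambda>t. G (y, t)) (f y) * u (m + j) y)"

definition Mf_s :: "('a \<Rightarrow> complex) \<Rightarrow> (nat \<Rightarrow> 'a \<Rightarrow> complex) \<Rightarrow> nat \<Rightarrow> 'a \<Rightarrow> complex" where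
  "Mf_s f u = - Mf_dt (Mf_t f u)"

text \<open>The stalk of \<open>V\<^sup>0 \<D>\<^sub>Y\<close> at \<open>(x, f(x))\<close>, acting on \<open>M\<^sub>f\<close>.\<close>

definition V0_ops :: "('a::topological_space, 'n::finite) chart set \<Rightarrow> ('a \<Rightarrow> complex) \<Rightarrow> 'a \<Rightarrow>
    ((nat \<Rightarrow> 'a \<Rightarrow> complex) \<Rightarrow> (nat \<Rightarrow> 'a \<Rightarrow> complex)) set" where
  "V0_ops A f x = ring_gen
     ({Mf_mulY f G | G. G \<in> O_prod_stalk A (x, f x)} \<union> D_gens A pmul (Mf_dx f) x \<union> {Mf_s f})"

text \<open>
  Quotients \<open>U/B\<close> of groups of germs, as sets of cosets, and the endomorphism induced by \<open>T\<close>. All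
  \<open>B\<close> used below are closed under equality of germs.
\<close>

definition coset :: "'m::ab_group_add set \<Rightarrow> 'm \<Rightarrow> 'm set" where
  "coset B u = {v. v - u \<in> B}"

definition quot :: "'m::ab_group_add set \<Rightarrow> 'm set \<Rightarrow> 'm set set" where
  "quot U B = coset B ` U"

definition induced :: "'m::ab_group_add set \<Rightarrow> ('m \<Rightarrow> 'm) \<Rightarrow> 'm set \<Rightarrow> 'm set" where
  "induced B T \<xi> = (\<Union>u\<in>\<xi>. coset B (T u))"

type_synonym 'a filtration = "rat \<Rightarrow> 'a \<Rightarrow> (nat \<Rightarrow> 'a \<Rightarrow> complex) set"

definition V_gt :: "'a filtration \<Rightarrow> rat \<Rightarrow> 'a \<Rightarrow> (nat \<Rightarrow> 'a \<Rightarrow> complex) set" where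
  "V_gt V \<alpha> x = (\<Union>\<gamma>\<in>{\<alpha><..}. V \<gamma> x)"

definition Gr :: "'a filtration \<Rightarrow> rat \<Rightarrow> 'a \<Rightarrow> (nat \<Rightarrow> 'a \<Rightarrow> complex) set set" where
  "Gr V \<alpha> x = quot (V \<alpha> x) (V_gt V \<alpha> x)"

definition V0_submodule :: "('a::topological_space, 'n::finite) chart set \<Rightarrow> ('a \<Rightarrow> complex) \<Rightarrow>
    ('a \<Rightarrow> (nat \<Rightarrow> 'a \<Rightarrow> complex) set) \<Rightarrow> bool" where
  "V0_submodule A f W \<longleftrightarrow> (\<forall>x.
     W x \<subseteq> Mf A x \<and> 0 \<in> W x \<and>
     (\<forall>u\<in>W x. \<forall>v. germ_eq x u v \<longrightarrow> v \<in> W x) \<and>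
     (\<forall>u\<in>W x. \<forall>\<^sub>F y in nhds x. u \<in> W y) \<and>
     (\<forall>u\<in>W x. \<forall>v\<in>W x. u - v \<in> W x) \<and>
     (\<forall>P\<in>V0_ops A f x. \<forall>u\<in>W x. P u \<in> W x))"

definition V0_locally_fg :: "('a::topological_space, 'n::finite) chart set \<Rightarrow> ('a \<Rightarrow> complex) \<Rightarrow>
    ('a \<Rightarrow> (nat \<Rightarrow> 'a \<Rightarrow> complex) set) \<Rightarrow> bool" where
  "V0_locally_fg A f W \<longleftrightarrow> (\<forall>x. \<exists>G. finite G \<and> (\<forall>\<^sub>F y in nhds x. W y =
     {u. \<exists>P. (\<forall>g\<in>G. P g \<in> V0_ops A f y) \<and> germ_eq y u (\<Sum>g\<in>G. P g g)}))"

text \<open>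
  The filtration of Kashiwara and Malgrange on \<open>M\<^sub>f\<close>. The third clause expresses that it is indexed
  discretely and left-continuously: locally \<open>V\<^sup>\<gamma>\<close> is constant for \<open>\<gamma>\<close> in \<open>((i-1)/m, i/m]\<close>.
\<close>

definition is_V_filtration ::
  "('a::topological_space, 'n::finite) chart set \<Rightarrow> ('a \<Rightarrow> complex) \<Rightarrow> 'a filtration \<Rightarrow> bool" where
  "is_V_filtration A f V \<longleftrightarrow>
     (\<forall>\<gamma>. V0_submodule A f (V \<gamma>)) \<and>
     (\<forall>\<gamma> \<gamma>' x. \<gamma> \<le> \<gamma>' \<longrightarrow> V \<gamma>' x \<subseteq> V \<gamma> x) \<and>
     (\<forall>x. \<exists>m::nat. m > 0 \<and> (\<forall>\<^sub>F y in nhds x. \<forall>\<gamma>.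
        V \<gamma> y = V (of_int \<lceil>of_nat m * \<gamma>\<rceil> / of_nat m) y)) \<and>
     (\<forall>x. (\<Union>\<gamma>. V \<gamma> x) = Mf A x) \<and>
     (\<forall>\<gamma> x. Mf_t f ` V \<gamma> x \<subseteq> V (\<gamma> + 1) x) \<and>
     (\<forall>x. \<exists>\<gamma>\<^sub>0. \<forall>\<^sub>F y in nhds x. \<forall>\<gamma>\<ge>\<gamma>\<^sub>0.
        V (\<gamma> + 1) y = {v. \<exists>u\<in>V \<gamma> y. germ_eq y v (Mf_t f u)}) \<and>
     (\<forall>\<gamma> x. Mf_dt ` V \<gamma> x \<subseteq> V (\<gamma> - 1) x) \<and>
     (\<forall>\<gamma> x. \<forall>\<xi>\<in>Gr V \<gamma> x. \<exists>k.
        (induced (V_gt V \<gamma> x) (\<lambda>u. Mf_dt (Mf_t f u) - pmul (\<lambda>_. of_rat \<gamma>) u) ^^ k) \<xi> = V_gt V \<gamma> x) \<and>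
     (\<forall>\<gamma>. V0_locally_fg A f (V \<gamma>))"


section \<open>The endomorphism \<open>N\<close>\<close>

definition N_op :: "('a \<Rightarrow> complex) \<Rightarrow> rat \<Rightarrow> (nat \<Rightarrow> 'a \<Rightarrow> complex) \<Rightarrow> nat \<Rightarrow> 'a \<Rightarrow> complex" where
  "N_op f \<beta> u = Mf_s f u + pmul (\<lambda>_. of_rat \<beta>) u"

definition N_nilpotent :: "('a \<Rightarrow> complex) \<Rightarrow> 'a filtration \<Rightarrow> rat \<Rightarrow> bool" where
  "N_nilpotent f V \<beta> \<longleftrightarrow> (\<exists>k. \<forall>x. \<forall>\<xi>\<in>Gr V \<beta> x.
     (induced (V_gt V \<beta> x) (N_op f \<beta>) ^^ k) \<xi> = V_gt V \<beta> x)"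

text \<open>
  The preimage in \<open>V\<^sup>1 M\<^sub>f\<close> of the kernel of \<open>N\<close> on \<open>M\<^sub>f\<^sup>1\<close>; the quotient of \<open>V\<^sup>1 M\<^sub>f\<close> by it is
  \<open>M\<^sub>f\<^sup>1 / Ker N\<close>.
\<close>

definition Ker_N1 :: "('a \<Rightarrow> complex) \<Rightarrow> 'a filtration \<Rightarrow> 'a \<Rightarrow> (nat \<Rightarrow> 'a \<Rightarrow> complex) set" where
  "Ker_N1 f V x = {u \<in> V 1 x.
     induced (V_gt V 1 x) (N_op f 1) (coset (V_gt V 1 x) u) = V_gt V 1 x}"

definition Mt_den :: "('a \<Rightarrow> complex) \<Rightarrow> 'a filtration \<Rightarrow> rat \<Rightarrow> 'a \<Rightarrow> (nat \<Rightarrow> 'a \<Rightarrow> complex) set" where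
  "Mt_den f V \<beta> x = (if \<beta> = 1 then Ker_N1 f V x else V_gt V \<beta> x)"

definition Mt :: "('a \<Rightarrow> complex) \<Rightarrow> 'a filtration \<Rightarrow> rat \<Rightarrow> 'a \<Rightarrow> (nat \<Rightarrow> 'a \<Rightarrow> complex) set set" where
  "Mt f V \<beta> x = quot (V \<beta> x) (Mt_den f V \<beta> x)"

definition m_tilde :: "('a \<Rightarrow> complex) \<Rightarrow> 'a filtration \<Rightarrow> rat \<Rightarrow> nat" where
  "m_tilde f V \<beta> = (LEAST k. \<forall>x. \<forall>\<xi>\<in>Mt f V \<beta> x.
     (induced (Mt_den f V \<beta> x) (N_op f \<beta>) ^^ k) \<xi> = Mt_den f V \<beta> x)"

end

theory Submission
  imports Defs "HOL-Complex_Analysis.Conformal_Mappings"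
begin

text \<open>
  If \<open>\<D>\<^sub>X f\<^sup>-\<^sup>\<alpha> = \<D>\<^sub>X f\<^sup>-\<^sup>\<alpha>\<^sup>+\<^sup>1\<close>, then near each point \<open>\<delta> = P t \<delta> + (s + \<alpha>) w\<close> in \<open>M\<^sub>f\<close> with \<open>P \<in> \<D>\<^sub>X\<close>, since
  for \<open>\<alpha> > 0\<close> the quotient \<open>M\<^sub>f / (s + \<alpha>) M\<^sub>f\<close> embeds into \<open>\<O>\<^sub>X(*Z) f\<^sup>-\<^sup>\<alpha>\<close>. Let \<open>m\<close> be the multiplicity of
  \<open>-\<alpha>\<close> and \<open>L = \<D>\<^sub>X[s] \<delta>\<close>. The generalized \<open>-\<alpha>\<close>-eigenspace of \<open>s\<close> on \<open>M\<^sub>f / t L\<close> is a quotient of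
  \<open>Gr\<^sub>V\<^sup>\<alpha> M\<^sub>f = t\<^sup>j Gr\<^sub>V\<^sup>\<beta> M\<^sub>f\<close>, as \<open>t L\<close> contains \<open>V\<^sup>\<gamma> M\<^sub>f\<close> for \<open>\<gamma>\<close> large. It is killed by \<open>(s + \<alpha>)\<^sup>m\<close>; for
  \<open>\<beta> = 1\<close>, \<open>j > 0\<close> this uses that the kernel of \<open>N\<close> on \<open>M\<^sub>f\<^sup>1\<close> comes from \<open>L\<close>, so that its image under \<open>t\<^sup>j\<close>
  comes from \<open>t L\<close>. Hence \<open>(s + \<alpha>)\<^sup>m w\<close> has no \<open>-\<alpha>\<close>-part modulo \<open>t L\<close>, and neither has
  \<open>(s + \<alpha>)\<^sup>m\<^sup>-\<^sup>1 \<delta>\<close>: a factor \<open>s + \<alpha>\<close> of \<open>b\<^sub>f\<close> is superfluous. For \<open>\<alpha> = 1\<close> instead \<open>\<delta> \<in> t M\<^sub>f\<close>, so that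
  \<open>f\<close> has no zeros and \<open>b\<^sub>f = 1\<close>.
\<close>

text \<open>Everything takes place in one stalk at a time, with representatives compared by
  \<open>germ_eq\<close>; the exponent m is common to all stalks and the equation for b_f is a
  condition on each of them. No eigenspace decomposition is constructed. That an element has no
  -\<alpha>-part modulo t L is expressed by a polynomial r with r(-\<alpha>) nonzero that carries
  the element into t L, and Bezout in \<complex>[s] does the rest. Positivity enters twice: the
  numbers k + \<alpha> have to be nonzero, and t has to map V^\<gamma> onto V^(\<gamma>+1) for
  \<gamma> > 0, which holds as s + 1 = -t \<partial>_t is invertible on the graded pieces in
  question. The value \<alpha> = 1 is exceptional because then j = 0, while at least one factor t is
  needed to carry the kernel of N from L to t L. The technical obstacle is to get V^\<gamma> into t
  L for large \<gamma>: V^\<gamma> is finitely generated over V^0 D_Y, which contains all functions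
  of (x, t), whereas L is by definition only a D_X[s]-module.\<close>

declare plus_fun_apply [simp del] zero_fun_apply [simp del] minus_apply [simp del] uminus_apply [simp del]
lemmas fun_apply = plus_fun_apply zero_fun_apply minus_apply uminus_apply

subsection \<open>Operators on polynomials with functions as coefficients\<close>

lemma pmul_apply: "pmul g u k y = g y * u k y"
  by (simp add: pmul_def)

lemma pshift_apply: "pshift u k y = (if k = 0 then 0 else u (k - 1) y)"
  by (simp add: pshift_def)

lemma Mf_t_apply: "Mf_t f u k y = f y * u k y - of_nat (Suc k) * u (Suc k) y"
  by (simp add: Mf_t_def)

lemma Mf_s_apply: "Mf_s f u k y = of_nat k * u k y - f y * (if k = 0 then 0 else u (k - 1) y)"
  by (cases k) (simp_all add: Mf_s_def pshift_def Mf_t_def fun_apply)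

lemmas op_apply = fun_apply pmul_apply pshift_apply Mf_t_apply Mf_s_apply

lemma Mf_t_dt: "Mf_t f (pshift u) = - Mf_s f u - u"
  by (intro ext) (auto simp: op_apply algebra_simps)

lemma Mf_t_s: "Mf_t f (Mf_s f u) = Mf_s f (Mf_t f u) + Mf_t f u"
  by (intro ext) (auto simp: op_apply algebra_simps)

lemma Mf_dt_t: "pshift (Mf_t f u) = - Mf_s f u"
  by (simp add: Mf_s_def)

lemma pshift_add: "pshift (u + v) = pshift u + pshift v"
  by (intro ext) (auto simp: op_apply)
lemma pshift_pmul: "pshift (pmul g u) = pmul g (pshift u)"
  by (intro ext) (auto simp: op_apply)
lemma Mf_t_diff: "Mf_t f (u - v) = Mf_t f u - Mf_t f v"
  by (intro ext) (auto simp: op_apply algebra_simps)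
lemma Mf_t_add: "Mf_t f (u + v) = Mf_t f u + Mf_t f v"
  by (intro ext) (auto simp: op_apply algebra_simps)
lemma Mf_t_pmul: "Mf_t f (pmul g u) = pmul g (Mf_t f u)"
  by (intro ext) (auto simp: op_apply algebra_simps)
lemma Mf_s_diff: "Mf_s f (u - v) = Mf_s f u - Mf_s f v"
  by (intro ext) (auto simp: op_apply algebra_simps)
lemma Mf_s_add: "Mf_s f (u + v) = Mf_s f u + Mf_s f v"
  by (intro ext) (auto simp: op_apply algebra_simps)
lemma Mf_s_pmul: "Mf_s f (pmul g u) = pmul g (Mf_s f u)"
  by (intro ext) (auto simp: op_apply algebra_simps)
lemma Mf_s_0: "Mf_s f 0 = 0"
  by (intro ext) (auto simp: op_apply)
lemma pmul_diff: "pmul g (u - v) = pmul g u - pmul g v"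
  by (intro ext) (auto simp: op_apply algebra_simps)
lemma pmul_add: "pmul g (u + v) = pmul g u + pmul g v"
  by (intro ext) (auto simp: op_apply algebra_simps)
lemma pmul_0: "pmul g 0 = 0"
  by (intro ext) (auto simp: op_apply algebra_simps)
lemma pmul_pmul: "pmul g (pmul h u) = pmul (\<lambda>y. g y * h y) u"
  by (intro ext) (auto simp: op_apply algebra_simps)
lemma pmul_one: "pmul (\<lambda>_. 1) u = u"
  by (intro ext) (auto simp: op_apply)
lemma pmul_zero: "pmul (\<lambda>_. 0) u = 0"
  by (intro ext) (auto simp: op_apply)

lemma Mf_t_pow_add: "(Mf_t f ^^ n) (u + v) = (Mf_t f ^^ n) u + (Mf_t f ^^ n) v"
  by (induction n) (simp_all only: funpow_0 funpow.simps comp_apply Mf_t_add id_apply)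
lemma Mf_t_pow_diff: "(Mf_t f ^^ n) (u - v) = (Mf_t f ^^ n) u - (Mf_t f ^^ n) v"
  by (induction n) (simp_all only: funpow_0 funpow.simps comp_apply Mf_t_diff id_apply)
lemma Mf_t_pow_pmul: "(Mf_t f ^^ n) (pmul g v) = pmul g ((Mf_t f ^^ n) v)"
  by (induction n) (simp_all only: funpow_0 funpow.simps comp_apply Mf_t_pmul id_apply)


subsection \<open>Polynomials in the operator \<open>s\<close>\<close>

text \<open>Horner evaluation of the \<complex>[s]-module structure. Through it, statements on
  generalized eigenspaces of s become statements on roots of polynomials.\<close>

definition sact :: "('a \<Rightarrow> complex) \<Rightarrow> complex poly \<Rightarrow> (nat \<Rightarrow> 'a \<Rightarrow> complex) \<Rightarrow> nat \<Rightarrow> 'a \<Rightarrow> complex" where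
  "sact f p u = fold_coeffs (\<lambda>a v. pmul (\<lambda>_. a) u + Mf_s f v) p 0"

lemma sact_0 [simp]: "sact f 0 u = 0"
  by (simp add: sact_def)

lemma sact_pCons: "sact f (pCons a p) u = pmul (\<lambda>_. a) u + Mf_s f (sact f p u)"
  by (cases "a = 0 \<and> p = 0")
     (auto simp: sact_def pmul_zero Mf_s_0)

lemma sact_const: "sact f [:c:] u = pmul (\<lambda>_. c) u"
  by (simp add: sact_pCons Mf_s_0)

lemma sact_1: "sact f 1 u = u"
  by (simp add: one_pCons sact_const pmul_one)

lemma sact_linear: "sact f [:c, 1:] u = Mf_s f u + pmul (\<lambda>_. c) u"
  by (simp add: sact_pCons Mf_s_0 pmul_one)

lemma sact_diff_right: "sact f p (u - v) = sact f p u - sact f p v"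
  by (induction p) (simp_all only: sact_pCons pmul_diff Mf_s_diff sact_0 diff_self add_diff_add)

lemma sact_add_right: "sact f p (u + v) = sact f p u + sact f p v"
  by (induction p) (simp_all only: sact_pCons pmul_add Mf_s_add sact_0 add_0 add_ac)

lemma sact_pmul: "sact f p (pmul g u) = pmul g (sact f p u)"
proof (induction p)
  case (pCons a p)
  have "pmul (\<lambda>_. a) (pmul g u) = pmul g (pmul (\<lambda>_. a) u)"
    by (intro ext) (auto simp: op_apply)
  with pCons show ?case by (simp add: sact_pCons pmul_add Mf_s_pmul)
qed (simp add: pmul_0)

lemma pmul_const_add: "pmul (\<lambda>_. a + b) u = pmul (\<lambda>_. a) u + pmul (\<lambda>_. b) u"
  by (intro ext) (auto simp: op_apply algebra_simps)

lemma sact_add: "sact f (p + q) u = sact f p u + sact f q u"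
proof (induction p arbitrary: q)
  case (pCons a p)
  show ?case
  proof (cases q)
    case (pCons b q')
    then show ?thesis using pCons.IH[of q']
      by (simp add: sact_pCons pmul_const_add Mf_s_add algebra_simps)
  qed
qed simp

lemma sact_smult: "sact f (smult c p) u = pmul (\<lambda>_. c) (sact f p u)"
  by (induction p) (simp_all add: sact_pCons pmul_add pmul_pmul pmul_0 Mf_s_pmul)

lemma sact_mult: "sact f (p * q) u = sact f p (sact f q u)"
  by (induction p) (simp_all add: sact_pCons sact_add sact_smult pmul_zero)

lemma sact_power: "sact f (p ^ k) u = (sact f p ^^ k) u"
  by (induction k) (simp_all add: sact_1 sact_mult)

text \<open>Iterates t s = (s + 1) t. Multiplication by t^n carries the -c-part of s to its -(c +
  n)-part, which links \<beta> with \<alpha> = \<beta> + j.\<close>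

lemma Mf_t_pow_linear:
  "(Mf_t f ^^ n) (sact f [:c, 1:] u) = sact f [:c + of_nat n, 1:] ((Mf_t f ^^ n) u)"
proof (induction n)
  case (Suc n)
  have "Mf_t f (sact f [:d, 1:] v) = sact f [:d + 1, 1:] (Mf_t f v)" for d v
    by (simp add: sact_linear Mf_t_add Mf_t_s Mf_t_pmul pmul_const_add pmul_one)
  with Suc show ?case by (simp add: add_ac)
qed simp

lemma Mf_t_pow_linear_power:
  "(Mf_t f ^^ n) (sact f ([:c, 1:] ^ k) u) = sact f ([:c + of_nat n, 1:] ^ k) ((Mf_t f ^^ n) u)"
  by (induction k) (simp_all only: power_0 power_Suc sact_1 sact_mult Mf_t_pow_linear)

lemma poly_split_root: "\<exists>q. p = [:poly p a:] + [:-a, 1:] * q" for p :: "complex poly"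
  using synthetic_div_correct'[of a p] by (metis add.commute)

subsection \<open>Holomorphic functions on a manifold\<close>

definition chart_line :: "('a, 'n::finite) chart \<Rightarrow> 'n \<Rightarrow> 'a \<Rightarrow> complex \<Rightarrow> 'a" where
  "chart_line c i y w = inv_into (fst c) (snd c) (snd c y + axis i w)"

lemma pd_chart_line: "pd c i g y = deriv (\<lambda>w. g (chart_line c i y w)) 0"
  by (simp add: pd_def chart_line_def split: prod.split)

lemma isCont_nhds: "isCont g a \<Longrightarrow> (g \<longlongrightarrow> g a) (nhds a)"
  by (simp add: isCont_def tendsto_at_iff_tendsto_nhds)

lemma has_derivative_axis: "((\<lambda>w. axis i w :: complex ^ 'n::finite) has_derivative (\<lambda>w. axis i w)) F"
proof -
  have "linear (\<lambda>w. axis i w :: complex ^ 'n)"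
    by (intro linearI) (auto simp: vec_eq_iff axis_def)
  then show ?thesis
    by (intro bounded_linear_imp_has_derivative) (simp add: linear_conv_bounded_linear)
qed

locale complex_manifold =
  fixes A :: "('a::{t2_space, second_countable_topology}, 'n::finite) chart set"
  assumes atlas: "complex_atlas A"
begin

lemma chart_open: "c \<in> A \<Longrightarrow> open (fst c)" "c \<in> A \<Longrightarrow> open (snd c ` fst c)"
  and chart_homeo: "c \<in> A \<Longrightarrow> homeomorphism (fst c) (snd c ` fst c) (snd c) (inv_into (fst c) (snd c))"
proof -
  have *: "\<forall>(D, \<phi>)\<in>A. open D \<and> open (\<phi> ` D) \<and> homeomorphism D (\<phi> ` D) \<phi> (inv_into D \<phi>)"
    using atlas unfolding complex_atlas_def by blast
  show "c \<in> A \<Longrightarrow> open (fst c)" "c \<in> A \<Longrightarrow> open (snd c ` fst c)"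
    "c \<in> A \<Longrightarrow> homeomorphism (fst c) (snd c ` fst c) (snd c) (inv_into (fst c) (snd c))"
    using bspec[OF *, of c] by (simp_all add: case_prod_beta)
qed

lemma chart_exists: "\<exists>c\<in>A. y \<in> fst c"
proof -
  have "y \<in> (\<Union>(D, \<phi>)\<in>A. D)" using atlas by (simp add: complex_atlas_def)
  then show ?thesis by force
qed

lemma chart_inv: "c \<in> A \<Longrightarrow> y \<in> fst c \<Longrightarrow> inv_into (fst c) (snd c) (snd c y) = y"
  using chart_homeo by (auto simp: homeomorphism_def)

lemma chart_inv2: "c \<in> A \<Longrightarrow> z \<in> snd c ` fst c \<Longrightarrow> snd c (inv_into (fst c) (snd c) z) = z"
  using chart_homeo by (auto simp: homeomorphism_def)

lemma chart_inv_in: "c \<in> A \<Longrightarrow> z \<in> snd c ` fst c \<Longrightarrow> inv_into (fst c) (snd c) z \<in> fst c"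
  by (rule inv_into_into)

lemma isCont_chart: "c \<in> A \<Longrightarrow> y \<in> fst c \<Longrightarrow> isCont (snd c) y"
  using chart_homeo chart_open by (auto simp: homeomorphism_def continuous_on_eq_continuous_at)

lemma isCont_chart_inv: "c \<in> A \<Longrightarrow> z \<in> snd c ` fst c \<Longrightarrow> isCont (inv_into (fst c) (snd c)) z"
  using chart_homeo chart_open by (auto simp: homeomorphism_def continuous_on_eq_continuous_at)

lemma chart_line_0: "c \<in> A \<Longrightarrow> y \<in> fst c \<Longrightarrow> chart_line c i y 0 = y"
  by (simp add: chart_line_def chart_inv axis_def vec_eq_iff flip: zero_vec_def)

lemma chart_line_tendsto:
  assumes "c \<in> A" "y \<in> fst c"
  shows "filterlim (chart_line c i y) (nhds y) (nhds 0)"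
proof -
  have cont: "isCont (\<lambda>w. snd c y + axis i w) 0"
    by (intro continuous_intros has_derivative_continuous[OF has_derivative_axis])
  have 0: "snd c y + axis i 0 = snd c y" by (simp add: axis_def vec_eq_iff)
  have "isCont (inv_into (fst c) (snd c)) (snd c y + axis i 0)"
    unfolding 0 using assms by (intro isCont_chart_inv) auto
  from isCont_o2[OF cont this] have "isCont (chart_line c i y) 0"
    unfolding chart_line_def .
  from isCont_nhds[OF this] show ?thesis
    by (simp only: chart_line_0[OF assms])
qed

lemma pd_cong:
  assumes "c \<in> A" "y \<in> fst c" "\<forall>\<^sub>F z in nhds y. g z = h z"
  shows "pd c i g y = pd c i h y"
  unfolding pd_chart_line
  using chart_line_tendsto[OF assms(1,2)] assms(3)
  by (intro deriv_cong_ev) (auto simp: filterlim_iff)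

lemma pd_deriv:
  assumes "c \<in> A" "y \<in> fst c" "hol_at A g y"
  shows "((\<lambda>w. g (chart_line c i y w)) has_field_derivative pd c i g y) (at 0)"
proof -
  have "cdiff_at (\<lambda>z. g (inv_into (fst c) (snd c) z)) (snd c y)"
    using assms by (cases c) (auto simp: hol_at_def)
  then obtain L where L: "((\<lambda>z. g (inv_into (fst c) (snd c) z)) has_derivative L) (at (snd c y))"
    and lin: "\<And>a v. L (a *s v) = a * L v"
    by (auto simp: cdiff_at_def)
  have 0: "snd c y + axis i 0 = snd c y" by (simp add: axis_def vec_eq_iff)
  have "((\<lambda>w. snd c y + axis i w) has_derivative (\<lambda>w. axis i w)) (at 0)"
    by (auto intro!: derivative_eq_intros has_derivative_axis)
  then have "((\<lambda>w. g (chart_line c i y w)) has_derivative (\<lambda>w. L (axis i w))) (at 0)"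
    unfolding chart_line_def by (rule has_derivative_compose) (simp only: 0 L)
  moreover have "(\<lambda>w. L (axis i w)) = (*) (L (axis i 1))"
  proof
    fix w :: complex
    have "axis i w = w *s axis i 1" by (auto simp: vec_eq_iff axis_def)
    then show "L (axis i w) = L (axis i 1) * w" by (metis lin mult.commute)
  qed
  ultimately have "((\<lambda>w. g (chart_line c i y w)) has_field_derivative L (axis i 1)) (at 0)"
    by (simp only: has_field_derivative_def)
  then show ?thesis
    unfolding pd_chart_line by (simp add: DERIV_imp_deriv)
qed

lemma pd_eqI:
  assumes "((\<lambda>w. g (chart_line c i y w)) has_field_derivative d) (at 0)"
  shows "pd c i g y = d"
  using assms unfolding pd_chart_line by (rule DERIV_imp_deriv)

lemma hol_at_isCont:
  assumes "hol_at A g y"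
  shows "isCont g y"
proof -
  obtain c where c: "c \<in> A" "y \<in> fst c" using chart_exists by blast
  have "cdiff_at (\<lambda>z. g (inv_into (fst c) (snd c) z)) (snd c y)"
    using c assms by (cases c) (auto simp: hol_at_def)
  then have "isCont (\<lambda>z. g (inv_into (fst c) (snd c) z)) (snd c y)"
    unfolding cdiff_at_def by (meson has_derivative_continuous)
  then have "isCont (\<lambda>z. g (inv_into (fst c) (snd c) (snd c z))) y"
    using isCont_o2[OF isCont_chart[OF c]] by blast
  moreover have "\<forall>\<^sub>F z in nhds y. g (inv_into (fst c) (snd c) (snd c z)) = g z"
    using eventually_nhds_in_open[OF chart_open(1)[OF c(1)] c(2)]
    by eventually_elim (simp add: chart_inv[OF c(1)])
  ultimately show ?thesis by (simp add: isCont_cong)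
qed

lemma const_O_stalk: "(\<lambda>_. c) \<in> O_stalk A x"
  unfolding O_stalk_def hol_at_def cdiff_at_def
  by (auto intro!: always_eventually exI[of _ "\<lambda>_. 0"])

lemma open_eventually: "\<forall>\<^sub>F y in nhds x. P y \<Longrightarrow> \<forall>\<^sub>F y in nhds x. \<forall>\<^sub>F z in nhds y. P z"
  by (simp add: eventually_eventually)

end

section \<open>The identity theorem and the density of the complement of Z\<close>

lemma convex_complex_line:
  fixes p d :: "complex ^ 'n::finite"
  assumes "convex B"
  shows "convex {\<zeta>. p + \<zeta> *s d \<in> B}"
proof (rule convexI)
  fix a b :: complex and u v :: real
  assume "a \<in> {\<zeta>. p + \<zeta> *s d \<in> B}" "b \<in> {\<zeta>. p + \<zeta> *s d \<in> B}" and uv: "0 \<le> u" "0 \<le> v" "u + v = 1"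
  moreover have "p + (u *\<^sub>R a + v *\<^sub>R b) *s d = u *\<^sub>R (p + a *s d) + v *\<^sub>R (p + b *s d)"
  proof -
    have "of_real u + of_real v = (1 :: complex)" using uv(3) by (metis of_real_1 of_real_add)
    then have v: "complex_of_real v = 1 - of_real u" by (simp add: algebra_simps)
    show ?thesis
      unfolding vec_eq_iff vector_add_component vector_smult_component vector_scaleR_component
      by (simp add: scaleR_conv_of_real v algebra_simps)
  qed
  ultimately show "u *\<^sub>R a + v *\<^sub>R b \<in> {\<zeta>. p + \<zeta> *s d \<in> B}"
    using assms by (simp add: convex_def)
qed

lemma has_derivative_complex_line:
  "((\<lambda>\<zeta>. p + \<zeta> *s d) has_derivative (\<lambda>\<zeta>. \<zeta> *s d)) (at z)" for p d :: "complex ^ 'n::finite"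
proof -
  have "linear (\<lambda>\<zeta>. \<zeta> *s d)"
    by (intro linearI) (auto simp: vec_eq_iff algebra_simps)
  then have "((\<lambda>\<zeta>. \<zeta> *s d) has_derivative (\<lambda>\<zeta>. \<zeta> *s d)) (at z)"
    by (intro bounded_linear_imp_has_derivative) (simp add: linear_conv_bounded_linear)
  then show ?thesis by (auto intro!: derivative_eq_intros)
qed

text \<open>The complex line through p and q meets the ball in a convex, hence connected, set, so
  the identity theorem in one variable applies.\<close>

lemma cdiff_identity_ball:
  fixes F :: "complex ^ 'n::finite \<Rightarrow> complex"
  assumes diff: "\<And>z. z \<in> ball z0 r \<Longrightarrow> cdiff_at F z"
    and p: "p \<in> ball z0 r" "\<forall>\<^sub>F z in nhds p. F z = 0" and q: "q \<in> ball z0 r"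
  shows "F q = 0"
proof -
  define l where "l = (\<lambda>\<zeta>. p + \<zeta> *s (q - p))"
  define S where "S = {\<zeta>. l \<zeta> \<in> ball z0 r}"
  have dl: "(l has_derivative (\<lambda>\<zeta>. \<zeta> *s (q - p))) (at z)" for z
    unfolding l_def by (rule has_derivative_complex_line)
  have contl: "continuous_on UNIV l"
    using dl by (meson continuous_at_imp_continuous_on has_derivative_continuous)
  have opS: "open S"
    using open_vimage[OF open_ball contl] by (simp add: S_def vimage_def)
  have conS: "connected S"
    unfolding S_def l_def by (intro convex_connected convex_complex_line) auto
  have holo: "(\<lambda>\<zeta>. F (l \<zeta>)) holomorphic_on S"
  proof (rule holomorphic_onI)
    fix \<zeta> assume "\<zeta> \<in> S"
    then obtain L where L: "(F has_derivative L) (at (l \<zeta>))" and lin: "\<And>c v. L (c *s v) = c * L v"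
      using diff unfolding S_def cdiff_at_def by blast
    have "((\<lambda>\<zeta>. F (l \<zeta>)) has_derivative (\<lambda>w. L (w *s (q - p)))) (at \<zeta>)"
      using has_derivative_compose[OF dl L] .
    moreover have "(\<lambda>w. L (w *s (q - p))) = (*) (L (q - p))"
      by (intro ext) (metis lin mult.commute)
    ultimately have "((\<lambda>\<zeta>. F (l \<zeta>)) has_field_derivative L (q - p)) (at \<zeta>)"
      by (simp only: has_field_derivative_def)
    then show "(\<lambda>\<zeta>. F (l \<zeta>)) field_differentiable (at \<zeta> within S)"
      using field_differentiable_at_within field_differentiable_def by blast
  qed
  have l0: "l 0 = p" and l1: "l 1 = q" by (auto simp: l_def)
  have "(l \<longlongrightarrow> p) (nhds 0)"
    using contl l0 isCont_nhds[of 0 l] by (simp add: continuous_on_eq_continuous_at)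
  then have "\<forall>\<^sub>F \<zeta> in nhds 0. F (l \<zeta>) = 0"
    using p(2) by (auto simp: filterlim_iff)
  then obtain U where U: "open U" "0 \<in> U" "\<And>\<zeta>. \<zeta> \<in> U \<Longrightarrow> F (l \<zeta>) = 0"
    by (auto simp: eventually_nhds)
  have 0: "0 \<in> S" "1 \<in> S" using p(1) q by (auto simp: S_def l0 l1)
  have "open (U \<inter> S)" "0 \<in> U \<inter> S" using U opS 0 by auto
  then have lim: "0 islimpt (U \<inter> S)"
    by (metis interior_limit_point interior_open)
  have "F (l 1) = 0"
    by (rule analytic_continuation[OF holo opS conS Int_lower2 0(1) lim _ 0(2)]) (simp add: U(3))
  then show ?thesis by (simp add: l1)
qed

locale hypersurface = complex_manifold A
  for A :: "('a::{t2_space, second_countable_topology}, 'n::finite) chart set" +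
  fixes f :: "'a \<Rightarrow> complex"
  assumes hol_f: "\<forall>x. hol_at A f x"
    and f_nonzero: "\<forall>C\<in>components (UNIV :: 'a set). \<exists>x\<in>C. f x \<noteq> 0"
begin

text \<open>The set of points near which f vanishes is open, and by the identity theorem in a chart
  it is closed, so it would contain a whole component.\<close>

lemma zero_nowhere_dense:
  assumes "open U" "x \<in> U"
  shows "\<exists>y\<in>U. f y \<noteq> 0"
proof (rule ccontr)
  assume no: "\<not> ?thesis"
  define S where "S = {x. \<forall>\<^sub>F y in nhds x. f y = 0}"
  have xS: "x \<in> S" using no assms unfolding S_def eventually_nhds by auto
  have opS: "open S"
    unfolding S_def by (subst open_subopen) (auto simp: eventually_nhds)
  have clS: "closed S"
  proof -
    have "y \<in> S" if y: "y \<in> closure S" for y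
    proof -
      obtain c where c: "c \<in> A" "y \<in> fst c" using chart_exists by blast
      obtain r where r: "r > 0" "ball (snd c y) r \<subseteq> snd c ` fst c"
        using chart_open(2)[OF c(1)] c(2) by (meson imageI openE)
      define W where "W = {z \<in> fst c. snd c z \<in> ball (snd c y) r}"
      have "continuous_on (fst c) (snd c)" using chart_homeo[OF c(1)] by (auto simp: homeomorphism_def)
      then have opW: "open W"
        using continuous_open_preimage[OF _ chart_open(1)[OF c(1)] open_ball]
        by (simp add: W_def vimage_def Int_def)
      have yW: "y \<in> W" using c r by (simp add: W_def)
      obtain p where p: "p \<in> S" "p \<in> W" using y opW yW by (auto simp: closure_iff_nhds_not_empty)
      define F where "F = (\<lambda>z. f (inv_into (fst c) (snd c) z))"
      have "isCont (inv_into (fst c) (snd c)) (snd c p)"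
        using p c by (intro isCont_chart_inv) (auto simp: W_def)
      from isCont_nhds[OF this] have "filterlim (inv_into (fst c) (snd c)) (nhds p) (nhds (snd c p))"
        using p c chart_inv[of c p] by (simp add: W_def)
      then have Fp: "\<forall>\<^sub>F z in nhds (snd c p). F z = 0"
        using p(1) unfolding F_def S_def by (auto simp: filterlim_iff)
      have diff: "cdiff_at F z" if "z \<in> ball (snd c y) r" for z
      proof -
        have "z \<in> snd c ` fst c" using that r by blast
        then have "inv_into (fst c) (snd c) z \<in> fst c" "snd c (inv_into (fst c) (snd c) z) = z"
          using chart_inv_in chart_inv2 c by blast+
        then show ?thesis
          using hol_f c unfolding hol_at_def F_def by (cases c) fastforce
      qed
      have "f z = 0" if "z \<in> W" for z
      proof -
        have "F (snd c z) = 0"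
          using p(2) that by (intro cdiff_identity_ball[OF diff _ Fp]) (auto simp: W_def)
        then show ?thesis using that c chart_inv[of c z] by (simp add: F_def W_def)
      qed
      then show "y \<in> S" using opW yW unfolding S_def eventually_nhds by blast
    qed
    then show ?thesis using closure_subset_eq by blast
  qed
  define C where "C = connected_component_set UNIV x"
  have "C \<in> components UNIV" by (auto simp: C_def components_def)
  then obtain y where y: "y \<in> C" "f y \<noteq> 0" using f_nonzero by blast
  have "connected C" "x \<in> C" by (auto simp: C_def)
  have "C \<inter> S = {} \<or> C \<inter> - S = {}"
    using connectedD[OF \<open>connected C\<close> opS] clS by (auto simp: open_Compl)
  then have "y \<in> S" using \<open>x \<in> C\<close> xS y by auto
  then have "f y = 0" unfolding S_def using eventually_nhds_x_imp_x by fastforce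
  with y show False by simp
qed

text \<open>Density of the complement of Z and continuity. This is the tool for all identities that
  can only be checked where f is invertible.\<close>

lemma O_stalk_zero_off:
  assumes "g \<in> O_stalk A x" "\<forall>\<^sub>F y in nhds x. f y \<noteq> 0 \<longrightarrow> g y = 0"
  shows "\<forall>\<^sub>F y in nhds x. g y = 0"
proof -
  have "\<forall>\<^sub>F y in nhds x. hol_at A g y" using assms by (simp add: O_stalk_def)
  then have "\<forall>\<^sub>F y in nhds x. hol_at A g y \<and> (\<forall>\<^sub>F z in nhds y. f z \<noteq> 0 \<longrightarrow> g z = 0)"
    using open_eventually[OF assms(2)] by eventually_elim auto
  then show ?thesis
  proof eventually_elim
    case (elim y)
    show "g y = 0"
    proof (rule ccontr)
      assume "g y \<noteq> 0"
      have "(g \<longlongrightarrow> g y) (nhds y)"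
        using hol_at_isCont elim by (intro isCont_nhds) auto
      then have "\<forall>\<^sub>F z in nhds y. g z \<noteq> 0"
        using \<open>g y \<noteq> 0\<close> by (rule tendsto_imp_eventually_ne)
      then have "\<forall>\<^sub>F z in nhds y. f z = 0"
        using elim by (auto elim: eventually_elim2)
      then show False
        unfolding eventually_nhds using zero_nowhere_dense by blast
    qed
  qed
qed

end

subsection \<open>Germs of sections and rings of operators\<close>

lemma ring_gen_mono: "P \<in> ring_gen S \<Longrightarrow> S \<subseteq> T \<Longrightarrow> P \<in> ring_gen T"
  by (induction rule: ring_gen.induct) (auto intro: ring_gen.intros)

lemma ring_gen_zero: "(\<lambda>u. 0) \<in> ring_gen S"
  using ring_gen.diff[OF ring_gen.one ring_gen.one] by simp

lemma ring_gen_add: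
  assumes "P \<in> ring_gen S" "Q \<in> ring_gen S"
  shows "(\<lambda>u. P u + Q u) \<in> ring_gen S"
  using ring_gen.diff[OF assms(1) ring_gen.diff[OF ring_gen_zero assms(2)]] by simp

text \<open>The operators by which the stalk of D_X[s] acts on M_f; V^0 D_Y contains in addition the
  functions of t.\<close>

definition Lops :: "('a::topological_space, 'n::finite) chart set \<Rightarrow> ('a \<Rightarrow> complex) \<Rightarrow> 'a \<Rightarrow>
    ((nat \<Rightarrow> 'a \<Rightarrow> complex) \<Rightarrow> (nat \<Rightarrow> 'a \<Rightarrow> complex)) set" where
  "Lops A f x = ring_gen (D_gens A pmul (Mf_dx f) x \<union> {Mf_s f})"

lemma Lops_V0_ops: "P \<in> Lops A f x \<Longrightarrow> P \<in> V0_ops A f x"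
  unfolding Lops_def V0_ops_def by (erule ring_gen_mono) auto

lemma germ_eq_refl: "germ_eq x u u"
  by (simp add: germ_eq_def)

lemma germ_eq_sym: "germ_eq x u v \<Longrightarrow> germ_eq x v u"
  by (simp add: germ_eq_def eq_commute)

lemma germ_eq_trans: "germ_eq x u v \<Longrightarrow> germ_eq x v w \<Longrightarrow> germ_eq x u w"
  unfolding germ_eq_def by (erule (1) eventually_elim2) simp

lemma germ_eq_diff: "germ_eq x u v \<Longrightarrow> germ_eq x u' v' \<Longrightarrow> germ_eq x (u - u') (v - v')"
  unfolding germ_eq_def by (erule (1) eventually_elim2) (simp add: fun_apply)

lemma germ_eq_add: "germ_eq x u v \<Longrightarrow> germ_eq x u' v' \<Longrightarrow> germ_eq x (u + u') (v + v')"
  unfolding germ_eq_def by (erule (1) eventually_elim2) (simp add: fun_apply)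

lemma germ_eq_pmul: "germ_eq x u v \<Longrightarrow> germ_eq x (pmul g u) (pmul g v)"
  unfolding germ_eq_def by (erule eventually_mono) (simp add: op_apply)

lemma germ_eq_dt: "germ_eq x u v \<Longrightarrow> germ_eq x (pshift u) (pshift v)"
  unfolding germ_eq_def by (erule eventually_mono) (simp add: op_apply)

lemma germ_eq_t: "germ_eq x u v \<Longrightarrow> germ_eq x (Mf_t f u) (Mf_t f v)"
  unfolding germ_eq_def by (erule eventually_mono) (simp add: op_apply)

lemma germ_eq_s: "germ_eq x u v \<Longrightarrow> germ_eq x (Mf_s f u) (Mf_s f v)"
  unfolding germ_eq_def by (erule eventually_mono) (simp add: op_apply)

lemma germ_eq_sact: "germ_eq x u v \<Longrightarrow> germ_eq x (sact f p u) (sact f p v)"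
  by (induction p) (auto simp: sact_pCons germ_eq_refl intro: germ_eq_add germ_eq_s germ_eq_pmul)

lemma germ_eq_t_pow: "germ_eq x u v \<Longrightarrow> germ_eq x ((Mf_t f ^^ n) u) ((Mf_t f ^^ n) v)"
  by (induction n) (auto intro: germ_eq_t)

text \<open>
  \<open>mu G\<close> is the action of the power series \<open>\<Sum>\<^sub>j G\<^sub>j (t - f)\<^sup>j / j!\<close>; for \<open>G\<^sub>j = (\<partial>\<^sub>t\<^sup>j G)(x, f(x))\<close> it is the
  action of \<open>G\<close>. In contrast to the functions on \<open>Y\<close>, these series are closed under commutators
  with vector fields and with \<open>\<partial>\<^sub>t\<close> by a mere computation.
\<close>

definition mu :: "(nat \<Rightarrow> 'a \<Rightarrow> complex) \<Rightarrow> (nat \<Rightarrow> 'a \<Rightarrow> complex) \<Rightarrow> nat \<Rightarrow> 'a \<Rightarrow> complex" where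
  "mu G u = (\<lambda>m y. \<Sum>j | u (m + j) y \<noteq> 0. (-1) ^ j * of_nat ((m + j) choose j) * G j y * u (m + j) y)"

lemma Mf_mulY_mu: "Mf_mulY f G u = mu (\<lambda>j y. (deriv ^^ j) (\<lambda>t. G (y, t)) (f y)) u"
  by (simp add: Mf_mulY_def mu_def)

text \<open>The sum in \<open>mu\<close> runs over a support that varies with y; a fixed range is
  needed to differentiate it and to compare several such sums.\<close>

lemma mu_eq:
  assumes "\<forall>k>K. u k y = 0" "K \<le> n"
  shows "mu G u m y = (\<Sum>j\<le>n. (-1) ^ j * of_nat ((m + j) choose j) * G j y * u (m + j) y)"
proof -
  have "{j. u (m + j) y \<noteq> 0} \<subseteq> {..n}"
  proof clarify
    fix j assume "u (m + j) y \<noteq> 0"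
    then have "\<not> m + j > K" using assms(1) by blast
    then show "j \<le> n" using assms(2) by simp
  qed
  then show ?thesis unfolding mu_def by (intro sum.mono_neutral_left) auto
qed

lemma mu_pmul:
  assumes "\<forall>k>K. u k y = 0"
  shows "mu G (pmul g u) m y = pmul g (mu G u) m y"
proof -
  have "\<forall>k>K. pmul g u k y = 0" using assms by (simp add: op_apply)
  from mu_eq[where u = "pmul g u", OF this order_refl] mu_eq[where u = u, OF assms order_refl] show ?thesis
    by (simp add: op_apply sum_distrib_left mult_ac)
qed

lemma mu_t:
  assumes "\<forall>k>K. u k y = 0"
  shows "mu G (Mf_t f u) m y = Mf_t f (mu G u) m y"
proof -
  have *: "\<forall>k>K. Mf_t f u k y = 0" using assms by (simp add: op_apply)
  \<comment> \<open>The factor m + j + 1 comes from lowering the degree by t before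
    \<open>mu G\<close> acts, the factor m + 1 from lowering it afterwards.\<close>
  have b: "of_nat ((m + j) choose j) * of_nat (Suc (m + j)) = (of_nat (Suc m) * of_nat ((Suc m + j) choose j) :: complex)" for j
  proof -
    have "Suc m * (Suc (m + j) choose Suc m) = Suc (m + j) * ((m + j) choose m)"
      using Suc_times_binomial_eq[of "m + j" m] by (simp add: mult.commute)
    moreover have "(Suc (m + j) choose Suc m) = (Suc m + j choose j)" "((m + j) choose m) = ((m + j) choose j)"
      using binomial_symmetric[of m "m + j"] binomial_symmetric[of "Suc m" "Suc (m + j)"]
      by (simp_all del: binomial_Suc_Suc)
    ultimately have "((m + j) choose j) * Suc (m + j) = Suc m * ((Suc m + j) choose j)"
      by (simp add: mult.commute)
    then show ?thesis by (metis of_nat_mult)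
  qed
  have "mu G (Mf_t f u) m y = (\<Sum>j\<le>K. (-1) ^ j * of_nat ((m + j) choose j) * G j y * Mf_t f u (m + j) y)"
    by (rule mu_eq[where u = "Mf_t f u", OF * order_refl])
  also have "\<dots> = (\<Sum>j\<le>K. f y * ((-1) ^ j * of_nat ((m + j) choose j) * G j y * u (m + j) y) -
      (of_nat ((m + j) choose j) * of_nat (Suc (m + j))) * ((-1) ^ j * G j y * u (Suc m + j) y))"
    by (intro sum.cong) (simp_all add: op_apply algebra_simps)
  also have "\<dots> = Mf_t f (mu G u) m y"
    unfolding b Mf_t_apply mu_eq[where u = u, OF assms order_refl, of G]
    by (simp add: sum_subtractf sum_distrib_left mult_ac)
  finally show ?thesis .
qed

text \<open>The commutator of \<partial>_t with G is \<partial>_t G, whose sequence is the shifted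
  one.\<close>

lemma mu_dt:
  assumes "\<forall>k>K. u k y = 0"
  shows "mu G (pshift u) m y = pshift (mu G u) m y - mu (\<lambda>j. G (Suc j)) u m y"
proof -
  have *: "\<forall>k>Suc K. pshift u k y = 0" using assms by (simp add: op_apply)
  have **: "\<And>G m. mu G u m y = (\<Sum>j\<le>Suc K. (-1) ^ j * of_nat ((m + j) choose j) * G j y * u (m + j) y)"
    using mu_eq[of K u y "Suc K"] assms by simp
  have "mu G (pshift u) m y = (\<Sum>j\<le>Suc K. (-1) ^ j * of_nat ((m + j) choose j) * G j y * pshift u (m + j) y)"
    by (rule mu_eq[where u = "pshift u", OF * order_refl])
  also have "\<dots> = G 0 y * pshift u m y +
     (\<Sum>j\<le>K. - ((-1) ^ j * of_nat ((m + Suc j) choose Suc j) * G (Suc j) y * u (m + j) y))"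
    by (subst sum.atMost_Suc_shift) (simp add: op_apply)
  \<comment> \<open>Pascal's rule: one part of the binomial coefficient rebuilds
    \<open>pshift (mu G u)\<close>, the other is the action of the shifted sequence.\<close>
  also have "(\<Sum>j\<le>K. - ((-1) ^ j * of_nat ((m + Suc j) choose Suc j) * G (Suc j) y * u (m + j) y))
     = (\<Sum>j\<le>K. - ((-1) ^ j * of_nat ((m + j) choose Suc j) * G (Suc j) y * u (m + j) y))
      - mu (\<lambda>j. G (Suc j)) u m y"
    unfolding mu_eq[where u = u, OF assms order_refl, of "\<lambda>j. G (Suc j)"] sum_subtractf[symmetric]
    by (intro sum.cong refl) (simp add: algebra_simps)
  also have "G 0 y * pshift u m y + ((\<Sum>j\<le>K. - ((-1) ^ j * of_nat ((m + j) choose Suc j) * G (Suc j) y * u (m + j) y))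
      - mu (\<lambda>j. G (Suc j)) u m y) = pshift (mu G u) m y - mu (\<lambda>j. G (Suc j)) u m y"
  proof (cases m)
    case 0
    then show ?thesis by (simp add: op_apply binomial_eq_0)
  next
    case (Suc m')
    have "pshift (mu G u) m y = G 0 y * u m' y +
      (\<Sum>j\<le>K. - ((-1) ^ j * of_nat ((m + j) choose Suc j) * G (Suc j) y * u (m + j) y))"
      unfolding pshift_apply Suc ** by (subst sum.atMost_Suc_shift) simp
    then show ?thesis by (simp add: Suc op_apply)
  qed
  finally show ?thesis .
qed

context complex_manifold
begin

lemma hol_at_cong:
  assumes "\<forall>\<^sub>F z in nhds y. g z = h z" "hol_at A g y"
  shows "hol_at A h y"
  unfolding hol_at_def
proof (clarify)
  fix D \<phi> assume c: "(D, \<phi>) \<in> A" "y \<in> D"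
  then have "cdiff_at (\<lambda>z. g (inv_into D \<phi> z)) (\<phi> y)" using assms by (auto simp: hol_at_def)
  then obtain L where L: "((\<lambda>z. g (inv_into D \<phi> z)) has_derivative L) (at (\<phi> y))" "\<forall>c v. L (c *s v) = c * L v"
    by (auto simp: cdiff_at_def)
  have "isCont (inv_into D \<phi>) (\<phi> y)" using isCont_chart_inv[OF c(1)] c(2) by simp
  from isCont_nhds[OF this] have "filterlim (inv_into D \<phi>) (nhds y) (nhds (\<phi> y))"
    using chart_inv[OF c(1)] c(2) by simp
  then have ev: "\<forall>\<^sub>F z in nhds (\<phi> y). g (inv_into D \<phi> z) = h (inv_into D \<phi> z)"
    using assms(1) by (auto simp: filterlim_iff)
  then have "((\<lambda>z. h (inv_into D \<phi> z)) has_derivative L) (at (\<phi> y))"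
    using L(1) ev eventually_nhds_x_imp_x[OF ev]
    by (intro has_derivative_transform_eventually[OF L(1)]) (auto intro: eventually_at_filter[THEN iffD2] elim: eventually_mono)
  with L(2) show "cdiff_at (\<lambda>z. h (inv_into D \<phi> z)) (\<phi> y)" by (auto simp: cdiff_at_def)
qed

lemma eventually_chart: "c \<in> A \<Longrightarrow> x \<in> fst c \<Longrightarrow> \<forall>\<^sub>F y in nhds x. y \<in> fst c"
  by (intro eventually_nhds_in_open chart_open)

text \<open>The vanishing of the high coefficients is asserted also near each nearby y, since their
  derivatives at y have to vanish as well.\<close>

lemma Mf_hol:
  assumes "u \<in> Mf A x"
  shows "\<exists>K. \<forall>\<^sub>F y in nhds x. (\<forall>k. hol_at A (u k) y) \<and> (\<forall>k>K. u k y = 0) \<and> (\<forall>\<^sub>F z in nhds y. \<forall>k>K. u k z = 0)"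
proof -
  obtain K where K: "\<forall>\<^sub>F y in nhds x. \<forall>k>K. u k y = 0" using assms by (auto simp: Mf_def)
  have "\<forall>\<^sub>F y in nhds x. \<forall>k\<le>K. hol_at A (u k) y"
    using assms by (simp add: Mf_def O_stalk_def eventually_ball_finite flip: Ball_def atMost_iff)
  then have "\<forall>\<^sub>F y in nhds x. (\<forall>k. hol_at A (u k) y) \<and> (\<forall>k>K. u k y = 0) \<and> (\<forall>\<^sub>F z in nhds y. \<forall>k>K. u k z = 0)"
    using K open_eventually[OF K]
  proof eventually_elim
    case (elim y)
    have "hol_at A (u k) y" if "k > K" for k
    proof (rule hol_at_cong[where g = "\<lambda>_. 0"])
      show "\<forall>\<^sub>F z in nhds y. 0 = u k z"
        using elim(3) by eventually_elim (use that in simp)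
      show "hol_at A (\<lambda>_. 0) y"
        unfolding hol_at_def cdiff_at_def by (auto intro!: exI[of _ "\<lambda>_. 0"])
    qed
    with elim show ?case by (meson not_less)
  qed
  then show ?thesis by blast
qed

lemma germ_eq_dx:
  assumes "c \<in> A" "x \<in> fst c" "germ_eq x u v"
  shows "germ_eq x (Mf_dx f c i u) (Mf_dx f c i v)"
  using eventually_chart[OF assms(1,2)] assms(3) open_eventually[OF assms(3)[unfolded germ_eq_def]]
  unfolding germ_eq_def
proof eventually_elim
  case (elim y)
  have "pd c i (u k) y = pd c i (v k) y" for k
    using elim(3) by (intro pd_cong assms elim) (auto elim: eventually_mono)
  with elim show ?case by (simp add: Mf_dx_def pshift_def)
qed

lemma germ_eq_V0_ops:
  assumes "P \<in> V0_ops A f x" "germ_eq x u v"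
  shows "germ_eq x (P u) (P v)"
  using assms unfolding V0_ops_def
proof (induction arbitrary: u v rule: ring_gen.induct)
  case (gen P)
  have "germ_eq x (Mf_mulY f G u) (Mf_mulY f G v)" for G
    using gen.prems unfolding germ_eq_def Mf_mulY_def by eventually_elim simp
  with gen show ?case
    by (auto simp: D_gens_def intro: germ_eq_s germ_eq_pmul germ_eq_dx)
qed (auto intro: germ_eq_diff)

lemma germ_eq_mu: "germ_eq x u v \<Longrightarrow> germ_eq x (mu G u) (mu G v)"
  unfolding germ_eq_def mu_def by (erule eventually_mono) simp

end

context hypersurface
begin

text \<open>The term (\<partial>_i f) u of the product rule cancels against the commutator of t with
  (\<partial>_i f) \<partial>_t. This is an equality of germs only, as representatives need not be
  differentiable far from x.\<close>

lemma t_dx: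
  assumes "c \<in> A" "x \<in> fst c" "u \<in> Mf A x"
  shows "germ_eq x (Mf_t f (Mf_dx f c i u)) (Mf_dx f c i (Mf_t f u))"
proof -
  obtain K where "\<forall>\<^sub>F y in nhds x. (\<forall>k. hol_at A (u k) y) \<and> (\<forall>k>K. u k y = 0) \<and> (\<forall>\<^sub>F z in nhds y. \<forall>k>K. u k z = 0)"
    using Mf_hol[OF assms(3)] by blast
  then show ?thesis
    using eventually_chart[OF assms(1,2)] unfolding germ_eq_def
  proof eventually_elim
    case (elim y)
    show ?case
    proof
      fix k
      have c: "c \<in> A" "y \<in> fst c" by fact+
      have "((\<lambda>w. f (chart_line c i y w) * u k (chart_line c i y w) - of_nat (Suc k) * u (Suc k) (chart_line c i y w))
         has_field_derivative pd c i f y * u k y + f y * pd c i (u k) y - of_nat (Suc k) * pd c i (u (Suc k)) y) (at 0)"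
        using pd_deriv[OF c, of f i] pd_deriv[OF c, of "u k" i] pd_deriv[OF c, of "u (Suc k)" i] elim hol_f
        by (auto intro!: derivative_eq_intros simp: chart_line_0[OF c])
      then have "pd c i (Mf_t f u k) y = pd c i f y * u k y + f y * pd c i (u k) y - of_nat (Suc k) * pd c i (u (Suc k)) y"
        by (intro pd_eqI) (simp add: op_apply)
      then show "Mf_t f (Mf_dx f c i u) k y = Mf_dx f c i (Mf_t f u) k y"
        by (cases k) (simp_all add: Mf_dx_def op_apply algebra_simps)
    qed
  qed
qed

text \<open>By the chain rule \<partial>_i of (\<partial>_t^j G)(x, f(x)) contains the extra term
  (\<partial>_i f) (\<partial>_t^(j+1) G)(x, f(x)). The sequence in the last summand removes it and
  so belongs to the partial derivative of G along X.\<close>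

lemma dx_mu:
  assumes "c \<in> A" "x \<in> fst c" "u \<in> Mf A x" "\<And>j. G j \<in> O_stalk A x"
  shows "germ_eq x (Mf_dx f c i (mu G u))
    (mu G (Mf_dx f c i u) + mu (\<lambda>j y. pd c i (G j) y - pd c i f y * G (Suc j) y) u)"
proof -
  obtain K where "\<forall>\<^sub>F y in nhds x. (\<forall>k. hol_at A (u k) y) \<and> (\<forall>k>K. u k y = 0) \<and> (\<forall>\<^sub>F z in nhds y. \<forall>k>K. u k z = 0)"
    using Mf_hol[OF assms(3)] by blast
  \<comment> \<open>Infinitely many germs \<open>G j\<close> need not be holomorphic on a common
    neighbourhood; indices up to \<open>Suc K\<close> suffice, as \<open>Mf_dx\<close> raises the
    degree of u by at most one.\<close>
  moreover have "\<forall>\<^sub>F y in nhds x. \<forall>j\<in>{..Suc K}. hol_at A (G j) y"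
    using assms(4) by (simp add: O_stalk_def eventually_ball_finite)
  ultimately show ?thesis
    using eventually_chart[OF assms(1,2)] unfolding germ_eq_def
  proof eventually_elim
    case (elim y)
    have c: "c \<in> A" "y \<in> fst c" by fact+
    have b: "\<forall>k>K. u k y = 0" using elim by blast
    define e where "e = (\<lambda>m j. (-1) ^ j * of_nat ((m + j) choose j) :: complex)"
    have b': "Mf_dx f c i u k y = 0" if "k > Suc K" for k
    proof -
      have "pd c i (u k) y = pd c i (\<lambda>_. 0) y"
        using elim(1) that by (intro pd_cong c) (auto elim!: eventually_mono)
      then show ?thesis using b that by (simp add: Mf_dx_def op_apply pd_chart_line)
    qed
    have mun: "mu H u m y = (\<Sum>j\<le>Suc K. e m j * H j y * u (m + j) y)" for H m
      using mu_eq[of K u y "Suc K" H m] b by (simp add: e_def)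
    show ?case
    proof
      fix m
      have "pd c i (mu G u m) y = pd c i (\<lambda>y. \<Sum>j\<le>Suc K. e m j * G j y * u (m + j) y) y"
        using elim(1) by (intro pd_cong c) (auto elim!: eventually_mono simp: e_def intro!: mu_eq[of K])
      also have "\<dots> = (\<Sum>j\<le>Suc K. e m j * (pd c i (G j) y * u (m + j) y + G j y * pd c i (u (m + j)) y))"
      proof (rule pd_eqI, rule DERIV_sum)
        fix j assume "j \<in> {..Suc K}"
        then show "((\<lambda>w. e m j * G j (chart_line c i y w) * u (m + j) (chart_line c i y w)) has_field_derivative
          e m j * (pd c i (G j) y * u (m + j) y + G j y * pd c i (u (m + j)) y)) (at 0)"
          using pd_deriv[OF c, of "G j" i] pd_deriv[OF c, of "u (m + j)" i] elim
          by (auto intro!: derivative_eq_intros simp: chart_line_0[OF c] algebra_simps)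
      qed
      finally have 1: "pd c i (mu G u m) y = mu (\<lambda>j. pd c i (G j)) u m y + (\<Sum>j\<le>Suc K. e m j * G j y * pd c i (u (m + j)) y)"
        by (simp add: mun sum.distrib algebra_simps)
      have 2: "mu G (Mf_dx f c i u) m y = (\<Sum>j\<le>Suc K. e m j * G j y * pd c i (u (m + j)) y) - pd c i f y * mu G (pshift u) m y"
      proof -
        have "mu G (Mf_dx f c i u) m y = (\<Sum>j\<le>Suc K. e m j * G j y * Mf_dx f c i u (m + j) y)"
          using mu_eq[of "Suc K" "Mf_dx f c i u" y "Suc K" G m] b' by (simp add: e_def)
        moreover have "mu G (pshift u) m y = (\<Sum>j\<le>Suc K. e m j * G j y * pshift u (m + j) y)"
          using mu_eq[of "Suc K" "pshift u" y "Suc K" G m] b by (simp add: e_def op_apply)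
        ultimately show ?thesis
          by (simp add: Mf_dx_def sum_distrib_left sum_subtractf algebra_simps)
      qed
      have 3: "mu (\<lambda>j y. pd c i (G j) y - pd c i f y * G (Suc j) y) u m y =
          mu (\<lambda>j. pd c i (G j)) u m y - pd c i f y * mu (\<lambda>j. G (Suc j)) u m y"
        unfolding mun by (simp add: sum_distrib_left sum_subtractf algebra_simps)
      show "Mf_dx f c i (mu G u) m y = (mu G (Mf_dx f c i u) + mu (\<lambda>j y. pd c i (G j) y - pd c i f y * G (Suc j) y) u) m y"
        unfolding Mf_dx_def[of f c i "mu G u"] plus_fun_apply 1 2 3
          mu_dt[where u = u, OF b, of G m] by (simp add: algebra_simps)
    qed
  qed
qed

end

subsection \<open>The lattices generated by \<open>\<delta>\<close> and \<open>t \<delta>\<close>\<close>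

lemma pconst_apply: "pconst h k y = (if k = 0 then h y else 0)"
  by (simp add: pconst_def)

lemma pshift_pow_pconst: "(pshift ^^ n) (pconst h) k y = (if k = n then h y else 0)"
  by (induction n arbitrary: k) (auto simp: pconst_apply pshift_apply)

lemma Mf_t_pconst: "Mf_t f (pconst h) = pmul f (pconst h)"
  by (intro ext) (simp add: op_apply pconst_apply)

lemma pmul_pconst: "pmul g (pconst h) = pconst (\<lambda>y. g y * h y)"
  by (intro ext) (simp add: op_apply pconst_apply)

text \<open>The classical formula t^n \<partial>_t^n = (-1)^n (s + 1) ... (s + n).\<close>

lemma Mf_t_pow_dt_pow: "\<exists>q. \<forall>u. (Mf_t f ^^ n) ((pshift ^^ n) u) = sact f q u"
proof (induction n)
  case 0
  show ?case by (rule exI[of _ 1]) (simp add: sact_1)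
next
  case (Suc n)
  then obtain q where q: "\<And>u. (Mf_t f ^^ n) ((pshift ^^ n) u) = sact f q u" by blast
  have "(Mf_t f ^^ Suc n) ((pshift ^^ Suc n) u) = sact f (smult (-1) ([:1 + of_nat n, 1:] * q)) u" for u
  proof -
    have *: "Mf_t f (pshift v) = pmul (\<lambda>_. -1) (sact f [:1, 1:] v)" for v
      unfolding Mf_t_dt sact_linear by (intro ext) (auto simp: op_apply)
    have "(Mf_t f ^^ Suc n) ((pshift ^^ Suc n) u) = (Mf_t f ^^ n) (Mf_t f (pshift ((pshift ^^ n) u)))"
      by (simp add: funpow_swap1)
    then show ?thesis
      unfolding * Mf_t_pow_pmul Mf_t_pow_linear q sact_smult sact_mult .
  qed
  then show ?case by blast
qed

locale V_filtration = hypersurface A f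
  for A :: "('a::{t2_space, second_countable_topology}, 'n::finite) chart set"
    and f :: "'a \<Rightarrow> complex" +
  fixes V :: "'a filtration" and x :: 'a
  assumes V_filt: "is_V_filtration A f V"
begin

abbreviation "M \<equiv> Mf A x"
abbreviation "geq \<equiv> germ_eq x"
abbreviation "t \<equiv> Mf_t f"

lemma V_submodule: "V0_submodule A f (V \<gamma>)"
  and V_anti: "\<gamma> \<le> \<gamma>' \<Longrightarrow> V \<gamma>' x \<subseteq> V \<gamma> x"
  and V_discrete: "\<exists>m::nat. m > 0 \<and> (\<forall>\<^sub>F y in nhds x. \<forall>\<gamma>.
        V \<gamma> y = V (of_int \<lceil>of_nat m * \<gamma>\<rceil> / of_nat m) y)"
  and V_exhaust: "(\<Union>\<gamma>. V \<gamma> x) = M"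
  and V_t': "t ` V \<gamma> x \<subseteq> V (\<gamma> + 1) x"
  and V_t_onto: "\<exists>\<gamma>\<^sub>0. \<forall>\<^sub>F y in nhds x. \<forall>\<gamma>\<ge>\<gamma>\<^sub>0.
        V (\<gamma> + 1) y = {v. \<exists>u\<in>V \<gamma> y. germ_eq y v (t u)}"
  and V_dt': "pshift ` V \<gamma> x \<subseteq> V (\<gamma> - 1) x"
  and V_nilp: "\<xi> \<in> Gr V \<gamma> x \<Longrightarrow> \<exists>k.
        (induced (V_gt V \<gamma> x) (\<lambda>u. pshift (t u) - pmul (\<lambda>_. of_rat \<gamma>) u) ^^ k) \<xi> = V_gt V \<gamma> x"
  and V_fg: "V0_locally_fg A f (V \<gamma>)"
proof -
  note d1 = V_filt[unfolded is_V_filtration_def]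
  note d2 = d1[THEN conjunct2] note d3 = d2[THEN conjunct2] note d4 = d3[THEN conjunct2]
  note d5 = d4[THEN conjunct2] note d6 = d5[THEN conjunct2] note d7 = d6[THEN conjunct2]
  note d8 = d7[THEN conjunct2]
  show "V0_submodule A f (V \<gamma>)"
    using d1[THEN conjunct1] by (rule spec)
  show "\<gamma> \<le> \<gamma>' \<Longrightarrow> V \<gamma>' x \<subseteq> V \<gamma> x"
    by (rule d2[THEN conjunct1, rule_format])
  show "\<exists>m::nat. m > 0 \<and> (\<forall>\<^sub>F y in nhds x. \<forall>\<gamma>.
        V \<gamma> y = V (of_int \<lceil>of_nat m * \<gamma>\<rceil> / of_nat m) y)"
    by (rule d3[THEN conjunct1, THEN spec])
  show "(\<Union>\<gamma>. V \<gamma> x) = M"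
    by (rule d4[THEN conjunct1, THEN spec])
  show "t ` V \<gamma> x \<subseteq> V (\<gamma> + 1) x"
    by (rule d5[THEN conjunct1, THEN spec, THEN spec])
  show "\<exists>\<gamma>\<^sub>0. \<forall>\<^sub>F y in nhds x. \<forall>\<gamma>\<ge>\<gamma>\<^sub>0.
        V (\<gamma> + 1) y = {v. \<exists>u\<in>V \<gamma> y. germ_eq y v (t u)}"
    by (rule d6[THEN conjunct1, THEN spec])
  show "pshift ` V \<gamma> x \<subseteq> V (\<gamma> - 1) x"
    by (rule d7[THEN conjunct1, THEN spec, THEN spec])
  show "\<xi> \<in> Gr V \<gamma> x \<Longrightarrow> \<exists>k.
        (induced (V_gt V \<gamma> x) (\<lambda>u. pshift (t u) - pmul (\<lambda>_. of_rat \<gamma>) u) ^^ k) \<xi> = V_gt V \<gamma> x"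
    by (rule d8[THEN conjunct1, THEN spec, THEN spec, THEN bspec])
  show "V0_locally_fg A f (V \<gamma>)"
    by (rule d8[THEN conjunct2, THEN spec])
qed

section \<open>The stalks of V and of M_f as modules\<close>

lemma V_M: "u \<in> V \<gamma> x \<Longrightarrow> u \<in> M"
  and V_0: "0 \<in> V \<gamma> x"
  and V_germ: "u \<in> V \<gamma> x \<Longrightarrow> geq u v \<Longrightarrow> v \<in> V \<gamma> x"
  and V_diff: "u \<in> V \<gamma> x \<Longrightarrow> v \<in> V \<gamma> x \<Longrightarrow> u - v \<in> V \<gamma> x"
  and V_op: "P \<in> V0_ops A f x \<Longrightarrow> u \<in> V \<gamma> x \<Longrightarrow> P u \<in> V \<gamma> x"
  using V_submodule[of \<gamma>] unfolding V0_submodule_def by blast+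

lemma V_t: "u \<in> V \<gamma> x \<Longrightarrow> t u \<in> V (\<gamma> + 1) x"
  and V_dt: "u \<in> V \<gamma> x \<Longrightarrow> pshift u \<in> V (\<gamma> - 1) x"
  using V_t' V_dt' by blast+

lemma V_add: "u \<in> V \<gamma> x \<Longrightarrow> v \<in> V \<gamma> x \<Longrightarrow> u + v \<in> V \<gamma> x"
  using V_diff[of u \<gamma> "0 - v"] V_diff[OF V_0, of v \<gamma>] by simp

lemma M_V: "u \<in> M \<Longrightarrow> \<exists>\<gamma>. u \<in> V \<gamma> x"
  using V_exhaust by blast

lemma V_mono: "u \<in> V \<gamma>' x \<Longrightarrow> \<gamma> \<le> \<gamma>' \<Longrightarrow> u \<in> V \<gamma> x"
  using V_anti by blast

lemma gen_V0_ops: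
  "g \<in> O_stalk A x \<Longrightarrow> pmul g \<in> V0_ops A f x"
  "c \<in> A \<Longrightarrow> x \<in> fst c \<Longrightarrow> Mf_dx f c i \<in> V0_ops A f x"
  "Mf_s f \<in> V0_ops A f x"
  "G \<in> O_prod_stalk A (x, f x) \<Longrightarrow> Mf_mulY f G \<in> V0_ops A f x"
  unfolding V0_ops_def D_gens_def by (intro ring_gen.gen; blast)+

lemma gen_Lops:
  "g \<in> O_stalk A x \<Longrightarrow> pmul g \<in> Lops A f x"
  "c \<in> A \<Longrightarrow> x \<in> fst c \<Longrightarrow> Mf_dx f c i \<in> Lops A f x"
  "Mf_s f \<in> Lops A f x"
  unfolding Lops_def D_gens_def by (intro ring_gen.gen; blast)+

lemma V_pmul: "g \<in> O_stalk A x \<Longrightarrow> u \<in> V \<gamma> x \<Longrightarrow> pmul g u \<in> V \<gamma> x"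
  and V_s: "u \<in> V \<gamma> x \<Longrightarrow> Mf_s f u \<in> V \<gamma> x"
  using V_op gen_V0_ops by blast+

lemma V_sact: "u \<in> V \<gamma> x \<Longrightarrow> sact f p u \<in> V \<gamma> x"
  by (induction p) (auto simp: sact_pCons V_0 intro!: V_add V_pmul V_s const_O_stalk)

lemma V_t_pow: "u \<in> V \<gamma> x \<Longrightarrow> (t ^^ n) u \<in> V (\<gamma> + of_nat n) x"
proof (induction n)
  case (Suc n)
  then show ?case using V_t[of "(t ^^ n) u" "\<gamma> + of_nat n"] by (simp add: add_ac)
qed simp

text \<open>V exhausts M_f by submodules over V^0 D_Y, so M_f inherits their closure properties
  without any computation with holomorphic coefficients.\<close>

lemma M_0: "0 \<in> M" and M_germ: "u \<in> M \<Longrightarrow> geq u v \<Longrightarrow> v \<in> M"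
  and M_op: "P \<in> V0_ops A f x \<Longrightarrow> u \<in> M \<Longrightarrow> P u \<in> M"
  and M_t: "u \<in> M \<Longrightarrow> t u \<in> M" and M_dt: "u \<in> M \<Longrightarrow> pshift u \<in> M"
  and M_pmul: "g \<in> O_stalk A x \<Longrightarrow> u \<in> M \<Longrightarrow> pmul g u \<in> M"
  and M_s: "u \<in> M \<Longrightarrow> Mf_s f u \<in> M"
  and M_sact: "u \<in> M \<Longrightarrow> sact f p u \<in> M"
  and M_dx: "c \<in> A \<Longrightarrow> x \<in> fst c \<Longrightarrow> u \<in> M \<Longrightarrow> Mf_dx f c i u \<in> M"
  using V_0 V_germ V_op V_t V_dt V_pmul V_s V_sact M_V V_M gen_V0_ops by metis+

lemma M_diff:
  assumes "u \<in> M" "v \<in> M"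
  shows "u - v \<in> M"
proof -
  obtain a b where "u \<in> V a x" "v \<in> V b x" using assms M_V by blast
  then have "u \<in> V (min a b) x" "v \<in> V (min a b) x" using V_mono by auto
  then show ?thesis using V_diff V_M by blast
qed

lemma M_add: "u \<in> M \<Longrightarrow> v \<in> M \<Longrightarrow> u + v \<in> M"
  using M_diff[of u "0 - v"] M_diff[OF M_0, of v] by simp

lemma M_t_pow: "u \<in> M \<Longrightarrow> (t ^^ n) u \<in> M"
  by (induction n) (auto intro: M_t)

lemma M_O: "u \<in> M \<Longrightarrow> u k \<in> O_stalk A x"
  by (simp add: Mf_def)

lemma pconst_M: "h \<in> O_stalk A x \<Longrightarrow> pconst h \<in> M"
proof -
  assume "h \<in> O_stalk A x"
  then have "pconst h k \<in> O_stalk A x" for k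
    using const_O_stalk[of 0 x] by (cases "k = 0") (simp_all add: pconst_def)
  then show ?thesis by (auto simp: Mf_def pconst_def intro!: exI[of _ 0])
qed

lemma O_mult: "g \<in> O_stalk A x \<Longrightarrow> h \<in> O_stalk A x \<Longrightarrow> (\<lambda>y. g y * h y) \<in> O_stalk A x"
  using M_O[OF M_pmul[OF _ pconst_M], of g h 0] by (simp add: pmul_def pconst_def)

lemma O_diff: "g \<in> O_stalk A x \<Longrightarrow> h \<in> O_stalk A x \<Longrightarrow> (\<lambda>y. g y - h y) \<in> O_stalk A x"
  using M_O[OF M_diff[OF pconst_M pconst_M], of g h 0] by (simp add: fun_diff_def pconst_def)

text \<open>Holomorphy of partial derivatives is read off from the stability of M_f under
  \<partial>_i, applied to g \<delta>.\<close>

lemma O_pd: "c \<in> A \<Longrightarrow> x \<in> fst c \<Longrightarrow> g \<in> O_stalk A x \<Longrightarrow> pd c i g \<in> O_stalk A x"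
  using M_O[OF M_dx[OF _ _ pconst_M], of c g i 0] by (simp add: Mf_dx_def pconst_def pshift_def)

lemma O_f: "f \<in> O_stalk A x"
  using hol_f by (auto simp: O_stalk_def intro: always_eventually)

lemma geq_mu:
  assumes "u \<in> M"
  shows "geq (mu G (pmul g u)) (pmul g (mu G u))"
    and "geq (mu G (t u)) (t (mu G u))"
    and "geq (mu G (pshift u)) (pshift (mu G u) - mu (\<lambda>j. G (Suc j)) u)"
proof -
  obtain K where "\<forall>\<^sub>F y in nhds x. \<forall>k>K. u k y = 0" using assms by (auto simp: Mf_def)
  note K = eventually_mono[OF this]
  show "geq (mu G (pmul g u)) (pmul g (mu G u))"
    unfolding germ_eq_def by (rule K) (blast intro: mu_pmul)
  show "geq (mu G (t u)) (t (mu G u))"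
    unfolding germ_eq_def by (rule K) (blast intro: mu_t)
  show "geq (mu G (pshift u)) (pshift (mu G u) - mu (\<lambda>j. G (Suc j)) u)"
    unfolding germ_eq_def minus_apply by (rule K) (blast intro: mu_dt)
qed

text \<open>Up to sign this function is the coefficient of \<delta> in G \<partial>_t^j \<delta>,
  and the coefficients of elements of M_f are holomorphic.\<close>

lemma mulY_O:
  assumes "G \<in> O_prod_stalk A (x, f x)"
  shows "(\<lambda>y. (deriv ^^ j) (\<lambda>t. G (y, t)) (f y)) \<in> O_stalk A x"
proof -
  define H where "H = (\<lambda>j y. (deriv ^^ j) (\<lambda>t. G (y, t)) (f y))"
  have "(pshift ^^ j) (pconst (\<lambda>_. 1)) \<in> M"
    by (induction j) (auto intro: M_dt pconst_M const_O_stalk)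
  then have "Mf_mulY f G ((pshift ^^ j) (pconst (\<lambda>_. 1))) \<in> M"
    using M_op gen_V0_ops(4)[OF assms] by blast
  then have "mu H ((pshift ^^ j) (pconst (\<lambda>_. 1))) 0 \<in> O_stalk A x"
    unfolding Mf_mulY_mu H_def by (rule M_O)
  moreover have "mu H ((pshift ^^ j) (pconst (\<lambda>_. 1))) 0 = (\<lambda>y. (-1) ^ j * H j y)"
    by (intro ext) (simp add: mu_def pshift_pow_pconst)
  ultimately have "(\<lambda>y. (-1) ^ j * ((-1) ^ j * H j y)) \<in> O_stalk A x"
    using O_mult[OF const_O_stalk] by metis
  then show ?thesis by (simp add: H_def flip: mult.assoc power_mult_distrib)
qed

text \<open>For h = 1 this is the lattice L of the overview. For h = f the generator is f \<delta> =
  t \<delta>, and the lattice is t L.\<close>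

definition L :: "('a \<Rightarrow> complex) \<Rightarrow> (nat \<Rightarrow> 'a \<Rightarrow> complex) set" where
  "L h = {u \<in> M. \<exists>P\<in>Lops A f x. geq u (P (pconst h))}"

lemma L_M: "u \<in> L h \<Longrightarrow> u \<in> M"
  by (simp add: L_def)

lemma L_gen: "h \<in> O_stalk A x \<Longrightarrow> pconst h \<in> L h"
  unfolding L_def Lops_def using pconst_M ring_gen.one germ_eq_refl by fastforce

lemma L_germ: "u \<in> L h \<Longrightarrow> geq u v \<Longrightarrow> v \<in> L h"
  unfolding L_def using M_germ germ_eq_sym germ_eq_trans by blast

lemma L_diff: "u \<in> L h \<Longrightarrow> v \<in> L h \<Longrightarrow> u - v \<in> L h"
  unfolding L_def Lops_def using M_diff germ_eq_diff ring_gen.diff by fastforce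

lemma L_op: "P \<in> Lops A f x \<Longrightarrow> u \<in> L h \<Longrightarrow> P u \<in> L h"
proof -
  assume P: "P \<in> Lops A f x" and "u \<in> L h"
  then obtain Q where Q: "Q \<in> Lops A f x" "geq u (Q (pconst h))" "u \<in> M" by (auto simp: L_def)
  then have "geq (P u) (P (Q (pconst h)))" using P germ_eq_V0_ops Lops_V0_ops by blast
  moreover have "(\<lambda>v. P (Q v)) \<in> Lops A f x" using P Q(1) unfolding Lops_def by (rule ring_gen.comp)
  ultimately show ?thesis using M_op[OF Lops_V0_ops[OF P] Q(3)] by (auto simp: L_def)
qed

lemma L_pmul: "g \<in> O_stalk A x \<Longrightarrow> u \<in> L h \<Longrightarrow> pmul g u \<in> L h"
  and L_s: "u \<in> L h \<Longrightarrow> Mf_s f u \<in> L h"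
  and L_dx: "c \<in> A \<Longrightarrow> x \<in> fst c \<Longrightarrow> u \<in> L h \<Longrightarrow> Mf_dx f c i u \<in> L h"
  using L_op gen_Lops by blast+

lemma L_0: "h \<in> O_stalk A x \<Longrightarrow> 0 \<in> L h"
  using L_diff[OF L_gen L_gen, of h] by simp

lemma L_add: "h \<in> O_stalk A x \<Longrightarrow> u \<in> L h \<Longrightarrow> v \<in> L h \<Longrightarrow> u + v \<in> L h"
  using L_diff[of u h "0 - v"] L_diff[OF L_0, of h v] by simp

lemma L_sact: "h \<in> O_stalk A x \<Longrightarrow> u \<in> L h \<Longrightarrow> sact f p u \<in> L h"
  by (induction p) (auto simp: sact_pCons L_0 intro!: L_add L_pmul L_s const_O_stalk)

text \<open>It suffices to move t past the generators. The set S is arbitrary because both D_X[s]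
  and V^0 D_Y are treated in this way.\<close>

lemma ring_gen_t:
  assumes "P \<in> ring_gen S" "S \<subseteq> V0_ops A f x"
    and "\<And>P. P \<in> S \<Longrightarrow> \<exists>P'\<in>ring_gen S. \<forall>u\<in>M. geq (t (P u)) (P' (t u))"
  shows "\<exists>P'\<in>ring_gen S. \<forall>u\<in>M. geq (t (P u)) (P' (t u))"
  using assms(1)
proof induction
  case one
  show ?case using ring_gen.one germ_eq_refl by fastforce
next
  case (gen P)
  then show ?case by (rule assms(3))
next
  case (diff P Q)
  then obtain P' Q' where "P' \<in> ring_gen S" "\<forall>u\<in>M. geq (t (P u)) (P' (t u))"
    "Q' \<in> ring_gen S" "\<forall>u\<in>M. geq (t (Q u)) (Q' (t u))" by blast
  then show ?case
    by (intro bexI[of _ "\<lambda>u. P' u - Q' u"]) (auto simp: Mf_t_diff intro: ring_gen.diff germ_eq_diff)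
next
  case (comp P Q)
  have V0: "R \<in> V0_ops A f x" if "R \<in> ring_gen S" for R
    using that assms(2)
  proof induction
    case (gen P) then show ?case by blast
  qed (auto simp: V0_ops_def intro: ring_gen.intros)
  obtain P' Q' where P': "P' \<in> ring_gen S" "\<forall>u\<in>M. geq (t (P u)) (P' (t u))"
    and Q': "Q' \<in> ring_gen S" "\<forall>u\<in>M. geq (t (Q u)) (Q' (t u))" using comp.IH by blast
  have "geq (t (P (Q u))) (P' (Q' (t u)))" if "u \<in> M" for u
  proof -
    have "geq (t (P (Q u))) (P' (t (Q u)))" using P' M_op[OF V0[OF comp.hyps(2)] that] by blast
    moreover have "geq (P' (t (Q u))) (P' (Q' (t u)))"
      using germ_eq_V0_ops[OF V0[OF P'(1)]] Q' that by blast
    ultimately show ?thesis by (rule germ_eq_trans)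
  qed
  then show ?case
    by (intro bexI[of _ "\<lambda>u. P' (Q' u)"]) (auto intro: ring_gen.comp P' Q')
qed

lemma D_gens_t:
  assumes "P \<in> D_gens A pmul (Mf_dx f) x \<union> {Mf_s f}" "D_gens A pmul (Mf_dx f) x \<union> {Mf_s f} \<subseteq> S"
  shows "\<exists>P'\<in>ring_gen S. \<forall>u\<in>M. geq (t (P u)) (P' (t u))"
proof -
  have P: "P \<in> ring_gen S" using assms by (auto intro: ring_gen.gen)
  consider "\<exists>g. P = pmul g" | "\<exists>c i. c \<in> A \<and> x \<in> fst c \<and> P = Mf_dx f c i" | "P = Mf_s f"
    using assms(1) unfolding D_gens_def by blast
  then show ?thesis
  proof cases
    case 1
    with P show ?thesis by (auto intro!: bexI[of _ P] simp: Mf_t_pmul germ_eq_refl)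
  next
    case 2
    with P show ?thesis by (auto intro!: bexI[of _ P] t_dx)
  next
    case 3
    with P show ?thesis
      by (intro bexI[of _ "\<lambda>u. Mf_s f u + u"])
         (auto simp: Mf_t_s germ_eq_refl intro: ring_gen_add ring_gen.one)
  qed
qed

lemma Lops_t:
  assumes "P \<in> Lops A f x"
  shows "\<exists>P'\<in>Lops A f x. \<forall>u\<in>M. geq (t (P u)) (P' (t u))"
  using assms unfolding Lops_def
  by (rule ring_gen_t) (auto simp: V0_ops_def intro: ring_gen.gen intro!: D_gens_t)

lemma V0_ops_t:
  assumes "P \<in> V0_ops A f x"
  shows "\<exists>P'\<in>V0_ops A f x. \<forall>u\<in>M. geq (t (P u)) (P' (t u))"
  using assms unfolding V0_ops_def
proof (rule ring_gen_t)
  let ?S = "{Mf_mulY f G | G. G \<in> O_prod_stalk A (x, f x)} \<union> D_gens A pmul (Mf_dx f) x \<union> {Mf_s f}"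
  show "?S \<subseteq> V0_ops A f x" unfolding V0_ops_def by (auto intro: ring_gen.gen)
  fix P assume P: "P \<in> ?S"
  show "\<exists>P'\<in>ring_gen ?S. \<forall>u\<in>M. geq (t (P u)) (P' (t u))"
  proof (cases "\<exists>G. P = Mf_mulY f G")
    case True
    then obtain G where G: "P = Mf_mulY f G" by blast
    have "geq (t (P u)) (P (t u))" if "u \<in> M" for u
      using germ_eq_sym[OF geq_mu(2)[OF that]] by (simp add: G Mf_mulY_mu)
    with P show ?thesis by (meson ring_gen.gen)
  next
    case False
    with P show ?thesis by (intro D_gens_t) auto
  qed
qed

lemma V0_ops_t_pow:
  assumes "P \<in> V0_ops A f x"
  shows "\<exists>P'\<in>V0_ops A f x. \<forall>u\<in>M. geq ((t ^^ n) (P u)) (P' ((t ^^ n) u))"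
proof (induction n)
  case 0
  show ?case using assms by (auto intro!: bexI[of _ P] germ_eq_refl)
next
  case (Suc n)
  then obtain P' where P': "P' \<in> V0_ops A f x" "\<forall>u\<in>M. geq ((t ^^ n) (P u)) (P' ((t ^^ n) u))" by blast
  obtain P'' where P'': "P'' \<in> V0_ops A f x" "\<forall>u\<in>M. geq (t (P' u)) (P'' (t u))"
    using V0_ops_t[OF P'(1)] by blast
  have "geq ((t ^^ Suc n) (P u)) (P'' ((t ^^ Suc n) u))" if "u \<in> M" for u
    using germ_eq_trans[OF germ_eq_t[of x "(t ^^ n) (P u)" "P' ((t ^^ n) u)" f]] P'(2) P''(2) M_t_pow[OF that] that
    by simp
  with P''(1) show ?case by blast
qed

lemma L_t: "h \<in> O_stalk A x \<Longrightarrow> u \<in> L h \<Longrightarrow> t u \<in> L (\<lambda>y. f y * h y)"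
proof -
  assume h: "h \<in> O_stalk A x" and "u \<in> L h"
  then obtain P where P: "P \<in> Lops A f x" "geq u (P (pconst h))" "u \<in> M" by (auto simp: L_def)
  obtain P' where P': "P' \<in> Lops A f x" "\<forall>u\<in>M. geq (t (P u)) (P' (t u))" using Lops_t[OF P(1)] by blast
  have "geq (t u) (t (P (pconst h)))" using P(2) by (rule germ_eq_t)
  moreover have "geq (t (P (pconst h))) (P' (pconst (\<lambda>y. f y * h y)))"
    using P'(2) pconst_M[OF h] by (auto simp: Mf_t_pconst pmul_pconst)
  ultimately have "geq (t u) (P' (pconst (\<lambda>y. f y * h y)))" by (rule germ_eq_trans)
  then show ?thesis unfolding L_def using P'(1) M_t[OF P(3)] by blast
qed

lemma L_subset: "h \<in> O_stalk A x \<Longrightarrow> g \<in> O_stalk A x \<Longrightarrow> u \<in> L (\<lambda>y. g y * h y) \<Longrightarrow> u \<in> L h"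
proof -
  assume h: "h \<in> O_stalk A x" "g \<in> O_stalk A x" and "u \<in> L (\<lambda>y. g y * h y)"
  then obtain P where P: "P \<in> Lops A f x" "geq u (P (pmul g (pconst h)))" by (auto simp: L_def pmul_pconst)
  then show ?thesis using L_germ[OF L_op[OF P(1) L_pmul[OF h(2) L_gen[OF h(1)]]]] germ_eq_sym by blast
qed

abbreviation "L1 \<equiv> L (\<lambda>_. 1)"
abbreviation "Lf \<equiv> L f"

lemma L1_t: "u \<in> L1 \<Longrightarrow> t u \<in> Lf"
  using L_t[OF const_O_stalk[of 1]] by simp

lemma Lf_L1: "u \<in> Lf \<Longrightarrow> u \<in> L1"
  using L_subset[OF const_O_stalk[of 1] O_f] by simp

lemma L1_t_pow: "u \<in> L1 \<Longrightarrow> (t ^^ n) u \<in> L1"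
  by (induction n) (auto intro: L1_t Lf_L1)

lemma L_t_same: "h \<in> O_stalk A x \<Longrightarrow> u \<in> L h \<Longrightarrow> t u \<in> L h"
  using L_t[of h u] L_subset[of h f "t u"] O_f by blast

text \<open>Though defined by D_X[s] alone, the lattice is stable under functions of (x, t): these
  act on h \<delta> through their restriction to t = f, and their commutators with the generators of
  D_X[s] are again of the form \<open>mu\<close>, up to a factor t.\<close>

lemma L_mu:
  assumes h: "h \<in> O_stalk A x" and u: "u \<in> L h" and G: "\<And>j. G j \<in> O_stalk A x"
  shows "mu G u \<in> L h"
proof -
  \<comment> \<open>All sequences are treated at once, because a commutator replaces G by one of its
    derivatives.\<close>
  define L' where "L' = {u \<in> L h. \<forall>G. (\<forall>j. G j \<in> O_stalk A x) \<longrightarrow> mu G u \<in> L h}"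
  have L': "P u \<in> L'" if "P \<in> Lops A f x" "u \<in> L'" for P u
    using that unfolding Lops_def
  proof (induction arbitrary: u)
    case (gen P)
    have uL: "u \<in> L h" "u \<in> M" and uG: "\<And>G. \<forall>j. G j \<in> O_stalk A x \<Longrightarrow> mu G u \<in> L h"
      using gen.prems L_M by (auto simp: L'_def)
    have "P \<in> Lops A f x" using ring_gen.gen[OF gen.hyps] by (simp only: Lops_def)
    from L_op[OF this uL(1)] have "P u \<in> L h" .
    moreover have "mu G (P u) \<in> L h" if G: "\<forall>j. G j \<in> O_stalk A x" for G
    proof -
      consider g where "g \<in> O_stalk A x" "P = pmul g" | c i where "c \<in> A" "x \<in> fst c" "P = Mf_dx f c i" | "P = Mf_s f"
        using gen.hyps by (auto simp: D_gens_def)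
      then show ?thesis
      proof cases
        case 1
        then show ?thesis
          using L_germ[OF L_pmul[OF _ uG[OF G]] germ_eq_sym[OF geq_mu(1)[OF uL(2)]]] by blast
      next
        case 2
        let ?H = "\<lambda>j y. pd c i (G j) y - pd c i f y * G (Suc j) y"
        have "\<forall>j. ?H j \<in> O_stalk A x" using 2 G O_f by (intro allI O_diff O_mult O_pd) auto
        note H = uG[OF this]
        have "geq (Mf_dx f c i (mu G u)) (mu G (P u) + mu ?H u)"
          unfolding 2 using 2 uL G by (intro dx_mu) auto
        then have "mu G (P u) + mu ?H u \<in> L h"
          using L_germ L_dx[OF 2(1,2) uG[OF G]] by blast
        from L_diff[OF this H] show ?thesis by simp
      next
        case 3
        \<comment> \<open>The aim is G s = s G + t (\<partial>_t G), a consequence of s =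
          -\<partial>_t t.\<close>
        let ?H = "\<lambda>j. G (Suc j)"
        have "\<forall>j. ?H j \<in> O_stalk A x" using G by blast
        note H = L_t_same[OF h uG[OF this]]
        have a: "geq (mu G (pshift (t u))) (pshift (mu G (t u)) - mu ?H (t u))"
          by (rule geq_mu(3)[OF M_t[OF uL(2)]])
        have "geq (pshift (mu G (t u)) - mu ?H (t u)) (pshift (t (mu G u)) - t (mu ?H u))"
          by (intro germ_eq_diff germ_eq_dt geq_mu(2) uL)
        with a have b: "geq (mu G (pshift (t u))) (- Mf_s f (mu G u) - t (mu ?H u))"
          unfolding Mf_dt_t by (rule germ_eq_trans)
        have "mu G (Mf_s f u) = 0 - mu G (pshift (t u))"
          by (intro ext) (simp add: mu_def Mf_s_def fun_apply sum_negf)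
        moreover have "geq (0 - mu G (pshift (t u))) (0 - (- Mf_s f (mu G u) - t (mu ?H u)))"
          by (intro germ_eq_diff germ_eq_refl b)
        moreover have "0 - (- Mf_s f (mu G u) - t (mu ?H u)) = Mf_s f (mu G u) + t (mu ?H u)"
          by simp
        ultimately have "geq (mu G (P u)) (Mf_s f (mu G u) + t (mu ?H u))" by (simp only: 3)
        then show ?thesis
          using L_germ[OF L_add[OF h L_s[OF uG[OF G]] H]] germ_eq_sym by blast
      qed
    qed
    ultimately show ?case by (auto simp: L'_def)
  next
    case (diff P Q)
    have L'PQ: "P u \<in> L'" "Q u \<in> L'" using diff by blast+
    have dist: "geq (mu G (P u - Q u)) (mu G (P u) - mu G (Q u))" if "P u \<in> M" "Q u \<in> M" for G
    proof -
      obtain K K' where K: "\<forall>\<^sub>F y in nhds x. \<forall>k>K. P u k y = 0" "\<forall>\<^sub>F y in nhds x. \<forall>k>K'. Q u k y = 0"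
        using \<open>P u \<in> M\<close> \<open>Q u \<in> M\<close> unfolding Mf_def by blast
      then show ?thesis unfolding germ_eq_def
      proof eventually_elim
        case (elim y)
        let ?K = "max K K'"
        have "\<forall>k>?K. P u k y = 0" "\<forall>k>?K. Q u k y = 0" "\<forall>k>?K. (P u - Q u) k y = 0"
          using elim by (auto simp: fun_apply)
        note eqs = this(1)[THEN mu_eq[where u = "P u", OF _ order_refl]] this(2)[THEN mu_eq[where u = "Q u", OF _ order_refl]]
          this(3)[THEN mu_eq[where u = "P u - Q u", OF _ order_refl]]
        show ?case unfolding minus_apply eqs
          by (simp add: sum_subtractf algebra_simps)
      qed
    qed
    have LPQ: "P u \<in> L h" "Q u \<in> L h" using L'PQ unfolding L'_def by blast+
    have "mu G (P u - Q u) \<in> L h" if "\<forall>j. G j \<in> O_stalk A x" for G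
    proof -
      have "mu G (P u) \<in> L h" "mu G (Q u) \<in> L h" using L'PQ that unfolding L'_def by blast+
      then show ?thesis by (rule L_germ[OF L_diff germ_eq_sym[OF dist[OF LPQ[THEN L_M]]]])
    qed
    then show ?case
      using L_diff[OF LPQ] unfolding L'_def by blast
  qed auto
  have "pconst h \<in> L'"
    unfolding L'_def
  proof safe
    fix G :: "nat \<Rightarrow> 'a \<Rightarrow> complex" assume G: "\<forall>j. G j \<in> O_stalk A x"
    have "mu G (pconst h) = pmul (G 0) (pconst h)"
    proof (intro ext)
      fix m y
      have "\<forall>k>0. pconst h k y = 0" by (simp add: pconst_apply)
      from mu_eq[where u = "pconst h", OF this order_refl, of G m]
      show "mu G (pconst h) m y = pmul (G 0) (pconst h) m y"
        by (simp add: op_apply)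
    qed
    then show "mu G (pconst h) \<in> L h" using G L_pmul L_gen h by simp
  qed (rule L_gen[OF h])
  moreover obtain P where P: "P \<in> Lops A f x" "geq u (P (pconst h))" using u by (auto simp: L_def)
  ultimately have "mu G (P (pconst h)) \<in> L h" using L'[of P] G by (auto simp: L'_def)
  then show ?thesis using L_germ germ_eq_sym[OF germ_eq_mu[OF P(2)]] by blast
qed

lemma L_V0_ops: "P \<in> V0_ops A f x \<Longrightarrow> h \<in> O_stalk A x \<Longrightarrow> u \<in> L h \<Longrightarrow> P u \<in> L h"
  unfolding V0_ops_def
proof (induction arbitrary: u rule: ring_gen.induct)
  case (gen P)
  then show ?case
    by (auto simp: Mf_mulY_mu D_gens_def intro: L_pmul L_s L_dx intro!: L_mu mulY_O)
qed (auto intro: L_diff)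

text \<open>The section t^n \<partial>_t^k \<delta> lies in L once n \<ge> k, as t^k \<partial>_t^k
  is a polynomial in s; an element of M_f has finitely many terms, which are added one degree at a
  time.\<close>

lemma t_pow_L1:
  assumes "g \<in> M"
  shows "\<exists>K. \<forall>n\<ge>K. (t ^^ n) g \<in> L1"
proof -
  obtain K where K: "\<forall>\<^sub>F y in nhds x. \<forall>k>K. g k y = 0" using assms by (auto simp: Mf_def)
  define w where "w = (\<lambda>m k y. if k < m then g k y else 0)"
  have "(t ^^ n) g \<in> L1" if n: "n \<ge> K" for n
  proof -
    have "(t ^^ n) (w m) \<in> L1" if "m \<le> Suc n" for m
      using that
    proof (induction m)
      case 0
      have "w 0 = 0" by (intro ext) (simp add: w_def fun_apply)
      moreover have "(t ^^ n) 0 = 0" using Mf_t_pow_diff[of n f 0 0] by simp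
      ultimately show ?case using L_0[OF const_O_stalk] by simp
    next
      case (Suc m)
      have eq: "w (Suc m) = w m + pmul (g m) ((pshift ^^ m) (pconst (\<lambda>_. 1)))"
        by (intro ext) (auto simp: w_def op_apply pshift_pow_pconst less_Suc_eq)
      obtain q where q: "\<And>u. (t ^^ m) ((pshift ^^ m) u) = sact f q u" using Mf_t_pow_dt_pow[of m f] by blast
      have "(t ^^ n) ((pshift ^^ m) (pconst (\<lambda>_. 1))) = (t ^^ (n - m)) ((t ^^ m) ((pshift ^^ m) (pconst (\<lambda>_. 1))))"
        using Suc.prems by (simp flip: funpow_add[THEN fun_cong, unfolded comp_apply])
      also have "\<dots> \<in> L1"
        unfolding q by (intro L1_t_pow L_sact L_gen const_O_stalk)
      finally have "(t ^^ n) (pmul (g m) ((pshift ^^ m) (pconst (\<lambda>_. 1)))) \<in> L1"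
        unfolding Mf_t_pow_pmul by (intro L_pmul M_O[OF assms])
      then show ?case
        unfolding eq Mf_t_pow_add using Suc by (intro L_add const_O_stalk) auto
    qed
    moreover have "geq (w (Suc n)) g"
      unfolding germ_eq_def using K
      by eventually_elim (use n in \<open>auto simp: w_def\<close>)
    ultimately show ?thesis using L_germ germ_eq_t_pow by blast
  qed
  then show ?thesis by blast
qed

text \<open>From some index \<gamma> on, V^(\<gamma>+n) = t^n V^\<gamma>. Powers of t carry the
  finitely many generators of V^\<gamma> over V^0 D_Y into t L, and t L is stable under that
  ring.\<close>

lemma V_big: "\<exists>\<gamma>\<^sub>1. \<forall>\<gamma>\<ge>\<gamma>\<^sub>1. V \<gamma> x \<subseteq> Lf"
proof -
  obtain \<gamma>\<^sub>0 where "\<forall>\<^sub>F y in nhds x. \<forall>\<gamma>\<ge>\<gamma>\<^sub>0. V (\<gamma> + 1) y = {v. \<exists>u\<in>V \<gamma> y. germ_eq y v (t u)}"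
    using V_t_onto by blast
  from eventually_nhds_x_imp_x[OF this]
  have on: "\<And>\<gamma> v. \<gamma> \<ge> \<gamma>\<^sub>0 \<Longrightarrow> v \<in> V (\<gamma> + 1) x \<Longrightarrow> \<exists>u\<in>V \<gamma> x. geq v (t u)" by blast
  have onto: "\<exists>u\<in>V \<gamma>\<^sub>0 x. geq v ((t ^^ n) u)" if "v \<in> V (\<gamma>\<^sub>0 + of_nat n) x" for v n
    using that
  proof (induction n arbitrary: v)
    case 0
    then show ?case using germ_eq_refl by auto
  next
    case (Suc n)
    then obtain u where u: "u \<in> V (\<gamma>\<^sub>0 + of_nat n) x" "geq v (t u)"
      using on[of "\<gamma>\<^sub>0 + of_nat n" v] by (auto simp: add_ac)
    obtain w where "w \<in> V \<gamma>\<^sub>0 x" "geq u ((t ^^ n) w)" using Suc.IH[OF u(1)] by blast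
    with u(2) show ?case using germ_eq_trans germ_eq_t by fastforce
  qed
  obtain G where fin: "finite G" and "\<forall>\<^sub>F y in nhds x. V \<gamma>\<^sub>0 y =
     {u. \<exists>P. (\<forall>g\<in>G. P g \<in> V0_ops A f y) \<and> germ_eq y u (\<Sum>g\<in>G. P g g)}"
    using V_fg[of \<gamma>\<^sub>0] unfolding V0_locally_fg_def by blast
  from eventually_nhds_x_imp_x[OF this(2)]
  have V0: "V \<gamma>\<^sub>0 x = {u. \<exists>P. (\<forall>g\<in>G. P g \<in> V0_ops A f x) \<and> geq u (\<Sum>g\<in>G. P g g)}" .
  have GM: "g \<in> M" if "g \<in> G" for g
  proof -
    \<comment> \<open>Taking the identity for g and zero for the other generators exhibits g itself
      as an element of \<open>V \<gamma>\<^sub>0 x\<close>.\<close>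
    define P where "P = (\<lambda>h u :: nat \<Rightarrow> 'a \<Rightarrow> complex. if h = g then u else 0)"
    have "P h \<in> V0_ops A f x" for h
      unfolding P_def V0_ops_def using ring_gen.one ring_gen_zero by (cases "h = g") auto
    moreover have "(\<Sum>h\<in>G. P h h) = g" using fin that by (simp add: P_def)
    ultimately have "g \<in> V \<gamma>\<^sub>0 x" unfolding V0 using germ_eq_refl[of x g] by (intro CollectI exI[of _ P]) simp
    then show ?thesis by (rule V_M)
  qed
  have "\<forall>g\<in>G. \<exists>K. \<forall>n\<ge>K. (t ^^ n) g \<in> L1" using GM t_pow_L1 by blast
  then obtain K where K: "\<And>g n. g \<in> G \<Longrightarrow> n \<ge> K g \<Longrightarrow> (t ^^ n) g \<in> L1" by metis
  \<comment> \<open>One power of t more than is needed to reach L leads into t L.\<close>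
  define n where "n = Suc (Max (insert 0 (K ` G)))"
  have nK: "(t ^^ n) g \<in> Lf" if "g \<in> G" for g
  proof -
    have "K g \<le> Max (insert 0 (K ` G))" using fin that by (intro Max_ge) auto
    then show ?thesis unfolding n_def using K[OF that] L1_t by simp
  qed
  have "V (\<gamma>\<^sub>0 + of_nat n) x \<subseteq> Lf"
  proof
    fix v assume "v \<in> V (\<gamma>\<^sub>0 + of_nat n) x"
    then obtain u where u: "u \<in> V \<gamma>\<^sub>0 x" "geq v ((t ^^ n) u)" using onto by blast
    then obtain P where P: "\<And>g. g \<in> G \<Longrightarrow> P g \<in> V0_ops A f x" "geq u (\<Sum>g\<in>G. P g g)" unfolding V0 by blast
    have "(t ^^ n) (\<Sum>g\<in>G'. P g g) \<in> Lf" if "G' \<subseteq> G" for G'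
      using finite_subset[OF that fin] that
    proof (induction G')
      case empty
      have "(t ^^ n) 0 = 0" using Mf_t_pow_diff[of n f 0 0] by simp
      then show ?case using L_0[OF O_f] by simp
    next
      case (insert g G')
      obtain P' where P': "P' \<in> V0_ops A f x" "\<forall>u\<in>M. geq ((t ^^ n) (P g u)) (P' ((t ^^ n) u))"
        using V0_ops_t_pow[OF P(1)] insert.prems by blast
      have "P' ((t ^^ n) g) \<in> Lf" using L_V0_ops[OF P'(1) O_f] nK insert.prems by blast
      then have "(t ^^ n) (P g g) \<in> Lf"
        using P'(2) GM insert.prems L_germ germ_eq_sym by (meson insertI1 subsetD)
      moreover have "(t ^^ n) (\<Sum>g\<in>G'. P g g) \<in> Lf" using insert by blast
      ultimately show ?case
        using insert.hyps by (simp add: Mf_t_pow_add L_add O_f)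
    qed
    then have "(t ^^ n) (\<Sum>g\<in>G. P g g) \<in> Lf" by blast
    moreover have "geq v ((t ^^ n) (\<Sum>g\<in>G. P g g))" using germ_eq_trans[OF u(2) germ_eq_t_pow[OF P(2)]] .
    ultimately show "v \<in> Lf" using L_germ germ_eq_sym by blast
  qed
  then show ?thesis using V_anti by blast
qed

end

subsection \<open>The graded pieces of the \<open>V\<close>-filtration\<close>

lemma coset_eq_iff:
  assumes "0 \<in> B" "\<And>u v. u \<in> B \<Longrightarrow> v \<in> B \<Longrightarrow> u - v \<in> B"
  shows "coset B u = B \<longleftrightarrow> u \<in> B"
proof
  assume "coset B u = B"
  moreover have "u \<in> coset B u" using assms(1) by (simp add: coset_def)
  ultimately show "u \<in> B" by simp
next
  assume u: "u \<in> B"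
  have "v - u \<in> B \<longleftrightarrow> v \<in> B" for v
  proof
    assume "v - u \<in> B"
    from assms(2)[OF this assms(2)[OF assms(1) u]] show "v \<in> B" by simp
  qed (use u assms(2) in blast)
  then show "coset B u = B" by (auto simp: coset_def)
qed

lemma induced_coset:
  assumes "0 \<in> B" "\<And>u v. u \<in> B \<Longrightarrow> v \<in> B \<Longrightarrow> u - v \<in> B"
    and "\<And>u v. T (u - v) = T u - T v" "\<And>u. u \<in> B \<Longrightarrow> T u \<in> B"
  shows "induced B T (coset B u) = coset B (T u)"
proof -
  have "coset B (T v) = coset B (T u)" if "v \<in> coset B u" for v
  proof -
    have d: "T v - T u \<in> B" using that assms(3,4) by (metis coset_def mem_Collect_eq)
    have "w - T v \<in> B \<longleftrightarrow> w - T u \<in> B" for w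
    proof
      assume "w - T v \<in> B"
      from assms(2)[OF this assms(2)[OF assms(1) d]] show "w - T u \<in> B" by simp
    next
      assume "w - T u \<in> B"
      from assms(2)[OF this d] show "w - T v \<in> B" by simp
    qed
    then show ?thesis by (simp add: coset_def)
  qed
  moreover have "u \<in> coset B u" using assms(1) by (simp add: coset_def)
  ultimately show ?thesis unfolding induced_def by blast
qed

lemma induced_pow_coset:
  assumes "0 \<in> B" "\<And>u v. u \<in> B \<Longrightarrow> v \<in> B \<Longrightarrow> u - v \<in> B"
    and "\<And>u v. T (u - v) = T u - T v" "\<And>u. u \<in> B \<Longrightarrow> T u \<in> B"
  shows "(induced B T ^^ k) (coset B u) = coset B ((T ^^ k) u)"
  by (induction k) (simp_all add: induced_coset[OF assms])

lemma ceiling_ceiling_divide: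
  fixes y :: rat
  assumes "q > 0"
  shows "\<lceil>of_int \<lceil>of_nat q * y\<rceil> / (of_nat q :: rat)\<rceil> = \<lceil>y\<rceil>"
proof (rule antisym)
  have "\<lceil>of_nat q * y\<rceil> \<le> int q * \<lceil>y\<rceil>"
    using assms by (simp add: ceiling_le_iff mult_left_mono)
  then have "of_int \<lceil>of_nat q * y\<rceil> \<le> (of_nat q * of_int \<lceil>y\<rceil> :: rat)"
    by (metis of_int_le_iff of_int_mult of_int_of_nat_eq)
  then have "of_int \<lceil>of_nat q * y\<rceil> / of_nat q \<le> (of_int \<lceil>y\<rceil> :: rat)"
    using assms by (simp add: divide_le_eq mult.commute)
  then show "\<lceil>of_int \<lceil>of_nat q * y\<rceil> / (of_nat q :: rat)\<rceil> \<le> \<lceil>y\<rceil>" by (simp add: ceiling_le_iff)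
  have "y \<le> of_int \<lceil>of_nat q * y\<rceil> / of_nat q"
    using assms by (simp add: le_divide_eq mult.commute)
  then show "\<lceil>y\<rceil> \<le> \<lceil>of_int \<lceil>of_nat q * y\<rceil> / (of_nat q :: rat)\<rceil>" by (rule ceiling_mono)
qed

text \<open>Bezout for p and s - a. It replaces the splitting into generalized eigenspaces: what p
  kills modulo a \<complex>[s]-submodule is divisible by s - a modulo that submodule.\<close>

lemma sact_split_root:
  assumes "poly p a \<noteq> 0"
  shows "\<exists>q. \<forall>u. u = sact f (smult (1 / poly p a) p) u + sact f [:-a, 1:] (sact f q u)"
proof -
  define l where "l = [:-a, 1:]"
  obtain q where q: "p = [:poly p a:] + l * q" using poly_split_root unfolding l_def by blast
  have "smult (1 / poly p a) p + l * smult (- 1 / poly p a) q = smult (1 / poly p a) (p - l * q)"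
    by (simp add: smult_diff_right)
  also have "p - l * q = [:poly p a:]" using q by (metis add_diff_cancel_right')
  also have "smult (1 / poly p a) [:poly p a:] = 1" using assms by (simp add: one_pCons)
  finally have "smult (1 / poly p a) p + [:-a, 1:] * smult (- 1 / poly p a) q = 1" by (simp only: l_def)
  then show ?thesis by (metis sact_1 sact_add sact_mult)
qed

context V_filtration
begin

lemma V_gt_iff: "u \<in> V_gt V \<gamma> x \<longleftrightarrow> (\<exists>\<gamma>'>\<gamma>. u \<in> V \<gamma>' x)"
  by (auto simp: V_gt_def)

lemma V_gt_0: "0 \<in> V_gt V \<gamma> x"
  unfolding V_gt_iff using V_0 by (intro exI[of _ "\<gamma> + 1"]) auto

lemma V_gt_diff: "u \<in> V_gt V \<gamma> x \<Longrightarrow> v \<in> V_gt V \<gamma> x \<Longrightarrow> u - v \<in> V_gt V \<gamma> x"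
proof -
  assume "u \<in> V_gt V \<gamma> x" "v \<in> V_gt V \<gamma> x"
  then obtain a b where ab: "a > \<gamma>" "u \<in> V a x" "b > \<gamma>" "v \<in> V b x" unfolding V_gt_iff by blast
  then have "u \<in> V (min a b) x" "v \<in> V (min a b) x" by (auto intro: V_mono)
  then have "u - v \<in> V (min a b) x" by (rule V_diff)
  with ab show ?thesis unfolding V_gt_iff by (intro exI[of _ "min a b"]) auto
qed

lemma V_gt_sact: "u \<in> V_gt V \<gamma> x \<Longrightarrow> sact f p u \<in> V_gt V \<gamma> x"
  unfolding V_gt_iff using V_sact by blast

lemma V_gt_pmul: "g \<in> O_stalk A x \<Longrightarrow> u \<in> V_gt V \<gamma> x \<Longrightarrow> pmul g u \<in> V_gt V \<gamma> x"
  unfolding V_gt_iff using V_pmul by blast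

lemma V_gt_V: "u \<in> V_gt V \<gamma> x \<Longrightarrow> u \<in> V \<gamma> x"
  unfolding V_gt_iff using V_mono by (meson less_imp_le)

lemma V_gt_t_pow: "u \<in> V_gt V \<gamma> x \<Longrightarrow> (t ^^ n) u \<in> V_gt V (\<gamma> + of_nat n) x"
  unfolding V_gt_iff using V_t_pow by (metis add_strict_right_mono)

text \<open>Local nilpotency of \<partial>_t t - \<gamma> = -(s + \<gamma>) yields an annihilating
  polynomial. Only the location of its roots is recorded: this is all that Bezout needs, and it
  behaves well under products.\<close>

lemma V_eigen:
  assumes "u \<in> V \<gamma> x"
  shows "\<exists>p. (\<forall>z. poly p z = 0 \<longrightarrow> z = - of_rat \<gamma>) \<and> sact f p u \<in> V_gt V \<gamma> x"
proof -
  let ?p = "[:- of_rat \<gamma>, -1:]" and ?B = "V_gt V \<gamma> x"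
  have T: "(\<lambda>u. pshift (t u) - pmul (\<lambda>_. of_rat \<gamma>) u) = sact f ?p"
    by (intro ext) (auto simp: sact_pCons Mf_dt_t op_apply)
  have "coset ?B u \<in> Gr V \<gamma> x" using assms by (simp add: Gr_def quot_def)
  from V_nilp[OF this, unfolded T] obtain k where "(induced ?B (sact f ?p) ^^ k) (coset ?B u) = ?B" ..
  moreover have "(induced ?B (sact f ?p) ^^ k) (coset ?B u) = coset ?B ((sact f ?p ^^ k) u)"
    by (intro induced_pow_coset V_gt_0 V_gt_diff V_gt_sact sact_diff_right)
  ultimately have "(sact f ?p ^^ k) u \<in> ?B"
    using coset_eq_iff[OF V_gt_0 V_gt_diff] by metis
  then have "sact f (?p ^ k) u \<in> ?B" by (simp only: sact_power)
  moreover have "\<forall>z. poly (?p ^ k) z = 0 \<longrightarrow> z = - of_rat \<gamma>"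
    by auto
  ultimately show ?thesis by blast
qed

text \<open>Refines the grid of the discreteness condition by the denominator of \<alpha>, so that
  \<alpha> becomes a grid point and steps of length 1 / D can end exactly there.\<close>

lemma V_grid:
  fixes \<alpha> :: rat
  shows "\<exists>D a. D > 0 \<and> \<alpha> = of_int a / of_nat D \<and> (\<forall>\<gamma>. V \<gamma> x = V (of_int \<lceil>of_nat D * \<gamma>\<rceil> / of_nat D) x)"
proof -
  obtain m :: nat where m: "m > 0" "\<forall>\<^sub>F y in nhds x. \<forall>\<gamma>. V \<gamma> y = V (of_int \<lceil>of_nat m * \<gamma>\<rceil> / of_nat m) y"
    using V_discrete by blast
  from eventually_nhds_x_imp_x[OF m(2)] have Vm: "\<And>\<gamma>. V \<gamma> x = V (of_int \<lceil>of_nat m * \<gamma>\<rceil> / of_nat m) x" by blast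
  obtain p q where pq: "quotient_of \<alpha> = (p, q)" by force
  have q: "q > 0" and \<alpha>: "\<alpha> = of_int p / of_int q"
    using quotient_of_denom_pos[OF pq] quotient_of_div[OF pq] by auto
  have nq: "nat q > 0" "of_nat (nat q) = (of_int q :: rat)" using q by (auto simp: of_nat_nat)
  have "V \<gamma> x = V (of_int \<lceil>of_nat (m * nat q) * \<gamma>\<rceil> / of_nat (m * nat q)) x" for \<gamma>
  proof -
    have "\<lceil>of_nat m * (of_int \<lceil>of_nat (m * nat q) * \<gamma>\<rceil> / of_nat (m * nat q)) :: rat\<rceil> =
        \<lceil>of_int \<lceil>of_nat (nat q) * (of_nat m * \<gamma>)\<rceil> / (of_nat (nat q) :: rat)\<rceil>"
      using m by (simp add: mult_ac)
    also have "\<dots> = \<lceil>of_nat m * \<gamma>\<rceil>" by (rule ceiling_ceiling_divide[OF nq(1)])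
    finally show ?thesis using Vm[of \<gamma>] Vm[of "of_int \<lceil>of_nat (m * nat q) * \<gamma>\<rceil> / of_nat (m * nat q)"] by simp
  qed
  moreover have "m * nat q > 0" using m nq by simp
  moreover have "\<alpha> = of_int (p * int m) / of_nat (m * nat q)"
    using m q nq unfolding \<alpha> by (simp add: field_simps)
  ultimately show ?thesis by blast
qed

lemma grid_step:
  assumes D: "D > 0" "\<And>\<gamma>. V \<gamma> x = V (of_int \<lceil>of_nat D * \<gamma>\<rceil> / of_nat D) x"
    and u: "u \<in> V_gt V (of_int i / of_nat D) x"
  shows "u \<in> V (of_int (i + 1) / of_nat D) x"
proof -
  obtain \<gamma> where \<gamma>: "\<gamma> > of_int i / of_nat D" "u \<in> V \<gamma> x" using u unfolding V_gt_iff by blast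
  have "of_int i < of_nat D * \<gamma>" using \<gamma>(1) D(1) by (simp add: divide_less_eq mult.commute)
  then have "i < \<lceil>of_nat D * \<gamma>\<rceil>" by (simp add: less_ceiling_iff)
  then have "of_int (i + 1) \<le> (of_int \<lceil>of_nat D * \<gamma>\<rceil> :: rat)" by (simp only: of_int_le_iff)
  then have "of_int (i + 1) / of_nat D \<le> (of_int \<lceil>of_nat D * \<gamma>\<rceil> / of_nat D :: rat)"
    by (rule divide_right_mono) simp
  then show ?thesis using \<gamma>(2) unfolding D(2)[of \<gamma>] by (rule V_mono[rotated])
qed

text \<open>Multiplies the polynomials of \<open>V_eigen\<close> over the finitely many grid points
  between \<gamma> and \<gamma>'. The half-open range of the roots later excludes -\<alpha>, or 0,
  from them.\<close>

lemma V_descend: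
  assumes "u \<in> V \<gamma> x"
  shows "\<exists>p. (\<forall>z. poly p z = 0 \<longrightarrow> (\<exists>r. \<gamma> \<le> r \<and> r < \<gamma>' \<and> z = - of_rat r)) \<and> sact f p u \<in> V \<gamma>' x"
proof -
  obtain D a where D: "D > 0" "\<And>\<gamma>. V \<gamma> x = V (of_int \<lceil>of_nat D * \<gamma>\<rceil> / of_nat D) x" and a: "\<gamma>' = of_int a / of_nat D"
    using V_grid[of \<gamma>'] by blast
  define i where "i = \<lceil>of_nat D * \<gamma>\<rceil>"
  have ui: "u \<in> V (of_int i / of_nat D) x" using assms D(2) i_def by metis
  have \<gamma>i: "\<gamma> \<le> of_int i / of_nat D" using D(1) by (simp add: i_def le_divide_eq mult.commute)
  show ?thesis
  proof (cases "i \<le> a")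
    case False
    then have "\<gamma>' \<le> of_int i / of_nat D" unfolding a by (intro divide_right_mono) auto
    then show ?thesis using V_mono[OF ui] by (intro exI[of _ 1]) (auto simp: sact_1)
  next
    case True
    have "\<exists>p. (\<forall>z. poly p z = 0 \<longrightarrow> (\<exists>l. i \<le> l \<and> l < a' \<and> z = - of_rat (of_int l / of_nat D)))
        \<and> sact f p u \<in> V (of_int a' / of_nat D) x" if "i \<le> a'" for a'
      using that
    proof (induction a' rule: int_ge_induct)
      case base
      then show ?case using ui by (intro exI[of _ 1]) (auto simp: sact_1)
    next
      case (step l)
      then obtain p where p: "\<And>z. poly p z = 0 \<Longrightarrow> (\<exists>l'. i \<le> l' \<and> l' < l \<and> z = - of_rat (of_int l' / of_nat D))"
        "sact f p u \<in> V (of_int l / of_nat D) x" by blast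
      obtain p' where p': "\<And>z. poly p' z = 0 \<Longrightarrow> z = - of_rat (of_int l / of_nat D)"
        "sact f p' (sact f p u) \<in> V_gt V (of_int l / of_nat D) x" using V_eigen[OF p(2)] by blast
      have "sact f (p' * p) u \<in> V (of_int (l + 1) / of_nat D) x"
        unfolding sact_mult by (rule grid_step[OF D p'(2)])
      moreover have "\<exists>l'. i \<le> l' \<and> l' < l + 1 \<and> z = - of_rat (of_int l' / of_nat D)"
        if z: "poly (p' * p) z = 0" for z
      proof -
        consider "poly p' z = 0" | "poly p z = 0" using z by auto
        then show ?thesis
        proof cases
          case 1
          then show ?thesis using p'(1) step.hyps by (intro exI[of _ l]) auto
        next
          case 2
          then obtain l' where "i \<le> l'" "l' < l" "z = - of_rat (of_int l' / of_nat D)" using p(1) by blast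
          then show ?thesis by (intro exI[of _ l']) auto
        qed
      qed
      ultimately show ?case by blast
    qed
    from this[OF True] obtain p where p: "\<And>z. poly p z = 0 \<Longrightarrow> (\<exists>l. i \<le> l \<and> l < a \<and> z = - of_rat (of_int l / of_nat D))"
      "sact f p u \<in> V \<gamma>' x" unfolding a by blast
    have "\<exists>r. \<gamma> \<le> r \<and> r < \<gamma>' \<and> z = - of_rat r" if z: "poly p z = 0" for z
    proof -
      obtain l where l: "i \<le> l" "l < a" "z = - of_rat (of_int l / of_nat D)" using p(1)[OF z] by blast
      have "(of_int i / of_nat D :: rat) \<le> of_int l / of_nat D" "(of_int l / of_nat D :: rat) < \<gamma>'"
        using l D(1) unfolding a by (auto intro!: divide_right_mono divide_strict_right_mono)
      with \<gamma>i l(3) show ?thesis by (intro exI[of _ "of_int l / of_nat D"]) auto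
    qed
    with p(2) show ?thesis by blast
  qed
qed

text \<open>On Gr^(\<gamma>+1) the eigenvalue -(\<gamma> + 1) of s differs from -1, so s + 1 = -t
  \<partial>_t is invertible there and t is onto.\<close>

lemma V_t_surj:
  assumes "\<gamma> \<noteq> 0" "u \<in> V (\<gamma> + 1) x"
  shows "\<exists>v\<in>V \<gamma> x. u - t v \<in> V_gt V (\<gamma> + 1) x"
proof -
  obtain p where p: "\<And>z. poly p z = 0 \<Longrightarrow> z = - of_rat (\<gamma> + 1)" "sact f p u \<in> V_gt V (\<gamma> + 1) x"
    using V_eigen[OF assms(2)] by blast
  have "poly p (-1) \<noteq> 0"
  proof
    assume "poly p (-1) = 0"
    then have "of_rat \<gamma> = (0 :: complex)" using p(1)[of "-1"] by (simp add: of_rat_add)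
    with assms(1) show False by simp
  qed
  then obtain q where q: "u = sact f (smult (1 / poly p (-1)) p) u + sact f [:1, 1:] (sact f q u)"
    using sact_split_root[of p "-1" f] by auto
  have *: "sact f [:1, 1:] w = - t (pshift w)" for w
    unfolding Mf_t_dt sact_linear by (intro ext) (auto simp: op_apply)
  let ?v = "0 - pshift (sact f q u)"
  have "sact f q u \<in> V (\<gamma> + 1) x" using assms(2) by (rule V_sact)
  from V_diff[OF V_0 V_dt[OF this]] have "?v \<in> V \<gamma> x" by simp
  moreover have "t ?v = sact f [:1, 1:] (sact f q u)"
    unfolding * by (intro ext) (simp add: op_apply)
  then have "u - t ?v = sact f (smult (1 / poly p (-1)) p) u" using q by (metis add_diff_cancel_right')
  then have "u - t ?v \<in> V_gt V (\<gamma> + 1) x"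
    using V_gt_pmul[OF const_O_stalk p(2)] by (simp add: sact_smult)
  ultimately show ?thesis by blast
qed

text \<open>Lifts surjectivity from the graded pieces: the error lies one grid step higher, where
  the index is still positive, and after finitely many steps the index has passed the bound beyond
  which t V^\<gamma> = V^(\<gamma>+1) by condition (a).\<close>

lemma V_t_onto_pos:
  assumes "\<gamma> > 0" "u \<in> V (\<gamma> + 1) x"
  shows "\<exists>v\<in>V \<gamma> x. geq u (t v)"
proof -
  obtain D a where D: "D > 0" "\<And>\<gamma>. V \<gamma> x = V (of_int \<lceil>of_nat D * \<gamma>\<rceil> / of_nat D) x" and a: "\<gamma> = of_int a / of_nat D"
    using V_grid[of \<gamma>] by blast
  obtain \<gamma>\<^sub>0 where "\<forall>\<^sub>F y in nhds x. \<forall>\<gamma>\<ge>\<gamma>\<^sub>0. V (\<gamma> + 1) y = {v. \<exists>u\<in>V \<gamma> y. germ_eq y v (t u)}"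
    using V_t_onto by blast
  from eventually_nhds_x_imp_x[OF this]
  have on: "\<And>\<gamma> v. \<gamma> \<ge> \<gamma>\<^sub>0 \<Longrightarrow> v \<in> V (\<gamma> + 1) x \<Longrightarrow> \<exists>u\<in>V \<gamma> x. geq v (t u)" by blast
  define b where "b = \<lceil>of_nat D * \<gamma>\<^sub>0\<rceil>"
  have "a > 0" using assms(1) D(1) unfolding a by (simp add: zero_less_divide_iff)
  have "\<exists>v\<in>V (of_int i / of_nat D) x. geq u (t v)" if "i > 0" "u \<in> V (of_int i / of_nat D + 1) x" for i u
    using that
  proof (induction "nat (b - i)" arbitrary: i u)
    case 0
    then have "b \<le> i" by simp
    then have "of_nat D * \<gamma>\<^sub>0 \<le> of_int i" by (simp add: b_def ceiling_le_iff)
    then have "\<gamma>\<^sub>0 \<le> of_int i / of_nat D" using D(1) by (simp add: le_divide_eq mult.commute)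
    then show ?case using on 0 by blast
  next
    case (Suc n)
    have "of_int i / of_nat D \<noteq> (0 :: rat)" using Suc.prems D(1) by simp
    from V_t_surj[OF this Suc.prems(2)] obtain v
      where v: "v \<in> V (of_int i / of_nat D) x" "u - t v \<in> V_gt V (of_int i / of_nat D + 1) x" by blast
    have "of_int i / of_nat D + 1 = (of_int (i + int D) / of_nat D :: rat)" using D(1) by (simp add: add_divide_distrib)
    then have "u - t v \<in> V (of_int (i + int D + 1) / of_nat D) x" using grid_step[OF D] v(2) by metis
    moreover have "of_int (i + int D + 1) / of_nat D = (of_int (i + 1) / of_nat D + 1 :: rat)"
      using D(1) by (simp add: add_divide_distrib)
    ultimately have "u - t v \<in> V (of_int (i + 1) / of_nat D + 1) x" by simp
    moreover have "n = nat (b - (i + 1))" "i + 1 > 0" using Suc by auto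
    ultimately obtain v' where v': "v' \<in> V (of_int (i + 1) / of_nat D) x" "geq (u - t v) (t v')"
      using Suc.hyps(1) by blast
    have "v' \<in> V (of_int i / of_nat D) x"
      using v'(1) by (rule V_mono) (simp add: divide_right_mono)
    then have "v + v' \<in> V (of_int i / of_nat D) x" using v(1) by (intro V_add)
    moreover have "geq u (t (v + v'))"
      using germ_eq_add[OF germ_eq_refl[of x "t v"] v'(2)] by (simp add: Mf_t_add)
    ultimately show ?case by blast
  qed
  then show ?thesis using \<open>a > 0\<close> assms(2) unfolding a by blast
qed

lemma V_t_pow_onto:
  assumes "\<beta> > 0" "u \<in> V (\<beta> + of_nat n) x"
  shows "\<exists>v\<in>V \<beta> x. geq u ((t ^^ n) v)"
  using assms(2)
proof (induction n arbitrary: u)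
  case 0
  then show ?case using germ_eq_refl by auto
next
  case (Suc n)
  have "\<beta> + of_nat n > 0" using assms(1) by (simp add: add_pos_nonneg)
  then obtain w where w: "w \<in> V (\<beta> + of_nat n) x" "geq u (t w)"
    using V_t_onto_pos[of "\<beta> + of_nat n" u] Suc.prems by (auto simp: add_ac)
  obtain v where "v \<in> V \<beta> x" "geq w ((t ^^ n) v)" using Suc.IH[OF w(1)] by blast
  with w(2) show ?case using germ_eq_trans germ_eq_t by fastforce
qed

lemma M_zero_off:
  assumes "w \<in> M" "\<forall>\<^sub>F y in nhds x. f y \<noteq> 0 \<longrightarrow> (\<forall>k. w k y = 0)"
  shows "geq w 0"
proof -
  obtain K where K: "\<forall>\<^sub>F y in nhds x. \<forall>k>K. w k y = 0" using assms(1) by (auto simp: Mf_def)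
  have "\<forall>\<^sub>F y in nhds x. w k y = 0" for k
    using assms(2) by (intro O_stalk_zero_off M_O[OF assms(1)]) (auto elim: eventually_mono)
  then have "\<forall>\<^sub>F y in nhds x. \<forall>k\<in>{..K}. w k y = 0" by (simp add: eventually_ball_finite)
  with K show ?thesis unfolding germ_eq_def
    by eventually_elim (metis atMost_iff not_less zero_fun_apply)
qed

text \<open>The equation t w = 0 reads f w_k = (k + 1) w_(k+1). Off Z the coefficients therefore
  vanish from the top degree downwards, and by density they vanish everywhere near x.\<close>

lemma t_inj:
  assumes "u \<in> M" "v \<in> M" "geq (t u) (t v)"
  shows "geq u v"
proof -
  define w where "w = u - v"
  have w: "w \<in> M" unfolding w_def using assms by (intro M_diff)
  have tw: "geq (t w) 0" unfolding w_def Mf_t_diff using germ_eq_diff[OF assms(3) germ_eq_refl[of x "t v"]] by simp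
  obtain K where K: "\<forall>\<^sub>F y in nhds x. \<forall>k>K. w k y = 0" using w by (auto simp: Mf_def)
  have "\<forall>\<^sub>F y in nhds x. f y \<noteq> 0 \<longrightarrow> (\<forall>k. w k y = 0)"
    using K tw unfolding germ_eq_def
  proof eventually_elim
    case (elim y)
    show ?case
    proof (intro impI allI)
      fix k assume "f y \<noteq> 0"
      have "w k y = 0" if "k \<le> Suc K"
        using that
      proof (induction k rule: inc_induct)
        case base
        then show ?case using elim by blast
      next
        case (step k)
        from elim(2) have "t w k y = 0" by (simp add: fun_apply)
        with step \<open>f y \<noteq> 0\<close> show ?case by (simp add: op_apply)
      qed
      with elim(1) show "w k y = 0" by (cases "k \<le> Suc K") auto
    qed
  qed
  then have "geq w 0" by (rule M_zero_off[OF w])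
  from germ_eq_add[OF this germ_eq_refl[of x v]] show ?thesis by (simp add: w_def)
qed

text \<open>Surjectivity in positive index gives a preimage in the right step of the filtration, and
  injectivity identifies it with u.\<close>

lemma V_gt_t_cancel:
  assumes "u \<in> M" "t u \<in> V_gt V 1 x"
  shows "u \<in> V_gt V 0 x"
proof -
  obtain \<gamma> where \<gamma>: "\<gamma> > 1" "t u \<in> V \<gamma> x" using assms(2) unfolding V_gt_iff by blast
  then obtain v where v: "v \<in> V (\<gamma> - 1) x" "geq (t u) (t v)" using V_t_onto_pos[of "\<gamma> - 1" "t u"] by auto
  then have "geq v u" using t_inj[OF assms(1) V_M] germ_eq_sym by blast
  with v(1) have "u \<in> V (\<gamma> - 1) x" using V_germ by blast
  then show ?thesis unfolding V_gt_iff using \<gamma>(1) by (intro exI[of _ "\<gamma> - 1"]) auto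
qed

text \<open>Both \<partial>_i (h \<delta>) and s u = -\<partial>_t (t u) lead back to O \<delta> +
  \<partial>_t L. The purpose is division by \<partial>_t: if \<partial>_t v lies in L, then
  comparing the terms of positive degree shows that v does.\<close>

lemma L1_mod_dt:
  assumes "l \<in> L1"
  shows "\<exists>h\<in>O_stalk A x. \<exists>q\<in>L1. geq l (pconst h + pshift q)"
proof -
  define E where "E = {u \<in> L1. \<exists>h\<in>O_stalk A x. \<exists>q\<in>L1. geq u (pconst h + pshift q)}"
  have EI: "u \<in> E" if "u \<in> L1" "h \<in> O_stalk A x" "q \<in> L1" "geq u (pconst h + pshift q)" for u h q
    using that unfolding E_def by blast
  have E: "P u \<in> E" if "P \<in> Lops A f x" "u \<in> E" for P u
    using that unfolding Lops_def
  proof (induction arbitrary: u)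
    case (gen P)
    obtain h q where hq: "u \<in> L1" "h \<in> O_stalk A x" "q \<in> L1" "geq u (pconst h + pshift q)"
      using gen.prems by (auto simp: E_def)
    consider g where "g \<in> O_stalk A x" "P = pmul g" | c i where "c \<in> A" "x \<in> fst c" "P = Mf_dx f c i" | "P = Mf_s f"
      using gen.hyps by (auto simp: D_gens_def)
    then show ?case
    proof cases
      case 1
      have "geq (P u) (pconst (\<lambda>y. g y * h y) + pshift (pmul g q))"
        using germ_eq_pmul[OF hq(4), of g] by (simp add: 1 pmul_add pmul_pconst pshift_pmul)
      with 1 hq show ?thesis by (intro EI[of _ "\<lambda>y. g y * h y" "pmul g q"]) (auto intro: L_pmul O_mult)
    next
      case 2
      \<comment> \<open>From \<partial>_i (h \<delta>) = (\<partial>_i h) \<delta> - (\<partial>_i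
        f) h \<partial>_t \<delta>.\<close>
      let ?q = "Mf_dx f c i q - pmul (pd c i f) (pconst h)"
      have "geq (P u) (P (pconst h + pshift q))"
        unfolding 2 by (rule germ_eq_dx[OF 2(1,2) hq(4)])
      moreover have "geq (P (pconst h + pshift q)) (pconst (pd c i h) + pshift ?q)"
      proof -
        obtain K where "\<forall>\<^sub>F y in nhds x. (\<forall>k. hol_at A (q k) y) \<and> (\<forall>k>K. q k y = 0) \<and> (\<forall>\<^sub>F z in nhds y. \<forall>k>K. q k z = 0)"
          using Mf_hol[OF L_M[OF hq(3)]] by blast
        then show ?thesis unfolding germ_eq_def using eventually_chart[OF 2(1,2)]
        proof eventually_elim
          case (elim y)
          show ?case
          proof
            fix k
            have c0: "pd c i (\<lambda>_. 0) y = 0" by (simp add: pd_chart_line)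
            have "(pconst h + pshift q) k = (if k = 0 then h else q (k - 1))"
              by (intro ext) (simp add: op_apply pconst_apply)
            then show "P (pconst h + pshift q) k y = (pconst (pd c i h) + pshift ?q) k y"
              unfolding 2 by (cases k) (auto simp: Mf_dx_def op_apply pconst_apply algebra_simps)
          qed
        qed
      qed
      ultimately have "geq (P u) (pconst (pd c i h) + pshift ?q)" by (rule germ_eq_trans)
      moreover have "pconst h \<in> L1"
        using L_pmul[OF hq(2) L_gen[OF const_O_stalk[of 1]]] by (simp add: pmul_pconst)
      then have "?q \<in> L1"
        using 2 hq by (intro L_diff L_dx L_pmul O_pd O_f)
      ultimately show ?thesis using 2 hq L_dx by (intro EI[of _ "pd c i h" ?q]) (auto intro: O_pd)
    next
      case 3
      have "P u = pconst (\<lambda>_. 0) + pshift (0 - t u)"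
        unfolding 3 by (intro ext) (auto simp: op_apply pconst_apply Mf_s_def)
      then have "geq (P u) (pconst (\<lambda>_. 0) + pshift (0 - t u))" using germ_eq_refl by metis
      moreover have "0 - t u \<in> L1"
        by (intro L_diff L_0 L_t_same const_O_stalk hq)
      moreover have "P u \<in> L1" unfolding 3 by (rule L_s[OF hq(1)])
      ultimately show ?thesis using EI[OF _ const_O_stalk] by blast
    qed
  next
    case (diff P Q)
    have "P u \<in> E" "Q u \<in> E" using diff by blast+
    then obtain h q h' q' where *: "P u \<in> L1" "h \<in> O_stalk A x" "q \<in> L1" "geq (P u) (pconst h + pshift q)"
      "Q u \<in> L1" "h' \<in> O_stalk A x" "q' \<in> L1" "geq (Q u) (pconst h' + pshift q')" unfolding E_def by blast
    have "(pconst h + pshift q) - (pconst h' + pshift q') = pconst (\<lambda>y. h y - h' y) + pshift (q - q')"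
      by (intro ext) (auto simp: op_apply pconst_apply)
    then have "geq (P u - Q u) (pconst (\<lambda>y. h y - h' y) + pshift (q - q'))"
      using germ_eq_diff[OF *(4,8)] by simp
    then show ?case by (intro EI[OF L_diff[OF *(1,5)] O_diff[OF *(2,6)] L_diff[OF *(3,7)]])
  qed auto
  have "pconst (\<lambda>_. 1) + pshift 0 = (pconst (\<lambda>_. 1) :: nat \<Rightarrow> 'a \<Rightarrow> complex)"
    by (intro ext) (auto simp: op_apply)
  then have "geq (pconst (\<lambda>_. 1)) (pconst (\<lambda>_. 1) + pshift 0)"
    by (simp only: germ_eq_refl)
  then have "pconst (\<lambda>_. 1) \<in> E"
    by (intro EI[OF L_gen const_O_stalk L_0] const_O_stalk)
  moreover obtain P where P: "P \<in> Lops A f x" "geq l (P (pconst (\<lambda>_. 1)))" using assms by (auto simp: L_def)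
  ultimately have "P (pconst (\<lambda>_. 1)) \<in> E" using E by blast
  then show ?thesis unfolding E_def using germ_eq_trans[OF P(2)] by blast
qed

text \<open>
  For \<open>z\<close> in the kernel of \<open>N\<close> the section \<open>\<partial>\<^sub>t z\<close> lies in \<open>V\<^sup>>\<^sup>0\<close>, where the eigenvalues of \<open>s\<close> are nonzero, so that \<open>\<partial>\<^sub>t z\<close> can be moved
  into \<open>\<D>\<^sub>X[s] \<delta>\<close> by adding an element of \<open>s V\<^sup>>\<^sup>0 = \<partial>\<^sub>t t V\<^sup>>\<^sup>0\<close>.
\<close>

lemma Ker_N1_L1:
  assumes z: "z \<in> V 1 x" "sact f [:1, 1:] z \<in> V_gt V 1 x"
  shows "\<exists>v\<in>V_gt V 1 x. z - v \<in> L1"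
proof -
  have "t (pshift z) = 0 - sact f [:1, 1:] z"
    unfolding Mf_t_dt sact_linear by (intro ext) (auto simp: op_apply)
  then have "t (pshift z) \<in> V_gt V 1 x" using V_gt_diff[OF V_gt_0 z(2)] by simp
  then have "pshift z \<in> V_gt V 0 x" using V_gt_t_cancel M_dt[OF V_M[OF z(1)]] by blast
  then obtain \<gamma> where \<gamma>: "\<gamma> > 0" "pshift z \<in> V \<gamma> x" unfolding V_gt_iff by blast
  obtain \<gamma>\<^sub>1 where \<gamma>1: "\<And>\<gamma>. \<gamma> \<ge> \<gamma>\<^sub>1 \<Longrightarrow> V \<gamma> x \<subseteq> Lf" using V_big by blast
  obtain p where p: "\<And>z. poly p z = 0 \<Longrightarrow> (\<exists>r. \<gamma> \<le> r \<and> r < \<gamma>\<^sub>1 \<and> z = - of_rat r)" "sact f p (pshift z) \<in> V \<gamma>\<^sub>1 x"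
    using V_descend[OF \<gamma>(2)] by blast
  have "poly p 0 \<noteq> 0"
  proof
    assume "poly p 0 = 0"
    then obtain r where "\<gamma> \<le> r" "0 = - (of_rat r :: complex)" using p(1) by blast
    with \<gamma>(1) show False by simp
  qed
  then obtain q where q: "pshift z = sact f (smult (1 / poly p 0) p) (pshift z) + sact f [:0, 1:] (sact f q (pshift z))"
    using sact_split_root[of p 0 f] by auto
  define y where "y = sact f q (pshift z)"
  define l where "l = sact f (smult (1 / poly p 0) p) (pshift z)"
  have y: "y \<in> V \<gamma> x" unfolding y_def by (rule V_sact[OF \<gamma>(2)])
  have l: "l \<in> L1"
    unfolding l_def sact_smult using p(2) \<gamma>1[of \<gamma>\<^sub>1] by (intro L_pmul const_O_stalk Lf_L1) auto
  have "pshift (z + t y) = l"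
  proof -
    have "pshift z = l + Mf_s f y" using q unfolding l_def[symmetric] y_def[symmetric]
      by (simp add: sact_linear pmul_zero)
    then show ?thesis by (simp add: pshift_add Mf_dt_t)
  qed
  \<comment> \<open>Division by \<partial>_t: the term h \<delta> sits in degree 0 and drops out
    when the positive degrees of \<partial>_t (z + t y) and l are compared.\<close>
  obtain h r where hr: "h \<in> O_stalk A x" "r \<in> L1" "geq l (pconst h + pshift r)" using L1_mod_dt[OF l] by blast
  have "geq (z + t y) r"
    using hr(3) unfolding germ_eq_def
  proof eventually_elim
    case (elim y')
    show ?case
    proof
      fix k
      have "pshift (z + t y) (Suc k) y' = (pconst h + pshift r) (Suc k) y'"
        using elim \<open>pshift (z + t y) = l\<close> by simp
      then show "(z + t y) k y' = r k y'" by (simp add: pshift_apply pconst_apply plus_fun_apply)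
    qed
  qed
  then have "z + t y \<in> L1" using L_germ[OF hr(2)] germ_eq_sym by blast
  moreover have "0 - t y \<in> V_gt V 1 x"
  proof (rule V_gt_diff[OF V_gt_0])
    show "t y \<in> V_gt V 1 x" unfolding V_gt_iff using V_t[OF y] \<gamma>(1) by (intro exI[of _ "\<gamma> + 1"]) auto
  qed
  ultimately show ?thesis by (intro bexI[of _ "0 - t y"]) simp_all
qed

section \<open>Powers of N on elements instead of cosets\<close>

lemma N_op_sact: "N_op f \<beta> = sact f [:of_rat \<beta>, 1:]"
  by (intro ext) (simp add: N_op_def sact_linear)

lemma Ker_N1_iff: "u \<in> Ker_N1 f V x \<longleftrightarrow> u \<in> V 1 x \<and> sact f [:1, 1:] u \<in> V_gt V 1 x"
proof -
  have "induced (V_gt V 1 x) (N_op f 1) (coset (V_gt V 1 x) u) = coset (V_gt V 1 x) (sact f [:1, 1:] u)"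
    unfolding N_op_sact of_rat_1 by (intro induced_coset V_gt_0 V_gt_diff V_gt_sact sact_diff_right)
  then show ?thesis
    unfolding Ker_N1_def using coset_eq_iff[OF V_gt_0 V_gt_diff] by simp
qed

lemma Mt_den_0: "0 \<in> Mt_den f V \<beta> x"
  and Mt_den_diff: "u \<in> Mt_den f V \<beta> x \<Longrightarrow> v \<in> Mt_den f V \<beta> x \<Longrightarrow> u - v \<in> Mt_den f V \<beta> x"
  and Mt_den_sact: "u \<in> Mt_den f V \<beta> x \<Longrightarrow> sact f p u \<in> Mt_den f V \<beta> x"
  and V_gt_Mt_den: "u \<in> V_gt V \<beta> x \<Longrightarrow> u \<in> Mt_den f V \<beta> x"
proof -
  have c: "sact f p (sact f q u) = sact f q (sact f p u)" for p q u
    by (metis mult.commute sact_mult)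
  have s0: "sact f p 0 = 0" for p using sact_diff_right[of f p 0 0] by simp
  show "0 \<in> Mt_den f V \<beta> x"
    by (simp add: Mt_den_def V_gt_0 Ker_N1_iff V_0 s0)
  show "u \<in> Mt_den f V \<beta> x \<Longrightarrow> v \<in> Mt_den f V \<beta> x \<Longrightarrow> u - v \<in> Mt_den f V \<beta> x"
    by (auto simp: Mt_den_def Ker_N1_iff sact_diff_right V_gt_diff V_diff split: if_splits)
  show "u \<in> Mt_den f V \<beta> x \<Longrightarrow> sact f p u \<in> Mt_den f V \<beta> x"
    by (auto simp: Mt_den_def Ker_N1_iff c[of "[:1, 1:]"] V_gt_sact V_sact split: if_splits)
  show "u \<in> V_gt V \<beta> x \<Longrightarrow> u \<in> Mt_den f V \<beta> x"
    by (auto simp: Mt_den_def Ker_N1_iff V_gt_sact V_gt_V)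
qed

lemma Mt_nilpotent_iff:
  "(\<forall>\<xi>\<in>Mt f V \<beta> x. (induced (Mt_den f V \<beta> x) (N_op f \<beta>) ^^ k) \<xi> = Mt_den f V \<beta> x) \<longleftrightarrow>
   (\<forall>u\<in>V \<beta> x. sact f ([:of_rat \<beta>, 1:] ^ k) u \<in> Mt_den f V \<beta> x)"
proof -
  have "(induced (Mt_den f V \<beta> x) (N_op f \<beta>) ^^ k) (coset (Mt_den f V \<beta> x) u) =
      coset (Mt_den f V \<beta> x) (sact f ([:of_rat \<beta>, 1:] ^ k) u)" for u
    unfolding N_op_sact sact_power
    by (intro induced_pow_coset Mt_den_0 Mt_den_diff Mt_den_sact sact_diff_right)
  then show ?thesis
    unfolding Mt_def quot_def using coset_eq_iff[OF Mt_den_0 Mt_den_diff] by simp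
qed

text \<open>Ensures that some exponent satisfies the condition defining \<open>m_tilde\<close>, so
  that the least one does.\<close>

lemma Gr_nilpotent_imp:
  assumes "\<forall>\<xi>\<in>Gr V \<beta> x. (induced (V_gt V \<beta> x) (N_op f \<beta>) ^^ k) \<xi> = V_gt V \<beta> x" "u \<in> V \<beta> x"
  shows "sact f ([:of_rat \<beta>, 1:] ^ k) u \<in> Mt_den f V \<beta> x"
proof -
  have "(induced (V_gt V \<beta> x) (N_op f \<beta>) ^^ k) (coset (V_gt V \<beta> x) u) =
      coset (V_gt V \<beta> x) (sact f ([:of_rat \<beta>, 1:] ^ k) u)"
    unfolding N_op_sact sact_power
    by (intro induced_pow_coset V_gt_0 V_gt_diff V_gt_sact sact_diff_right)
  then have "sact f ([:of_rat \<beta>, 1:] ^ k) u \<in> V_gt V \<beta> x"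
    using assms coset_eq_iff[OF V_gt_0 V_gt_diff] unfolding Gr_def quot_def by (metis imageI)
  then show ?thesis by (rule V_gt_Mt_den)
qed

text \<open>The factor r is a product of two polynomials. One moves w into V^\<alpha> and has only
  roots above -\<alpha>; the other moves an element of V^(>\<alpha>) into t L and has only roots
  below -\<alpha>. Between them (s + \<alpha>)^m acts on V^\<alpha> = t^j V^\<beta> as t^j
  N^m.\<close>

lemma eigen_part_in_Lf:
  assumes \<beta>: "\<beta> > 0" and j: "\<beta> = 1 \<Longrightarrow> j > 0" and w: "w \<in> M"
    and N: "\<And>u. u \<in> V \<beta> x \<Longrightarrow> sact f ([:of_rat \<beta>, 1:] ^ m) u \<in> Mt_den f V \<beta> x"
  defines "\<alpha> \<equiv> \<beta> + of_nat j"
  shows "\<exists>r. poly r (- of_rat \<alpha>) \<noteq> 0 \<and> sact f (r * [:of_rat \<alpha>, 1:] ^ m) w \<in> Lf"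
proof -
  let ?N = "[:of_rat \<alpha>, 1:] ^ m"
  obtain \<gamma> where "w \<in> V \<gamma> x" using M_V[OF w] by blast
  from V_descend[OF this, of \<alpha>] obtain p
    where p: "\<And>z. poly p z = 0 \<Longrightarrow> (\<exists>r. r < \<alpha> \<and> z = - of_rat r)" "sact f p w \<in> V \<alpha> x" by blast
  obtain v where v: "v \<in> V \<beta> x" "geq (sact f p w) ((t ^^ j) v)"
    using V_t_pow_onto[OF \<beta>] p(2) unfolding \<alpha>_def by blast
  define z where "z = sact f ([:of_rat \<beta>, 1:] ^ m) v"
  have z: "z \<in> V \<beta> x" "z \<in> Mt_den f V \<beta> x" unfolding z_def using v(1) N V_sact by blast+
  have "geq (sact f ?N (sact f p w)) (sact f ?N ((t ^^ j) v))" by (rule germ_eq_sact[OF v(2)])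
  moreover have "sact f ?N ((t ^^ j) v) = (t ^^ j) z"
    unfolding z_def Mf_t_pow_linear_power \<alpha>_def by (simp add: of_rat_add)
  ultimately have eq: "geq (sact f ?N (sact f p w)) ((t ^^ j) z)" by simp
  have "\<exists>v'\<in>V_gt V \<alpha> x. (t ^^ j) z - v' \<in> Lf"
  proof (cases "\<beta> = 1")
    case False
    then have "z \<in> V_gt V \<beta> x" using z(2) by (simp add: Mt_den_def)
    then have "(t ^^ j) z \<in> V_gt V \<alpha> x" unfolding \<alpha>_def by (rule V_gt_t_pow)
    then show ?thesis using L_0[OF O_f] by (intro bexI[of _ "(t ^^ j) z"]) simp_all
  next
    case True
    then have "sact f [:1, 1:] z \<in> V_gt V 1 x" using z(2) by (simp add: Mt_den_def Ker_N1_iff)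
    then obtain v' where v': "v' \<in> V_gt V 1 x" "z - v' \<in> L1" using Ker_N1_L1 z(1) True by blast
    \<comment> \<open>One of the j factors t carries L into t L; for \<alpha> = 1 there would be
      none.\<close>
    obtain i where i: "j = Suc i" using j[OF True] by (cases j) auto
    have "(t ^^ j) (z - v') \<in> Lf" unfolding i using L1_t[OF L1_t_pow[OF v'(2)]] by simp
    moreover have "(t ^^ j) v' \<in> V_gt V \<alpha> x" using V_gt_t_pow[OF v'(1)] True by (simp add: \<alpha>_def)
    ultimately show ?thesis by (intro bexI[of _ "(t ^^ j) v'"]) (simp_all only: Mf_t_pow_diff)
  qed
  then obtain v' where v': "v' \<in> V_gt V \<alpha> x" "(t ^^ j) z - v' \<in> Lf" by blast
  obtain \<gamma>' where \<gamma>': "\<gamma>' > \<alpha>" "v' \<in> V \<gamma>' x" using v'(1) unfolding V_gt_iff by blast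
  obtain \<gamma>\<^sub>1 where \<gamma>1: "\<And>\<gamma>. \<gamma> \<ge> \<gamma>\<^sub>1 \<Longrightarrow> V \<gamma> x \<subseteq> Lf" using V_big by blast
  from V_descend[OF \<gamma>'(2), of \<gamma>\<^sub>1] obtain q
    where q: "\<And>z. poly q z = 0 \<Longrightarrow> (\<exists>r. r > \<alpha> \<and> z = - of_rat r)" "sact f q v' \<in> V \<gamma>\<^sub>1 x"
    using \<gamma>'(1) by (metis less_le_trans)
  have "sact f q v' \<in> Lf" using q(2) \<gamma>1 by blast
  moreover have "sact f q ((t ^^ j) z - v') \<in> Lf" using L_sact[OF O_f v'(2)] .
  ultimately have "sact f q ((t ^^ j) z) \<in> Lf"
    using L_add[OF O_f] by (metis diff_add_cancel sact_diff_right)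
  then have "sact f q (sact f ?N (sact f p w)) \<in> Lf"
    using L_germ germ_eq_sact[OF germ_eq_sym[OF eq]] by blast
  moreover have "sact f (q * p * ?N) w = sact f q (sact f ?N (sact f p w))"
    by (metis mult.assoc mult.commute sact_mult)
  moreover have "poly (q * p) (- of_rat \<alpha>) \<noteq> 0"
  proof
    assume "poly (q * p) (- of_rat \<alpha>) = 0"
    then consider "poly q (- of_rat \<alpha>) = 0" | "poly p (- of_rat \<alpha>) = 0" by auto
    then show False using p(1) q(1) by (cases; fastforce)
  qed
  ultimately show ?thesis by (intro exI[of _ "q * p"]) simp
qed

end

subsection \<open>From \<open>M\<^sub>f\<close> to \<open>\<O>\<^sub>X(*Z)[s] f\<^sup>s\<close>\<close>

text \<open>
  \<open>\<partial>\<^sub>t\<^sup>i \<delta>\<close> corresponds to \<open>(-1)\<^sup>i s (s - 1) \<dots> (s - i + 1) f\<^sup>s\<^sup>-\<^sup>i\<close>, whence the polynomials \<open>s_poly i\<close>.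
  \<open>Psi f u y\<close> is the polynomial in \<open>s\<close> obtained from the values at \<open>y\<close>; it is meaningful only if
  \<open>f y \<noteq> 0\<close> and \<open>u k y = 0\<close> for large \<open>k\<close>.
\<close>

definition s_poly :: "nat \<Rightarrow> complex poly" where
  "s_poly i = (\<Prod>l<i. [:of_nat l, -1:])"

lemma smult_sum_right: "smult a (\<Sum>i\<in>S. g i) = (\<Sum>i\<in>S. smult a (g i))"
  by (induction S rule: infinite_finite_induct) (simp_all add: smult_add_right)

definition Psi :: "('a \<Rightarrow> complex) \<Rightarrow> (nat \<Rightarrow> 'a \<Rightarrow> complex) \<Rightarrow> 'a \<Rightarrow> complex poly" where
  "Psi f u y = (\<Sum>i | u i y \<noteq> 0. smult (u i y / f y ^ i) (s_poly i))"

lemma s_poly_Suc: "s_poly (Suc i) = smult (of_nat i) (s_poly i) - [:0, 1:] * s_poly i"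
  by (simp add: s_poly_def)

lemma poly_s_poly: "poly (s_poly i) z = (\<Prod>l<i. of_nat l - z)"
  by (simp add: s_poly_def poly_prod)

lemma Psi_eq:
  assumes "\<forall>k>K. u k y = 0"
  shows "Psi f u y = (\<Sum>i\<le>K. smult (u i y / f y ^ i) (s_poly i))"
proof -
  have "{i. u i y \<noteq> 0} \<subseteq> {..K}" using assms by (auto simp: not_less[symmetric])
  then show ?thesis unfolding Psi_def by (intro sum.mono_neutral_left) auto
qed

lemma Psi_eq_le:
  assumes "\<forall>k>K. u k y = 0" "K \<le> n"
  shows "Psi f u y = (\<Sum>i\<le>n. smult (u i y / f y ^ i) (s_poly i))"
  using assms by (intro Psi_eq) auto

lemma Psi_pmul:
  assumes "\<forall>k>K. u k y = 0"
  shows "Psi f (pmul g u) y = smult (g y) (Psi f u y)"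
proof -
  have "\<forall>k>K. pmul g u k y = 0" using assms by (simp add: op_apply)
  from Psi_eq[where u = "pmul g u", OF this] show ?thesis
    unfolding Psi_eq[where u = u, OF assms] by (simp add: op_apply smult_sum_right)
qed

lemma Psi_diff:
  assumes "\<forall>k>K. u k y = 0" "\<forall>k>K'. v k y = 0"
  shows "Psi f (u - v) y = Psi f u y - Psi f v y"
proof -
  let ?n = "max K K'"
  have "\<forall>k>?n. (u - v) k y = 0" using assms by (simp add: op_apply)
  from Psi_eq[where u = "u - v", OF this] show ?thesis
    unfolding Psi_eq_le[where u = u, OF assms(1), of ?n, simplified] Psi_eq_le[where u = v, OF assms(2), of ?n, simplified]
    by (simp add: op_apply diff_divide_distrib smult_diff_left sum_subtractf)
qed

lemma Psi_add:
  assumes "\<forall>k>K. u k y = 0" "\<forall>k>K'. v k y = 0"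
  shows "Psi f (u + v) y = Psi f u y + Psi f v y"
proof -
  let ?n = "max K K'"
  have "\<forall>k>?n. (u + v) k y = 0" using assms by (simp add: op_apply)
  from Psi_eq[where u = "u + v", OF this] show ?thesis
    unfolding Psi_eq_le[where u = u, OF assms(1), of ?n, simplified] Psi_eq_le[where u = v, OF assms(2), of ?n, simplified]
    by (simp add: op_apply add_divide_distrib smult_add_left sum.distrib)
qed

text \<open>Rests on s p_i = i p_i - p_(i+1) for p_i = \<open>s_poly i\<close>, the counterpart of s
  \<partial>_t^i \<delta> = i \<partial>_t^i \<delta> - f \<partial>_t^(i+1) \<delta>.\<close>

lemma Psi_s:
  assumes "\<forall>k>K. u k y = 0" "f y \<noteq> 0"
  shows "Psi f (Mf_s f u) y = [:0, 1:] * Psi f u y"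
proof -
  have "\<forall>k>Suc K. Mf_s f u k y = 0" using assms by (simp add: op_apply)
  from Psi_eq[where u = "Mf_s f u", OF this]
  have "Psi f (Mf_s f u) y = (\<Sum>i\<le>Suc K. smult (Mf_s f u i y / f y ^ i) (s_poly i))" .
  also have "\<dots> = (\<Sum>i\<le>Suc K. smult (of_nat i * u i y / f y ^ i) (s_poly i)) -
      (\<Sum>i\<le>Suc K. smult (f y * (if i = 0 then 0 else u (i - 1) y) / f y ^ i) (s_poly i))"
    by (simp only: Mf_s_apply diff_divide_distrib smult_diff_left sum_subtractf)
  also have "(\<Sum>i\<le>Suc K. smult (f y * (if i = 0 then 0 else u (i - 1) y) / f y ^ i) (s_poly i)) =
      (\<Sum>i\<le>K. smult (u i y / f y ^ i) (s_poly (Suc i)))"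
    by (subst sum.atMost_Suc_shift) (use assms(2) in simp)
  also have "(\<Sum>i\<le>Suc K. smult (of_nat i * u i y / f y ^ i) (s_poly i)) =
      (\<Sum>i\<le>K. smult (of_nat i * u i y / f y ^ i) (s_poly i))"
    using assms(1) by simp
  also have "\<dots> - (\<Sum>i\<le>K. smult (u i y / f y ^ i) (s_poly (Suc i))) =
      (\<Sum>i\<le>K. [:0, 1:] * smult (u i y / f y ^ i) (s_poly i))"
    unfolding sum_subtractf[symmetric] by (intro sum.cong refl) (simp add: s_poly_Suc smult_diff_right mult.commute)
  also have "\<dots> = [:0, 1:] * Psi f u y"
    unfolding Psi_eq[where u = u, OF assms(1)] by (rule sum_distrib_left[symmetric])
  finally show ?thesis .
qed

lemma Psi_sact:
  assumes "\<forall>k>K. u k y = 0" "f y \<noteq> 0"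
  shows "\<exists>K. \<forall>k>K. sact f p u k y = 0" and "Psi f (sact f p u) y = p * Psi f u y"
proof -
  have "(\<exists>K. \<forall>k>K. sact f p u k y = 0) \<and> Psi f (sact f p u) y = p * Psi f u y"
  proof (induction p)
    case 0
    show ?case by (simp add: Psi_def zero_fun_apply)
  next
    case (pCons a p)
    then obtain K' where K': "\<forall>k>K'. sact f p u k y = 0" by blast
    have 1: "\<forall>k>Suc K'. Mf_s f (sact f p u) k y = 0" using K' by (simp add: op_apply)
    have 2: "\<forall>k>K. pmul (\<lambda>_. a) u k y = 0" using assms by (simp add: op_apply)
    have "\<forall>k>max K (Suc K'). sact f (pCons a p) u k y = 0"
      using 1 2 by (simp add: sact_pCons plus_fun_apply)
    moreover have "Psi f (sact f (pCons a p) u) y = pCons a p * Psi f u y"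
      unfolding sact_pCons Psi_add[where u = "pmul (\<lambda>_. a) u" and v = "Mf_s f (sact f p u)", OF 2 1]
        Psi_s[where u = "sact f p u" and y = y and f = f, OF K' assms(2)] Psi_pmul[where u = u, OF assms(1)]
      using pCons.IH by simp
    ultimately show ?case by blast
  qed
  then show "\<exists>K. \<forall>k>K. sact f p u k y = 0" and "Psi f (sact f p u) y = p * Psi f u y" by blast+
qed

text \<open>Triangularity: at s = k the polynomials \<open>s_poly i\<close> with i > k vanish and
  \<open>s_poly k\<close> does not, so the coefficients are determined in increasing degree.\<close>

lemma Psi_inj:
  assumes "\<forall>k>K. u k y = 0" "f y \<noteq> 0" "Psi f u y = 0"
  shows "u k y = 0"
proof (induction k rule: less_induct)
  case (less k)
  show ?case
  proof (cases "k \<le> K")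
    case True
    have "0 = poly (Psi f u y) (of_nat k)" using assms(3) by simp
    also have "\<dots> = (\<Sum>i\<le>K. u i y / f y ^ i * (\<Prod>l<i. of_nat l - of_nat k))"
      unfolding Psi_eq[where u = u, OF assms(1)] by (simp add: poly_sum poly_s_poly)
    also have "\<dots> = (\<Sum>i\<in>{k}. u i y / f y ^ i * (\<Prod>l<i. of_nat l - of_nat k))"
    proof (intro sum.mono_neutral_right ballI)
      fix i assume i: "i \<in> {..K} - {k}"
      show "u i y / f y ^ i * (\<Prod>l<i. of_nat l - of_nat k) = 0"
      proof (cases "i < k")
        case True
        then show ?thesis using less by simp
      next
        case False
        then have "k \<in> {..<i}" using i by simp
        then have "(\<Prod>l<i. of_nat l - of_nat k :: complex) = 0" by (intro prod_zero) auto
        then show ?thesis by simp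
      qed
    qed (use True in auto)
    finally have "u k y / f y ^ k * (\<Prod>l<k. of_nat l - of_nat k) = 0" by simp
    moreover have "(\<Prod>l<k. of_nat l - of_nat k :: complex) \<noteq> 0" by (simp add: prod_zero_iff)
    ultimately show ?thesis using assms(2) by simp
  qed (use assms in simp)
qed

lemma Psi_pconst: "Psi f (pconst h) y = [:h y:]"
proof -
  have "\<forall>k>0. pconst h k y = 0" by (simp add: pconst_apply)
  from Psi_eq[where u = "pconst h", OF this] show ?thesis by (simp add: pconst_apply s_poly_def one_pCons)
qed

context hypersurface
begin

text \<open>The rule \<partial>_i (p f^s) = (\<partial>_i p + s p \<partial>_i f / f) f^s, solved
  for \<partial>_i p. A linear functional l is applied because \<open>pd\<close> differentiates
  complex-valued functions; one proof then serves both the coefficients in s and the evaluation at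
  -\<alpha>.\<close>

lemma Psi_dx:
  assumes c: "c \<in> A" "y \<in> fst c" and fy: "f y \<noteq> 0"
    and hol: "\<forall>k. hol_at A (u k) y" and K: "\<forall>\<^sub>F z in nhds y. \<forall>k>K. u k z = 0"
    and add: "\<And>p q. l (p + q) = l p + l q" and hom: "\<And>a p. l (smult a p) = a * l p"
  shows "pd c i (\<lambda>z. l (Psi f u z)) y =
    l (Psi f (Mf_dx f c i u) y) - pd c i f y / f y * l ([:0, 1:] * Psi f u y)"
proof -
  have l0: "l 0 = 0" using hom[of 0 0] by simp
  have ls: "l (\<Sum>i\<le>n. g i) = (\<Sum>i\<le>n. l (g i))" for g and n :: nat
    by (induction n) (simp_all add: add)
  have lm: "l (p - q) = l p - l q" for p q
    using add[of "p - q" q] by simp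
  have Ky: "\<forall>k>K. u k y = 0" using eventually_nhds_x_imp_x[OF K] .
  have du: "Mf_dx f c i u k y = pd c i (u k) y - pd c i f y * (if k = 0 then 0 else u (k - 1) y)" for k
    by (simp add: Mf_dx_def pshift_apply)
  have pd0: "pd c i (u k) y = 0" if "k > K" for k
  proof -
    have "pd c i (u k) y = pd c i (\<lambda>_. 0) y"
      using K that by (intro pd_cong c) (auto elim: eventually_mono)
    then show ?thesis by (simp add: pd_chart_line)
  qed
  have dK: "\<forall>k>Suc K. Mf_dx f c i u k y = 0" using Ky pd0 by (simp add: du)
  have "pd c i (\<lambda>z. l (Psi f u z)) y = pd c i (\<lambda>z. \<Sum>j\<le>K. u j z / f z ^ j * l (s_poly j)) y"
    using K by (intro pd_cong c) (auto elim!: eventually_mono simp: Psi_eq[of K] ls hom)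
  also have "\<dots> = (\<Sum>j\<le>K. (pd c i (u j) y / f y ^ j - of_nat j * u j y * pd c i f y / f y ^ Suc j) * l (s_poly j))"
  proof (intro pd_eqI DERIV_sum)
    fix j
    note d = pd_deriv[OF c, of f i] pd_deriv[OF c, of "u j" i]
    have *: "((\<lambda>w. u j (chart_line c i y w) * inverse (f (chart_line c i y w)) ^ j * l (s_poly j)) has_field_derivative
       (pd c i (u j) y * inverse (f y) ^ j - of_nat j * u j y * pd c i f y * inverse (f y) ^ Suc j) * l (s_poly j)) (at 0)"
    proof -
      have "((\<lambda>w. inverse (f (chart_line c i y w))) has_field_derivative - (inverse (f y) * pd c i f y * inverse (f y))) (at 0)"
        using DERIV_inverse'[OF d(1)] hol_f fy by (simp add: chart_line_0[OF c])
      note DERIV_cmult_right[OF DERIV_mult[OF d(2) DERIV_power[OF this, of j]], of "l (s_poly j)"]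
      moreover have "pd c i (u j) y * inverse (f (chart_line c i y 0)) ^ j +
          of_nat j * (- (inverse (f y) * pd c i f y * inverse (f y)) * inverse (f (chart_line c i y 0)) ^ (j - Suc 0)) *
          u j (chart_line c i y 0) =
          pd c i (u j) y * inverse (f y) ^ j - of_nat j * u j y * pd c i f y * inverse (f y) ^ Suc j"
        by (cases j) (simp_all add: chart_line_0[OF c])
      ultimately show ?thesis using hol by simp
    qed
    show "((\<lambda>w. u j (chart_line c i y w) / f (chart_line c i y w) ^ j * l (s_poly j)) has_field_derivative
       (pd c i (u j) y / f y ^ j - of_nat j * u j y * pd c i f y / f y ^ Suc j) * l (s_poly j)) (at 0)"
      using * by (simp add: divide_inverse power_inverse)
  qed
  finally have 1: "pd c i (\<lambda>z. l (Psi f u z)) y =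
    (\<Sum>j\<le>K. pd c i (u j) y / f y ^ j * l (s_poly j)) - (\<Sum>j\<le>K. of_nat j * u j y * pd c i f y / f y ^ Suc j * l (s_poly j))"
    by (simp add: sum_subtractf left_diff_distrib)
  have "l (Psi f (Mf_dx f c i u) y) = (\<Sum>j\<le>Suc K. Mf_dx f c i u j y / f y ^ j * l (s_poly j))"
    unfolding Psi_eq[where u = "Mf_dx f c i u", OF dK] by (simp only: ls hom)
  also have "\<dots> = (\<Sum>j\<le>Suc K. pd c i (u j) y / f y ^ j * l (s_poly j)) -
      (\<Sum>j\<le>Suc K. pd c i f y * (if j = 0 then 0 else u (j - 1) y) / f y ^ j * l (s_poly j))"
    by (simp only: du diff_divide_distrib left_diff_distrib sum_subtractf)
  also have "(\<Sum>j\<le>Suc K. pd c i (u j) y / f y ^ j * l (s_poly j)) = (\<Sum>j\<le>K. pd c i (u j) y / f y ^ j * l (s_poly j))"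
    using pd0 by simp
  also have "(\<Sum>j\<le>Suc K. pd c i f y * (if j = 0 then 0 else u (j - 1) y) / f y ^ j * l (s_poly j)) =
     (\<Sum>j\<le>K. pd c i f y * u j y / f y ^ Suc j * l (s_poly (Suc j)))"
    by (subst sum.atMost_Suc_shift) simp
  finally have 2: "l (Psi f (Mf_dx f c i u) y) = (\<Sum>j\<le>K. pd c i (u j) y / f y ^ j * l (s_poly j)) -
     (\<Sum>j\<le>K. pd c i f y * u j y / f y ^ Suc j * l (s_poly (Suc j)))" .
  have "[:0, 1:] * Psi f u y = (\<Sum>j\<le>K. smult (u j y / f y ^ j) ([:0, 1:] * s_poly j))"
    unfolding Psi_eq[where u = u, OF Ky] sum_distrib_left mult_smult_right ..
  then have "l ([:0, 1:] * Psi f u y) = (\<Sum>j\<le>K. u j y / f y ^ j * l ([:0, 1:] * s_poly j))"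
    by (simp only: ls hom)
  then have 3: "pd c i f y / f y * l ([:0, 1:] * Psi f u y) = (\<Sum>j\<le>K. pd c i f y * u j y / f y ^ Suc j * l ([:0, 1:] * s_poly j))"
    by (simp only: sum_distrib_left) (simp add: mult_ac)
  have 4: "(\<Sum>j\<le>K. pd c i f y * u j y / f y ^ Suc j * l (s_poly (Suc j))) =
     (\<Sum>j\<le>K. of_nat j * u j y * pd c i f y / f y ^ Suc j * l (s_poly j)) -
     (\<Sum>j\<le>K. pd c i f y * u j y / f y ^ Suc j * l ([:0, 1:] * s_poly j))"
    unfolding sum_subtractf[symmetric] s_poly_Suc lm hom
    by (intro sum.cong refl) (simp add: algebra_simps diff_divide_distrib)
  show ?thesis unfolding 1 2 3 4 by simp
qed

end

text \<open>The operators are mere maps on representatives, so no homomorphism between the rings is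
  set up; a relation compatible with the ring operations provides each operator with a
  partner.\<close>

lemma ring_gen_correspond:
  assumes "P \<in> ring_gen S"
    and "\<And>P. P \<in> S \<Longrightarrow> \<exists>Q\<in>ring_gen T. C P Q"
    and "C (\<lambda>u. u) (\<lambda>u. u)"
    and "\<And>P P' Q Q'. C P Q \<Longrightarrow> C P' Q' \<Longrightarrow> C (\<lambda>u. P u - P' u) (\<lambda>u. Q u - Q' u)"
    and "\<And>P P' Q Q'. C P Q \<Longrightarrow> C P' Q' \<Longrightarrow> C (\<lambda>u. P (P' u)) (\<lambda>u. Q (Q' u))"
  shows "\<exists>Q\<in>ring_gen T. C P Q"
  using assms(1)
proof induction
  case one
  show ?case using assms(3) ring_gen.one by blast
next
  case (gen P)
  then show ?case by (rule assms(2))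
next
  case (diff P P')
  then obtain Q Q' where "Q \<in> ring_gen T" "C P Q" "Q' \<in> ring_gen T" "C P' Q'" by blast
  then show ?case using assms(4) ring_gen.diff by blast
next
  case (comp P P')
  then obtain Q Q' where "Q \<in> ring_gen T" "C P Q" "Q' \<in> ring_gen T" "C P' Q'" by blast
  then show ?case using assms(5) ring_gen.comp by blast
qed

context V_filtration
begin

text \<open>
  With the coefficients as functionals \<open>l\<close> the target is \<open>\<O>\<^sub>X(*Z)[s] f\<^sup>s\<close>, with the evaluation at \<open>-\<alpha>\<close>
  it is \<open>\<O>\<^sub>X(*Z) f\<^sup>-\<^sup>\<alpha>\<close>.
\<close>

definition rel :: "('k \<Rightarrow> complex poly \<Rightarrow> complex) \<Rightarrow> (nat \<Rightarrow> 'a \<Rightarrow> complex) \<Rightarrow> ('k \<Rightarrow> 'a \<Rightarrow> complex) \<Rightarrow> bool" where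
  "rel l u p \<longleftrightarrow> u \<in> M \<and> (\<forall>\<^sub>F y in nhds x. f y \<noteq> 0 \<longrightarrow> (\<forall>k. p k y = l k (Psi f u y)))"

lemma M_bound:
  assumes "u \<in> M"
  shows "\<forall>\<^sub>F y in nhds x. \<exists>K. \<forall>k>K. u k y = 0"
proof -
  obtain K where "\<forall>\<^sub>F y in nhds x. \<forall>k>K. u k y = 0" using assms by (auto simp: Mf_def)
  then show ?thesis by eventually_elim blast
qed

lemma rel_pmul:
  assumes "\<And>k a p. l k (smult a p) = a * l k p" "rel l u p" "g \<in> O_stalk A x"
  shows "rel l (pmul g u) (\<lambda>k y. g y * p k y)"
proof -
  have u: "u \<in> M" and ev: "\<forall>\<^sub>F y in nhds x. f y \<noteq> 0 \<longrightarrow> (\<forall>k. p k y = l k (Psi f u y))"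
    using assms(2) by (auto simp: rel_def)
  have "\<forall>\<^sub>F y in nhds x. f y \<noteq> 0 \<longrightarrow> (\<forall>k. g y * p k y = l k (Psi f (pmul g u) y))"
    using ev M_bound[OF u]
  proof eventually_elim
    case (elim y)
    then obtain K where "\<forall>k>K. u k y = 0" by blast
    from elim(1) show ?case unfolding Psi_pmul[where u = u, OF \<open>\<forall>k>K. u k y = 0\<close>] by (simp add: assms(1))
  qed
  then show ?thesis unfolding rel_def using M_pmul[OF assms(3) u] by blast
qed

lemma rel_diff:
  assumes "\<And>k p q. l k (p - q) = l k p - l k q" "rel l u p" "rel l v q"
  shows "rel l (u - v) (\<lambda>k y. p k y - q k y)"
proof -
  have u: "u \<in> M" "v \<in> M" and ev: "\<forall>\<^sub>F y in nhds x. f y \<noteq> 0 \<longrightarrow> (\<forall>k. p k y = l k (Psi f u y))"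
    "\<forall>\<^sub>F y in nhds x. f y \<noteq> 0 \<longrightarrow> (\<forall>k. q k y = l k (Psi f v y))"
    using assms(2,3) by (auto simp: rel_def)
  have "\<forall>\<^sub>F y in nhds x. f y \<noteq> 0 \<longrightarrow> (\<forall>k. p k y - q k y = l k (Psi f (u - v) y))"
    using ev M_bound[OF u(1)] M_bound[OF u(2)]
  proof eventually_elim
    case (elim y)
    then obtain K K' where "\<forall>k>K. u k y = 0" "\<forall>k>K'. v k y = 0" by blast
    from elim(1,2) show ?case
      unfolding Psi_diff[where u = u and v = v, OF \<open>\<forall>k>K. u k y = 0\<close> \<open>\<forall>k>K'. v k y = 0\<close>] by (simp add: assms(1))
  qed
  then show ?thesis unfolding rel_def using M_diff[OF u] by blast
qed

lemma rel_fun_diff: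
  assumes "\<And>k p q. l k (p - q) = l k p - l k q" "rel l u p" "rel l v q"
  shows "rel l (u - v) (p - q)"
  using rel_diff[OF assms] by (simp add: fun_diff_def)

lemma rel_sact:
  assumes "rel l u p"
  shows "rel l (sact f r u) (\<lambda>k y. l k (r * Psi f u y))"
proof -
  have u: "u \<in> M" using assms by (simp add: rel_def)
  have "\<forall>\<^sub>F y in nhds x. f y \<noteq> 0 \<longrightarrow> (\<forall>k. l k (r * Psi f u y) = l k (Psi f (sact f r u) y))"
    using M_bound[OF u] by eventually_elim (metis Psi_sact(2))
  then show ?thesis unfolding rel_def using M_sact[OF u] by blast
qed

lemma rel_dx:
  assumes "c \<in> A" "x \<in> fst c" "rel l u p"
    and add: "\<And>k p q. l k (p + q) = l k p + l k q" and hom: "\<And>k a p. l k (smult a p) = a * l k p"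
  shows "rel l (Mf_dx f c i u) (\<lambda>k y. pd c i (p k) y + pd c i f y / f y * l k ([:0, 1:] * Psi f u y))"
proof -
  have u: "u \<in> M" and ev: "\<forall>\<^sub>F y in nhds x. f y \<noteq> 0 \<longrightarrow> (\<forall>k. p k y = l k (Psi f u y))"
    using assms(3) by (auto simp: rel_def)
  obtain K where K: "\<forall>\<^sub>F y in nhds x. (\<forall>k. hol_at A (u k) y) \<and> (\<forall>k>K. u k y = 0) \<and> (\<forall>\<^sub>F z in nhds y. \<forall>k>K. u k z = 0)"
    using Mf_hol[OF u] by blast
  have "\<forall>\<^sub>F y in nhds x. f y \<noteq> 0 \<longrightarrow> (\<forall>k. pd c i (p k) y + pd c i f y / f y * l k ([:0, 1:] * Psi f u y) =
      l k (Psi f (Mf_dx f c i u) y))"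
    using open_eventually[OF ev] K eventually_chart[OF assms(1,2)]
  proof eventually_elim
    case (elim y)
    show ?case
    proof (intro impI allI)
      fix k assume fy: "f y \<noteq> 0"
      have "isCont f y" using hol_f hol_at_isCont by blast
      then have "\<forall>\<^sub>F z in nhds y. f z \<noteq> 0" using fy isCont_nhds tendsto_imp_eventually_ne by blast
      with elim(1) have "\<forall>\<^sub>F z in nhds y. p k z = l k (Psi f u z)" by (auto elim: eventually_elim2)
      then have "pd c i (p k) y = pd c i (\<lambda>z. l k (Psi f u z)) y"
        by (intro pd_cong assms(1) elim)
      also have "\<dots> = l k (Psi f (Mf_dx f c i u) y) - pd c i f y / f y * l k ([:0, 1:] * Psi f u y)"
        using elim by (intro Psi_dx assms(1) fy add hom) auto
      finally show "pd c i (p k) y + pd c i f y / f y * l k ([:0, 1:] * Psi f u y) = l k (Psi f (Mf_dx f c i u) y)"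
        by simp
    qed
  qed
  then show ?thesis unfolding rel_def using M_dx[OF assms(1,2) u] by blast
qed

lemma rel_cong:
  assumes "rel l u p" "\<forall>\<^sub>F y in nhds x. f y \<noteq> 0 \<longrightarrow> (\<forall>k. p k y = q k y)"
  shows "rel l u q"
  using assms unfolding rel_def by (auto elim: eventually_elim2)

lemma rel_dxI:
  assumes "c \<in> A" "x \<in> fst c" "rel l u p"
    and add: "\<And>k p q. l k (p + q) = l k p + l k q" and hom: "\<And>k a p. l k (smult a p) = a * l k p"
    and q: "\<And>y k. (\<And>k. p k y = l k (Psi f u y)) \<Longrightarrow>
      q k y = pd c i (p k) y + pd c i f y / f y * l k ([:0, 1:] * Psi f u y)"
  shows "rel l (Mf_dx f c i u) q"
proof (rule rel_cong[OF rel_dx[OF assms(1-5)]])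
  have "\<forall>\<^sub>F y in nhds x. f y \<noteq> 0 \<longrightarrow> (\<forall>k. p k y = l k (Psi f u y))"
    using assms(3) by (simp add: rel_def)
  then show "\<forall>\<^sub>F y in nhds x. f y \<noteq> 0 \<longrightarrow>
      (\<forall>k. pd c i (p k) y + pd c i f y / f y * l k ([:0, 1:] * Psi f u y) = q k y)"
    by eventually_elim (simp add: q)
qed

section \<open>Comparison with O[1/f][s] f^s\<close>

abbreviation "cf \<equiv> (\<lambda>k p. coeff p k :: complex)"

lemma coeff_s_mult: "coeff ([:0, 1:] * p) k = (if k = 0 then 0 else coeff p (k - 1))" for p :: "complex poly"
  by (cases k) simp_all

lemma correspond_fs:
  assumes "rel cf u p"
  shows "g \<in> O_stalk A x \<Longrightarrow> rel cf (pmul g u) (pmul g p)"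
    and "c \<in> A \<Longrightarrow> x \<in> fst c \<Longrightarrow> rel cf (Mf_dx f c i u) (fs_dx f c i p)"
    and "rel cf (Mf_s f u) (pshift p)"
proof -
  show "g \<in> O_stalk A x \<Longrightarrow> rel cf (pmul g u) (pmul g p)"
    unfolding pmul_def[of g p] by (intro rel_pmul assms) auto
  show "c \<in> A \<Longrightarrow> x \<in> fst c \<Longrightarrow> rel cf (Mf_dx f c i u) (fs_dx f c i p)"
    by (rule rel_dxI[OF _ _ assms]) (auto simp: fs_dx_def pshift_def coeff_s_mult simp del: mult_pCons_left)
  have "rel cf (sact f [:0, 1:] u) (\<lambda>k y. coeff ([:0, 1:] * Psi f u y) k)"
    by (rule rel_sact[OF assms])
  moreover have "sact f [:0, 1:] u = Mf_s f u" by (simp add: sact_linear pmul_zero)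
  ultimately have "rel cf (Mf_s f u) (\<lambda>k y. coeff ([:0, 1:] * Psi f u y) k)" by simp
  moreover have "\<forall>\<^sub>F y in nhds x. f y \<noteq> 0 \<longrightarrow> (\<forall>k. p k y = coeff (Psi f u y) k)"
    using assms by (simp add: rel_def)
  then have "\<forall>\<^sub>F y in nhds x. f y \<noteq> 0 \<longrightarrow> (\<forall>k. coeff ([:0, 1:] * Psi f u y) k = pshift p k y)"
    by eventually_elim (auto simp: coeff_s_mult pshift_apply simp del: mult_pCons_left)
  ultimately show "rel cf (Mf_s f u) (pshift p)" by (rule rel_cong)
qed

lemma Ds_ops_to_Lops:
  assumes "P \<in> Ds_ops A f x"
  shows "\<exists>Q\<in>Lops A f x. \<forall>u p. rel cf u p \<longrightarrow> rel cf (Q u) (P p)"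
  using assms unfolding Ds_ops_def Lops_def
proof (rule ring_gen_correspond)
  fix P assume "P \<in> D_gens A pmul (fs_dx f) x \<union> {pshift}"
  then consider g where "g \<in> O_stalk A x" "P = pmul g" | c i where "c \<in> A" "x \<in> fst c" "P = fs_dx f c i" | "P = pshift"
    by (auto simp: D_gens_def)
  then show "\<exists>Q\<in>ring_gen (D_gens A pmul (Mf_dx f) x \<union> {Mf_s f}). \<forall>u p. rel cf u p \<longrightarrow> rel cf (Q u) (P p)"
    using correspond_fs gen_Lops unfolding Lops_def by cases metis+
qed (blast intro: rel_fun_diff coeff_diff)+

lemma Lops_to_Ds_ops:
  assumes "Q \<in> Lops A f x"
  shows "\<exists>P\<in>Ds_ops A f x. \<forall>u p. rel cf u p \<longrightarrow> rel cf (Q u) (P p)"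
  using assms unfolding Ds_ops_def Lops_def
proof (rule ring_gen_correspond)
  fix Q assume "Q \<in> D_gens A pmul (Mf_dx f) x \<union> {Mf_s f}"
  then consider g where "g \<in> O_stalk A x" "Q = pmul g" | c i where "c \<in> A" "x \<in> fst c" "Q = Mf_dx f c i" | "Q = Mf_s f"
    by (auto simp: D_gens_def)
  moreover have "g \<in> O_stalk A x \<Longrightarrow> pmul g \<in> ring_gen (D_gens A pmul (fs_dx f) x \<union> {pshift})"
    "c \<in> A \<Longrightarrow> x \<in> fst c \<Longrightarrow> fs_dx f c i \<in> ring_gen (D_gens A pmul (fs_dx f) x \<union> {pshift})"
    "pshift \<in> ring_gen (D_gens A pmul (fs_dx f) x \<union> {pshift})" for g c i
    unfolding D_gens_def by (intro ring_gen.gen; blast)+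
  ultimately show "\<exists>P\<in>ring_gen (D_gens A pmul (fs_dx f) x \<union> {pshift}). \<forall>u p. rel cf u p \<longrightarrow> rel cf (Q u) (P p)"
    using correspond_fs by cases metis+
qed (blast intro: rel_fun_diff coeff_diff)+

section \<open>Comparison with O[1/f] f^(-\<alpha>)\<close>

abbreviation "ev z \<equiv> (\<lambda>(_ :: unit) p. poly p z :: complex)"

lemma pow_ops_to_Lops:
  assumes "P \<in> ring_gen (D_gens A (*) (pow_dx f \<alpha>) x)"
  shows "\<exists>Q\<in>Lops A f x. \<forall>u g. rel (ev (- of_rat \<alpha>)) u (\<lambda>_. g) \<longrightarrow> rel (ev (- of_rat \<alpha>)) (Q u) (\<lambda>_. P g)"
  using assms unfolding Lops_def
proof (rule ring_gen_correspond)
  fix P assume "P \<in> D_gens A (*) (pow_dx f \<alpha>) x"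
  then consider g where "g \<in> O_stalk A x" "P = (*) g" | c i where "c \<in> A" "x \<in> fst c" "P = pow_dx f \<alpha> c i"
    by (auto simp: D_gens_def)
  then show "\<exists>Q\<in>ring_gen (D_gens A pmul (Mf_dx f) x \<union> {Mf_s f}).
      \<forall>u g. rel (ev (- of_rat \<alpha>)) u (\<lambda>_. g) \<longrightarrow> rel (ev (- of_rat \<alpha>)) (Q u) (\<lambda>_. P g)"
  proof cases
    case 1
    have "rel (ev (- of_rat \<alpha>)) (pmul g u) (\<lambda>_. P h)" if "rel (ev (- of_rat \<alpha>)) u (\<lambda>_. h)" for u h
      using rel_pmul[OF _ that 1(1)] by (simp add: 1(2) times_fun_def)
    then show ?thesis using gen_Lops(1)[OF 1(1)] unfolding Lops_def by blast
  next
    case 2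
    have "rel (ev (- of_rat \<alpha>)) (Mf_dx f c i u) (\<lambda>_. P h)" if "rel (ev (- of_rat \<alpha>)) u (\<lambda>_. h)" for u h
      by (rule rel_dxI[OF 2(1,2) that]) (auto simp: 2(3) pow_dx_def)
    then show ?thesis using gen_Lops(2)[OF 2(1,2)] unfolding Lops_def by blast
  qed
next
  fix P P' Q Q'
  assume PQ: "\<forall>u g. rel (ev (- of_rat \<alpha>)) u (\<lambda>_. g) \<longrightarrow> rel (ev (- of_rat \<alpha>)) (Q u) (\<lambda>_. P g)"
    "\<forall>u g. rel (ev (- of_rat \<alpha>)) u (\<lambda>_. g) \<longrightarrow> rel (ev (- of_rat \<alpha>)) (Q' u) (\<lambda>_. P' g)"
  show "\<forall>u g. rel (ev (- of_rat \<alpha>)) u (\<lambda>_. g) \<longrightarrow> rel (ev (- of_rat \<alpha>)) (Q u - Q' u) (\<lambda>_. P g - P' g)"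
  proof (intro allI impI)
    fix u g assume "rel (ev (- of_rat \<alpha>)) u (\<lambda>_. g)"
    then have "rel (ev (- of_rat \<alpha>)) (Q u) (\<lambda>_. P g)" "rel (ev (- of_rat \<alpha>)) (Q' u) (\<lambda>_. P' g)"
      using PQ by blast+
    from rel_diff[OF _ this] show "rel (ev (- of_rat \<alpha>)) (Q u - Q' u) (\<lambda>_. P g - P' g)"
      by (simp add: fun_diff_def)
  qed
qed blast+

lemma rel_pconst: "h \<in> O_stalk A x \<Longrightarrow> rel cf (pconst h) (pconst h)"
  unfolding rel_def Psi_pconst using pconst_M
  by (auto simp: pconst_apply coeff_pCons split: nat.split)

text \<open>Injectivity of the map from M_f to O[1/f][s] f^s: \<open>Psi_inj\<close> off Z, then
  density.\<close>

lemma rel_zero_germ: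
  assumes "rel cf u p" "rel cf v p"
  shows "geq u v"
proof -
  have d: "u - v \<in> M" "\<forall>\<^sub>F y in nhds x. f y \<noteq> 0 \<longrightarrow> (\<forall>k. 0 = coeff (Psi f (u - v) y) k)"
    using rel_diff[OF _ assms] by (simp_all add: rel_def)
  have "\<forall>\<^sub>F y in nhds x. f y \<noteq> 0 \<longrightarrow> (\<forall>k. (u - v) k y = 0)"
    using d(2) M_bound[OF d(1)]
  proof eventually_elim
    case (elim y)
    then obtain K where K: "\<forall>k>K. (u - v) k y = 0" by blast
    show ?case
    proof
      assume "f y \<noteq> 0"
      moreover from this have "Psi f (u - v) y = 0" using elim by (simp add: poly_eq_iff)
      ultimately show "\<forall>k. (u - v) k y = 0" using Psi_inj[where u = "u - v", OF K] by blast
    qed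
  qed
  then have "geq (u - v) 0" by (rule M_zero_off[OF d(1)])
  from germ_eq_add[OF this germ_eq_refl[of x v]] show ?thesis by simp
qed

text \<open>Malgrange's description of b_f through the action of s on L / t L, with \<delta> in the
  place of f^s. Injectivity is used to pass from f^s back to M_f.\<close>

lemma b_equation_iff_Lf:
  "(\<exists>P\<in>Ds_ops A f x. \<forall>\<^sub>F y in nhds x. f y \<noteq> 0 \<longrightarrow> (\<forall>k. coeff b k = P (pconst f) k y)) \<longleftrightarrow>
   sact f b (pconst (\<lambda>_. 1)) \<in> Lf"
proof -
  have one: "rel cf (sact f b (pconst (\<lambda>_. 1))) (\<lambda>k y. coeff b k)"
    using rel_sact[OF rel_pconst[OF const_O_stalk[of 1]], of b] by (simp add: Psi_pconst flip: one_pCons)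
  have rf: "rel cf (pconst f) (pconst f)" by (rule rel_pconst[OF O_f])
  show ?thesis
  proof
    assume "\<exists>P\<in>Ds_ops A f x. \<forall>\<^sub>F y in nhds x. f y \<noteq> 0 \<longrightarrow> (\<forall>k. coeff b k = P (pconst f) k y)"
    then obtain P where P: "P \<in> Ds_ops A f x" "\<forall>\<^sub>F y in nhds x. f y \<noteq> 0 \<longrightarrow> (\<forall>k. coeff b k = P (pconst f) k y)" by blast
    obtain Q where Q: "Q \<in> Lops A f x" "rel cf (Q (pconst f)) (P (pconst f))"
      using Ds_ops_to_Lops[OF P(1)] rf by blast
    have "geq (Q (pconst f)) (sact f b (pconst (\<lambda>_. 1)))"
      by (rule rel_zero_germ[OF Q(2) rel_cong[OF one P(2)]])
    then show "sact f b (pconst (\<lambda>_. 1)) \<in> Lf" using L_germ L_op[OF Q(1) L_gen[OF O_f]] by blast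
  next
    assume "sact f b (pconst (\<lambda>_. 1)) \<in> Lf"
    then obtain Q where Q: "Q \<in> Lops A f x" "geq (sact f b (pconst (\<lambda>_. 1))) (Q (pconst f))" by (auto simp: L_def)
    obtain P where P: "P \<in> Ds_ops A f x" "rel cf (Q (pconst f)) (P (pconst f))"
      using Lops_to_Ds_ops[OF Q(1)] rf by blast
    have 1: "\<forall>\<^sub>F y in nhds x. f y \<noteq> 0 \<longrightarrow> (\<forall>k. P (pconst f) k y = coeff (Psi f (Q (pconst f)) y) k)"
      using P(2) by (simp add: rel_def)
    have 2: "\<forall>\<^sub>F y in nhds x. f y \<noteq> 0 \<longrightarrow> (\<forall>k. coeff b k = coeff (Psi f (sact f b (pconst (\<lambda>_. 1))) y) k)"
      using one by (simp add: rel_def)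
    have "\<forall>\<^sub>F y in nhds x. f y \<noteq> 0 \<longrightarrow> (\<forall>k. coeff b k = P (pconst f) k y)"
      using 1 2 Q(2)[unfolded germ_eq_def]
      by eventually_elim (simp add: Psi_def)
    with P(1) show "\<exists>P\<in>Ds_ops A f x. \<forall>\<^sub>F y in nhds x. f y \<noteq> 0 \<longrightarrow> (\<forall>k. coeff b k = P (pconst f) k y)" by blast
  qed
qed

text \<open>
  As \<open>(s + \<alpha>) (h \<partial>\<^sub>t\<^sup>k \<delta>) = (k + \<alpha>) h \<partial>\<^sub>t\<^sup>k \<delta> - f h \<partial>\<^sub>t\<^sup>k\<^sup>+\<^sup>1 \<delta>\<close> with \<open>k + \<alpha> \<noteq> 0\<close>, modulo the image of \<open>s + \<alpha>\<close>
  all terms can be moved to the top degree.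
\<close>

lemma divide_by_s:
  assumes \<alpha>: "\<alpha> > (0 :: rat)" and u: "rel (ev (- of_rat \<alpha>)) u (\<lambda>_ _. 0)"
  shows "\<exists>w\<in>M. geq u (sact f [:of_rat \<alpha>, 1:] w)"
proof -
  have uM: "u \<in> M" using u by (simp add: rel_def)
  obtain K where K: "\<forall>\<^sub>F y in nhds x. \<forall>k>K. u k y = 0" using uM by (auto simp: Mf_def)
  have nz: "of_nat k + of_rat \<alpha> \<noteq> (0 :: complex)" for k
  proof -
    have "of_rat (of_nat k + \<alpha>) \<noteq> (0 :: complex)" using \<alpha> by simp
    then show ?thesis by (simp only: of_rat_add of_rat_of_nat_eq not_False_eq_True)
  qed
  \<comment> \<open>The remainder v lives in degrees i to K; each step cancels degree i at the cost
    of degree i + 1.\<close>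
  have "\<exists>w\<in>M. \<exists>v\<in>M. geq u (v + sact f [:of_rat \<alpha>, 1:] w) \<and> (\<forall>k y. k < i \<or> k > K \<longrightarrow> v k y = 0)" if "i \<le> K" for i
    using that
  proof (induction i)
    case 0
    define v where "v = (\<lambda>k y. if k \<le> K then u k y else 0)"
    have uv: "geq u v" using K unfolding germ_eq_def by eventually_elim (auto simp: v_def)
    then have "v \<in> M" using M_germ[OF uM] by blast
    moreover have "v + sact f [:of_rat \<alpha>, 1:] 0 = v"
      using sact_diff_right[of f "[:of_rat \<alpha>, 1:]" 0 0] by simp
    ultimately show ?case using uv M_0 by (intro bexI[of _ 0] bexI[of _ v]) (auto simp: v_def)
  next
    case (Suc i)
    then obtain w v where wv: "w \<in> M" "v \<in> M" "geq u (v + sact f [:of_rat \<alpha>, 1:] w)"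
      and v0: "\<And>k y. k < i \<or> k > K \<Longrightarrow> v k y = 0" by force
    define m where "m = (pshift ^^ i) (pconst (v i))"
    define w1 where "w1 = pmul (\<lambda>_. 1 / (of_nat i + of_rat \<alpha>)) m"
    have "(pshift ^^ n) (pconst (v i)) \<in> M" for n
      by (induction n) (auto intro: M_dt pconst_M M_O[OF wv(2)])
    then have "m \<in> M" unfolding m_def .
    then have w1: "w1 \<in> M" unfolding w1_def by (intro M_pmul const_O_stalk)
    let ?v = "v - sact f [:of_rat \<alpha>, 1:] w1"
    have s: "sact f [:of_rat \<alpha>, 1:] w1 k y = 1 / (of_nat i + of_rat \<alpha>) *
        ((of_nat k + of_rat \<alpha>) * m k y - f y * (if k = 0 then 0 else m (k - 1) y))" for k y
      unfolding w1_def sact_pmul by (simp add: sact_linear op_apply algebra_simps)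
    have m: "m k y = (if k = i then v i y else 0)" for k y
      unfolding m_def by (rule pshift_pow_pconst)
    have "?v k y = 0" if k: "k < Suc i \<or> k > K" for k y
    proof (cases "k = i")
      case True
      then show ?thesis using nz[of i] by (cases i) (simp_all add: minus_apply s m)
    next
      case False
      then have "k < i \<or> k > Suc i" using k Suc.prems by auto
      then show ?thesis using v0[of k y] k False by (auto simp: minus_apply s m)
    qed
    moreover have "geq u (?v + sact f [:of_rat \<alpha>, 1:] (w + w1))"
      using wv(3) by (simp add: sact_add_right algebra_simps)
    moreover have "?v \<in> M" by (intro M_diff M_sact wv w1)
    ultimately show ?case using M_add[OF wv(1) w1] by blast
  qed
  from this[of K] obtain w v where wv: "w \<in> M" "v \<in> M" "geq u (v + sact f [:of_rat \<alpha>, 1:] w)"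
    and v0: "\<And>k y. k < K \<or> k > K \<Longrightarrow> v k y = 0" by blast
  have "rel (ev (- of_rat \<alpha>)) w (\<lambda>_ y. poly (Psi f w y) (- of_rat \<alpha>))" using wv(1) by (simp add: rel_def)
  from rel_sact[OF this, of "[:of_rat \<alpha>, 1:]"] have "rel (ev (- of_rat \<alpha>)) (sact f [:of_rat \<alpha>, 1:] w) (\<lambda>_ _. 0)"
    by simp
  from rel_diff[OF _ u this] have d: "rel (ev (- of_rat \<alpha>)) (u - sact f [:of_rat \<alpha>, 1:] w) (\<lambda>_ _. 0)" by simp
  have uv: "geq (u - sact f [:of_rat \<alpha>, 1:] w) v"
    using germ_eq_diff[OF wv(3) germ_eq_refl[of x "sact f [:of_rat \<alpha>, 1:] w"]] by simp
  have "\<forall>\<^sub>F y in nhds x. f y \<noteq> 0 \<longrightarrow> 0 = poly (Psi f (u - sact f [:of_rat \<alpha>, 1:] w) y) (- of_rat \<alpha>)"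
    using d unfolding rel_def by simp
  then have "\<forall>\<^sub>F y in nhds x. f y \<noteq> 0 \<longrightarrow> poly (Psi f v y) (- of_rat \<alpha>) = 0"
    using uv[unfolded germ_eq_def] by eventually_elim (simp add: Psi_def)
  then have "\<forall>\<^sub>F y in nhds x. f y \<noteq> 0 \<longrightarrow> (\<forall>k. v k y = 0)"
  proof eventually_elim
    case (elim y)
    show ?case
    proof
      assume fy: "f y \<noteq> 0"
      have "Psi f v y = (\<Sum>i\<in>{K}. smult (v i y / f y ^ i) (s_poly i))"
      proof -
        have "i = K" if "v i y \<noteq> 0" for i
          using v0[of i y] that by (cases i K rule: linorder_cases) blast+
        then have "{i. v i y \<noteq> 0} \<subseteq> {K}" by blast
        then show ?thesis unfolding Psi_def by (intro sum.mono_neutral_left) auto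
      qed
      \<comment> \<open>Only the top degree is left, and \<open>s_poly K\<close> takes at -\<alpha>
        the product of the numbers l + \<alpha> as its value.\<close>
      then have "v K y / f y ^ K * (\<Prod>l<K. of_nat l + of_rat \<alpha>) = 0"
        using elim fy by (simp add: poly_s_poly)
      moreover have "(\<Prod>l<K. of_nat l + of_rat \<alpha> :: complex) \<noteq> 0" using nz by (simp add: prod_zero_iff)
      ultimately have vK: "v K y = 0" using fy by simp
      have "v k y = 0" for k
        using v0[of k y] vK by (cases k K rule: linorder_cases) blast+
      then show "\<forall>k. v k y = 0" ..
    qed
  qed
  then have "geq v 0" by (rule M_zero_off[OF wv(2)])
  then have "geq (v + sact f [:of_rat \<alpha>, 1:] w) (sact f [:of_rat \<alpha>, 1:] w)"
    using germ_eq_add[OF _ germ_eq_refl[of x "sact f [:of_rat \<alpha>, 1:] w"]] by fastforce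
  with wv show ?thesis using germ_eq_trans by blast
qed

text \<open>Equality of the modules writes the generator 1 as P f with P in D_X. For the partner Q
  of P the section \<delta> - Q (f \<delta>) vanishes at s = -\<alpha>, hence is divisible by s +
  \<alpha>.\<close>

lemma D_pow_eq_imp:
  assumes "\<alpha> > 0" "D_pow A f \<alpha> (\<lambda>_. 1) = D_pow A f \<alpha> f"
  shows "\<exists>w\<in>M. \<exists>l\<in>Lf. geq (pconst (\<lambda>_. 1)) (l + sact f [:of_rat \<alpha>, 1:] w)"
proof -
  let ?e = "ev (- of_rat \<alpha>)"
  have "(\<lambda>_. 1) \<in> D_pow A f \<alpha> (\<lambda>_. 1) x"
    unfolding D_pow_def germ_eq_off_def by (intro CollectI bexI[of _ "\<lambda>u. u"] ring_gen.one) simp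
  then obtain P where P: "P \<in> ring_gen (D_gens A (*) (pow_dx f \<alpha>) x)" "germ_eq_off f x (\<lambda>_. 1) (P f)"
    unfolding assms(2) D_pow_def by blast
  obtain Q where Q: "Q \<in> Lops A f x" "\<And>u g. rel ?e u (\<lambda>_. g) \<Longrightarrow> rel ?e (Q u) (\<lambda>_. P g)"
    using pow_ops_to_Lops[OF P(1)] by blast
  have rel_h: "rel ?e (pconst h) (\<lambda>_. h)" if "h \<in> O_stalk A x" for h
    using pconst_M[OF that] by (simp add: rel_def Psi_pconst)
  have "rel ?e (pconst (\<lambda>_. 1) - Q (pconst f)) (\<lambda>_ y. 1 - P f y)"
    using rel_diff[OF _ rel_h[OF const_O_stalk[of 1]] Q(2)[OF rel_h[OF O_f]]] by simp
  then have "rel ?e (pconst (\<lambda>_. 1) - Q (pconst f)) (\<lambda>_ _. 0)"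
    by (rule rel_cong) (use P(2) in \<open>auto simp: germ_eq_off_def elim!: eventually_mono\<close>)
  then obtain w where w: "w \<in> M" "geq (pconst (\<lambda>_. 1) - Q (pconst f)) (sact f [:of_rat \<alpha>, 1:] w)"
    using divide_by_s[OF assms(1)] by blast
  have "geq (pconst (\<lambda>_. 1)) (Q (pconst f) + sact f [:of_rat \<alpha>, 1:] w)"
    using germ_eq_add[OF w(2) germ_eq_refl[of x "Q (pconst f)"]] by (simp add: add.commute)
  then show ?thesis using w(1) L_op[OF Q(1) L_gen[OF O_f]] by blast
qed

text \<open>Since s + 1 = -t \<partial>_t and t M_f is stable under D_X[s], both summands lie in t
  M_f. In \<delta> = t z the coefficient z_1 vanishes, which leaves f z_0 = 1.\<close>

lemma t_quotient_imp:
  assumes "w \<in> M" "l \<in> Lf" "geq (pconst (\<lambda>_. 1)) (l + sact f [:1, 1:] w)"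
  shows "pconst (\<lambda>_. 1) \<in> Lf"
proof -
  define T where "T = {v. \<exists>u\<in>M. geq v (t u)}"
  have T: "P v \<in> T" if "P \<in> Lops A f x" "v \<in> T" for P v
    using that unfolding Lops_def
  proof (induction arbitrary: v)
    case (gen P)
    then obtain u where u: "u \<in> M" "geq v (t u)" by (auto simp: T_def)
    consider g where "g \<in> O_stalk A x" "P = pmul g" | c i where "c \<in> A" "x \<in> fst c" "P = Mf_dx f c i" | "P = Mf_s f"
      using gen.hyps by (auto simp: D_gens_def)
    then show ?case
    proof cases
      case 1
      have "geq (P v) (t (pmul g u))" using germ_eq_pmul[OF u(2), of g] by (simp add: 1 Mf_t_pmul)
      then show ?thesis unfolding T_def using M_pmul[OF 1(1) u(1)] by blast
    next
      case 2
      then show ?thesis unfolding T_def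
        using germ_eq_trans[OF germ_eq_dx[OF 2(1,2) u(2)] germ_eq_sym[OF t_dx[OF 2(1,2) u(1)]]]
          M_dx[OF 2(1,2) u(1)] by blast
    next
      case 3
      have "Mf_s f (t u) = t (Mf_s f u - u)" by (simp add: Mf_t_diff Mf_t_s)
      then show ?thesis unfolding T_def
        using germ_eq_s[OF u(2), of f] M_diff[OF M_s[OF u(1)] u(1)] 3 by auto
    qed
  next
    case (diff P Q)
    then have "P v \<in> T" "Q v \<in> T" by blast+
    then obtain u u' where "u \<in> M" "geq (P v) (t u)" "u' \<in> M" "geq (Q v) (t u')" by (auto simp: T_def)
    then have "u - u' \<in> M" "geq (P v - Q v) (t (u - u'))"
      unfolding Mf_t_diff by (blast intro: M_diff germ_eq_diff)+
    then show ?case unfolding T_def by blast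
  qed auto
  have "pconst f = t (pconst (\<lambda>_. 1))" by (simp add: Mf_t_pconst pmul_pconst)
  then have "pconst f \<in> T"
    unfolding T_def using pconst_M[OF const_O_stalk[of 1]] germ_eq_refl[of x "pconst f"] by auto
  moreover obtain P where P: "P \<in> Lops A f x" "geq l (P (pconst f))" using assms(2) by (auto simp: L_def)
  ultimately obtain u where u: "u \<in> M" "geq (P (pconst f)) (t u)" using T by (auto simp: T_def)
  have "sact f [:1, 1:] w = 0 - t (pshift w)"
    unfolding Mf_t_dt sact_linear by (intro ext) (auto simp: op_apply)
  then have "geq (l + sact f [:1, 1:] w) (t u + (0 - t (pshift w)))"
    using germ_eq_add[OF germ_eq_trans[OF P(2) u(2)] germ_eq_refl] by metis
  from germ_eq_trans[OF assms(3) this] have "geq (pconst (\<lambda>_. 1)) (t (u - pshift w))"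
    by (simp add: Mf_t_diff)
  then obtain z where z: "z \<in> M" "geq (pconst (\<lambda>_. 1)) (t z)" using M_diff[OF u(1) M_dt[OF assms(1)]] by blast
  obtain K where K: "\<forall>\<^sub>F y in nhds x. \<forall>k>K. z k y = 0" using z(1) by (auto simp: Mf_def)
  have "\<forall>\<^sub>F y in nhds x. f y \<noteq> 0 \<longrightarrow> z 1 y = 0"
    using K z(2)[unfolded germ_eq_def]
  proof eventually_elim
    case (elim y)
    show ?case
    proof
      assume fy: "f y \<noteq> 0"
      \<comment> \<open>As \<delta> has no terms of positive degree, f z_(k+1) = (k + 2) z_(k+2),
        and vanishing descends from the top.\<close>
      have "z (Suc k) y = 0" if "k \<le> K" for k
        using that
      proof (induction k rule: inc_induct)
        case base
        then show ?case using elim by blast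
      next
        case (step k)
        from elim(2)[rule_format, of "Suc k"] have "t z (Suc k) y = 0" by (simp add: pconst_apply)
        with step.IH fy show ?case by (simp add: op_apply)
      qed
      from this[of 0] show "z 1 y = 0" by simp
    qed
  qed
  then have "\<forall>\<^sub>F y in nhds x. z 1 y = 0" by (rule O_stalk_zero_off[OF M_O[OF z(1)]])
  then have "geq (pmul (z 0) (pconst f)) (pconst (\<lambda>_. 1))"
    using z(2) unfolding germ_eq_def
  proof eventually_elim
    case (elim y)
    from elim(2)[rule_format, of 0] elim(1) have "f y * z 0 y = 1" by (simp add: pconst_apply Mf_t_apply)
    then show ?case by (simp add: pmul_apply pconst_apply mult.commute)
  qed
  then show ?thesis using L_germ[OF L_pmul[OF M_O[OF z(1)] L_gen[OF O_f]]] by blast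
qed

text \<open>Applying r (s + \<alpha>)^m to \<delta> = l + (s + \<alpha>) w shows that this
  polynomial carries \<delta> into t L, and so does (s + \<alpha>)^(m+1) c. Bezout for r and s +
  \<alpha> combines the two into (s + \<alpha>)^m c.\<close>

lemma reduced_in_Lf:
  assumes \<alpha>: "\<alpha> = \<beta> + of_nat j" "\<beta> > 0" "\<alpha> \<noteq> 1"
    and N: "\<And>u. u \<in> V \<beta> x \<Longrightarrow> sact f ([:of_rat \<beta>, 1:] ^ Suc m) u \<in> Mt_den f V \<beta> x"
    and w: "w \<in> M" "l \<in> Lf" "geq (pconst (\<lambda>_. 1)) (l + sact f [:of_rat \<alpha>, 1:] w)"
    and b: "sact f ([:of_rat \<alpha>, 1:] ^ Suc m * c) (pconst (\<lambda>_. 1)) \<in> Lf"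
  shows "sact f ([:of_rat \<alpha>, 1:] ^ m * c) (pconst (\<lambda>_. 1)) \<in> Lf"
proof -
  define p where "p = [:of_rat \<alpha> :: complex, 1:]"
  define d :: "nat \<Rightarrow> 'a \<Rightarrow> complex" where "d = pconst (\<lambda>_. 1)"
  have j: "\<beta> = 1 \<Longrightarrow> j > 0" using \<alpha> by (cases j) auto
  obtain r where r: "poly r (- of_rat \<alpha>) \<noteq> 0" "sact f (r * p ^ Suc m) w \<in> Lf"
    using eigen_part_in_Lf[OF \<alpha>(2) j w(1) N] unfolding \<alpha>(1) p_def by blast
  have "geq (sact f (r * p ^ m) d) (sact f (r * p ^ m) (l + sact f p w))"
    using w(3) unfolding d_def p_def by (rule germ_eq_sact)
  moreover have "sact f (r * p ^ m) (l + sact f p w) = sact f (r * p ^ m) l + sact f (r * p ^ Suc m) w"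
    unfolding sact_add_right sact_mult[symmetric] by (simp add: mult_ac)
  moreover have "sact f (r * p ^ m) l + sact f (r * p ^ Suc m) w \<in> Lf"
    by (intro L_add O_f L_sact w(2) r(2))
  ultimately have rd: "sact f (r * p ^ m) d \<in> Lf" using L_germ germ_eq_sym by metis
  obtain q where q: "\<And>u. u = sact f (smult (1 / poly r (- of_rat \<alpha>)) r) u + sact f p (sact f q u)"
    using sact_split_root[OF r(1)] unfolding p_def by auto
  let ?k = "1 / poly r (- of_rat \<alpha>)"
  have "sact f (p ^ m * c) d = sact f (smult ?k r * (p ^ m * c)) d + sact f (p * q * (p ^ m * c)) d"
    using q[of "sact f (p ^ m * c) d"] unfolding sact_mult .
  also have "smult ?k r * (p ^ m * c) = smult ?k c * (r * p ^ m)" by (simp add: mult_ac)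
  also have "p * q * (p ^ m * c) = q * (p ^ Suc m * c)" by (simp add: mult_ac)
  also have "sact f (smult ?k c * (r * p ^ m)) d + sact f (q * (p ^ Suc m * c)) d \<in> Lf"
    unfolding sact_mult[of f "smult ?k c"] sact_mult[of f q]
    by (intro L_add O_f L_sact[OF O_f rd] L_sact[OF O_f b[folded p_def d_def]])
  finally show ?thesis unfolding p_def d_def .
qed

end

section \<open>Contradiction to the minimality of b_f\<close>

theorem theorem3:
  fixes A :: "('a::{t2_space, second_countable_topology}, 'n::finite) chart set"
    and f :: "'a \<Rightarrow> complex"
    and b :: "complex poly"
    and V :: "'a filtration"
    and \<alpha> \<beta> :: rat
    and j :: nat
  assumes "complex_atlas A"
    and "CARD('n) \<ge> 2"
    and "\<forall>x. hol_at A f x"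
    and "\<forall>C\<in>components (UNIV :: 'a set). \<exists>x\<in>C. f x \<noteq> 0"
    and "is_bernstein_sato_poly A f b"
    and "is_V_filtration A f V"
    and "\<alpha> > 0"
    and "\<alpha> = \<beta> + of_nat j"
    and "0 < \<beta>" and "\<beta> \<le> 1"
    and "N_nilpotent f V \<beta>"
    and "poly b (- of_rat \<alpha>) = 0"
    and "order (- of_rat \<alpha>) b = m_tilde f V \<beta>"
  shows "D_pow A f \<alpha> (\<lambda>_. 1) \<noteq> D_pow A f \<alpha> f"
proof
  assume eq: "D_pow A f \<alpha> (\<lambda>_. 1) = D_pow A f \<alpha> f"
  have VF: "V_filtration A f V"
    by unfold_locales (use assms in auto)
  let ?d = "pconst (\<lambda>_. 1) :: nat \<Rightarrow> 'a \<Rightarrow> complex"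
  have b: "b_equation A f b" "lead_coeff b = 1"
    and min: "\<And>b'. lead_coeff b' = 1 \<Longrightarrow> b_equation A f b' \<Longrightarrow> degree b \<le> degree b'"
    using assms(5) by (auto simp: is_bernstein_sato_poly_def)
  have b0: "b \<noteq> 0" using b(2) by auto
  have b_eq: "b_equation A f p \<longleftrightarrow> (\<forall>x. sact f p ?d \<in> V_filtration.L A f x f)" for p
    unfolding b_equation_def V_filtration.b_equation_iff_Lf[OF VF] ..
  have quot: "\<exists>w\<in>Mf A x. \<exists>l\<in>V_filtration.L A f x f. germ_eq x ?d (l + sact f [:of_rat \<alpha>, 1:] w)" for x
    by (rule V_filtration.D_pow_eq_imp[OF VF assms(7) eq])
  show False
  \<comment> \<open>This value means \<beta> = 1 and j = 0, where no factor t is available for the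
    kernel of N.\<close>
  proof (cases "\<alpha> = 1")
    case True
    have "?d \<in> V_filtration.L A f x f" for x
      using quot[of x] V_filtration.t_quotient_imp[OF VF] True by auto
    then have "b_equation A f 1" unfolding b_eq by (simp add: sact_1)
    then have "degree b = 0" using min[of 1] by simp
    then obtain a where "b = [:a:]" by (rule degree_eq_zeroE)
    with b0 assms(12) show False by simp
  next
    case False
    define m where "m = m_tilde f V \<beta>"
    \<comment> \<open>A root has positive multiplicity, so that there is a factor s + \<alpha> to
      remove.\<close>
    have "m \<noteq> 0" using assms(12,13) b0 order_root[of b "- of_rat \<alpha>"] by (simp add: m_def)
    then obtain m' where m': "m = Suc m'" by (cases m) auto
    let ?P = "\<lambda>k. \<forall>x. \<forall>\<xi>\<in>Mt f V \<beta> x. (induced (Mt_den f V \<beta> x) (N_op f \<beta>) ^^ k) \<xi> = Mt_den f V \<beta> x"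
    obtain k where "\<forall>x. \<forall>\<xi>\<in>Gr V \<beta> x. (induced (V_gt V \<beta> x) (N_op f \<beta>) ^^ k) \<xi> = V_gt V \<beta> x"
      using assms(11) unfolding N_nilpotent_def by blast
    then have "?P k"
      unfolding V_filtration.Mt_nilpotent_iff[OF VF] using V_filtration.Gr_nilpotent_imp[OF VF] by blast
    then have "?P m" unfolding m_def m_tilde_def by (rule LeastI)
    then have N: "\<And>x u. u \<in> V \<beta> x \<Longrightarrow> sact f ([:of_rat \<beta>, 1:] ^ Suc m') u \<in> Mt_den f V \<beta> x"
      unfolding V_filtration.Mt_nilpotent_iff[OF VF] m' by blast
    obtain c where c: "b = [:of_rat \<alpha>, 1:] ^ Suc m' * c"
      using order_1[of "- of_rat \<alpha>" b] assms(13) unfolding m_def[symmetric] m' by (auto elim: dvdE)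
    let ?b = "[:of_rat \<alpha>, 1:] ^ m' * c"
    have "sact f ?b ?d \<in> V_filtration.L A f x f" for x
    proof -
      obtain w l where "w \<in> Mf A x" "l \<in> V_filtration.L A f x f" "germ_eq x ?d (l + sact f [:of_rat \<alpha>, 1:] w)"
        using quot by blast
      moreover have "sact f ([:of_rat \<alpha>, 1:] ^ Suc m' * c) ?d \<in> V_filtration.L A f x f"
        using b(1) unfolding b_eq c[symmetric] by blast
      ultimately show ?thesis
        using V_filtration.reduced_in_Lf[OF VF assms(8,9) False N] by blast
    qed
    then have "b_equation A f ?b" unfolding b_eq by blast
    moreover have b': "b = [:of_rat \<alpha>, 1:] * ?b" unfolding c by (simp add: mult_ac)
    then have "lead_coeff ?b = 1" using b(2) by (simp add: lead_coeff_mult del: mult_pCons_left)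
    ultimately have "degree b \<le> degree ?b" using min by blast
    moreover have "degree b = 1 + degree ?b"
      using b0 unfolding b' by (subst degree_mult_eq) auto
    ultimately show False by simp
  qed
qed

end
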